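(* Let $A$ be a $C^*$-algebra and suppose that $\alpha:\mathbb{N}\to \operatorname{End}(A)$ is an action of the additive semigroup $\mathbb{N}$ by extendible injective endomorphisms such that $\alpha_n$ has hereditary range for all $n\in \mathbb{N}$. Let $L$ be the action by transfer operators given by $L_n(a)=\alpha_n^{-1}(\overline{\alpha_n}(1)a\overline{\alpha_n}(1))$, let $X_{\mathbb{N}}$ be the product system over $\mathbb{N}$ of Hilbert bimodules over $A$ associated to $(A, \mathbb{N}, \alpha, L)$, and let $K_n=\overline{A\alpha_n(A)A}$ for $n\in \mathbb{N}$. Then the relative Cuntz-Pimsner algebra of $X_{\mathbb{N}}$ corresponding to the family of ideals $(K_n)_n$ is isomorphic to the relative Cuntz-Pimsner algebra $\mathcal{O}(X_1, K_1)$, where $X_1$ is the bimodule at the fibre $n=1$.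
   Context: $\mathbb{N}$ is the additive semigroup with identity $0$. $A$ is not necessarily unital; $M(A)$ is its multiplier algebra with unit $1$. An action is a semigroup homomorphism ($\alpha_{m+n}=\alpha_m\circ\alpha_n$, $\alpha_0=\operatorname{id}$). An endomorphism $\alpha_n$ is extendible if it extends uniquely to an endomorphism $\overline{\alpha_n}$ of $M(A)$ with $\overline{\alpha_n}(1_{M(A)})=\lim\alpha_n(u_\lambda)$ (strict limit) for some (hence every) approximate unit $(u_\lambda)$ of $A$. The maps $L_n$ are positive, linear, continuous, satisfy $L_{m+n}=L_m\circ L_n$ and $L_n(\alpha_n(a)b)=aL_n(b)$. For a subset $E$ of a $C^*$-algebra, $\overline{E}$ denotes its closed linear span. Hilbert bimodules: a Hilbert bimodule over $A$ is a right Hilbert $A$-module $Y$ with a homomorphism $\phi:A\to\mathcal{L}(Y)$ giving the left action $a\cdot y=\phi(a)y$. $\mathcal{K}(Y)$ is the closed span of the operators $\theta_{u,v}(w)=u\cdot\langle v,w\rangle$. The product system $X_{\mathbb{N}}$: for $n\in\mathbb{N}$ put $A_n:=A\overline{\alpha_n}(1)$ with right action $x\cdot a:=x\alpha_n(a)$ and pre-inner product $\langle x,y\rangle_n:=L_n(x^*y)$; let $M_n$ be the right Hilbert $A$-module obtained by quotienting by $\{x:\langle x,x\rangle_n=0\}$ and completing; left multiplication $x\mapsto ax$ extends to $\phi_n:A\to\mathcal{L}(M_n)$. Set $X_n:=\{n\}\times M_n$ and $X_{\mathbb{N}}:=\bigsqcup_n X_n$, with multiplication $X_m\times X_n\to X_{m+n}$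 extending $(m,a\overline{\alpha_m}(1))(n,b\overline{\alpha_n}(1))=(m+n,a\alpha_m(b\overline{\alpha_n}(1)))$ by continuity. Here $X_0=A$. Toeplitz representations: a Toeplitz representation of a Hilbert bimodule $Y$ over $A$ in a $C^*$-algebra $B$ is a pair $(\psi,\pi)$ of a linear map $\psi:Y\to B$ and a homomorphism $\pi:A\to B$ with $\psi(u\cdot a)=\psi(u)\pi(a)$, $\psi(u)^*\psi(v)=\pi(\langle u,v\rangle)$, $\psi(a\cdot u)=\pi(a)\psi(u)$; it determines a homomorphism $\psi^{(1)}:\mathcal{K}(Y)\to B$ with $\psi^{(1)}(\theta_{u,v})=\psi(u)\psi(v)^*$. For an ideal $K$ of $A$ with $\phi(K)\subset\mathcal{K}(Y)$, the pair is coisometric on $K$ if $\psi^{(1)}(\phi(a))=\pi(a)$ for all $a\in K$. The relative Cuntz-Pimsner algebra $\mathcal{O}(Y,K)$ is the $C^*$-algebra generated by a universal Toeplitz representation of $Y$ that is coisometric on $K$. A Toeplitz representation of $X_{\mathbb{N}}$ in $B$ is a map $\psi:X_{\mathbb{N}}\to B$ with $\psi(u)\psi(v)=\psi(uv)$ for all $u,v$ such that $(\psi_n,\psi_0):=(\psi|_{X_n},\psi|_{X_0})$ is a Toeplitz representation of the bimodule $X_n$ for every $n$. It is coisometric on a family of ideals $(K_n)_n$ of $A$ with $K_n\subset\phi_n^{-1}(\mathcal{K}(X_n))$ if $(\psi_n,\psi_0)$ is coisometric on $K_n$ for every $n$. The relative Cuntz-Pimsner algebra of $X_{\mathbb{N}}$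 corresponding to $(K_n)_n$ is the $C^*$-algebra generated by a universal Toeplitz representation of $X_{\mathbb{N}}$ that is coisometric on $(K_n)_n$. (For the ideals $K_n$ in the claim the inclusion $K_n\subset\phi_n^{-1}(\mathcal{K}(X_n))$ holds.) *)

theory Defs
  imports "HOL-Analysis.Analysis" "HOL-Algebra.Module"
begin

section \<open>$C^*$-algebras on explicit carriers\<close>

text \<open>
  Vector spaces are HOL-Algebra modules over the ring of complex numbers. As there, the
  inherited record fields that play no role in a structure are ignored: the field \<^term>\<open>one\<close> of a
  $C^*$-algebra that is not known to be unital, and \<^term>\<open>one\<close> and \<^term>\<open>mult\<close> of a Hilbert
  module.
\<close>

definition complex_ring :: "complex ring" where
  "complex_ring = \<lparr>carrier = UNIV, mult = (*), one = 1, zero = 0, add = (+)\<rparr>"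

record 'a cstar = "(complex, 'a) module" +
  star :: "'a \<Rightarrow> 'a"
  nrm :: "'a \<Rightarrow> real"

text \<open>The distance is set to 0 off the carrier, as the locale \<^locale>\<open>Metric_space\<close> requires
  symmetry and nonnegativity on the whole type.\<close>

definition ndist :: "'a cstar \<Rightarrow> 'a \<Rightarrow> 'a \<Rightarrow> real" where
  "ndist A x y =
     (if x \<in> carrier A \<and> y \<in> carrier A then nrm A (x \<ominus>\<^bsub>A\<^esub> y) else 0)"

abbreviation ntop :: "'a cstar \<Rightarrow> 'a topology" where
  "ntop A \<equiv> Metric_space.mtopology (carrier A) (ndist A)"

locale cstar_algebra = Module.module complex_ring A for A :: "'a cstar" (structure) +
  assumes m_closed: "\<lbrakk>x \<in> carrier A; y \<in> carrier A\<rbrakk> \<Longrightarrow> x \<otimes> y \<in> carrier A"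
    and m_assoc: "\<lbrakk>x \<in> carrier A; y \<in> carrier A; z \<in> carrier A\<rbrakk>
      \<Longrightarrow> (x \<otimes> y) \<otimes> z = x \<otimes> (y \<otimes> z)"
    and l_distr: "\<lbrakk>x \<in> carrier A; y \<in> carrier A; z \<in> carrier A\<rbrakk>
      \<Longrightarrow> (x \<oplus> y) \<otimes> z = x \<otimes> z \<oplus> y \<otimes> z"
    and r_distr: "\<lbrakk>x \<in> carrier A; y \<in> carrier A; z \<in> carrier A\<rbrakk>
      \<Longrightarrow> z \<otimes> (x \<oplus> y) = z \<otimes> x \<oplus> z \<otimes> y"
    and smult_mult_l: "\<lbrakk>x \<in> carrier A; y \<in> carrier A\<rbrakk>
      \<Longrightarrow> (c \<odot> x) \<otimes> y = c \<odot> (x \<otimes> y)"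
    and smult_mult_r: "\<lbrakk>x \<in> carrier A; y \<in> carrier A\<rbrakk>
      \<Longrightarrow> x \<otimes> (c \<odot> y) = c \<odot> (x \<otimes> y)"
    and star_closed: "x \<in> carrier A \<Longrightarrow> star A x \<in> carrier A"
    and star_star: "x \<in> carrier A \<Longrightarrow> star A (star A x) = x"
    and star_add: "\<lbrakk>x \<in> carrier A; y \<in> carrier A\<rbrakk>
      \<Longrightarrow> star A (x \<oplus> y) = star A x \<oplus> star A y"
    and star_smult: "x \<in> carrier A \<Longrightarrow> star A (c \<odot> x) = cnj c \<odot> star A x"
    and star_mult: "\<lbrakk>x \<in> carrier A; y \<in> carrier A\<rbrakk>
      \<Longrightarrow> star A (x \<otimes> y) = star A y \<otimes> star A x"
    and nrm_nonneg: "x \<in> carrier A \<Longrightarrow> 0 \<le> nrm A x"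
    and nrm_eq_0: "x \<in> carrier A \<Longrightarrow> nrm A x = 0 \<longleftrightarrow> x = \<zero>"
    and nrm_triangle: "\<lbrakk>x \<in> carrier A; y \<in> carrier A\<rbrakk>
      \<Longrightarrow> nrm A (x \<oplus> y) \<le> nrm A x + nrm A y"
    and nrm_smult: "x \<in> carrier A \<Longrightarrow> nrm A (c \<odot> x) = cmod c * nrm A x"
    and nrm_mult: "\<lbrakk>x \<in> carrier A; y \<in> carrier A\<rbrakk>
      \<Longrightarrow> nrm A (x \<otimes> y) \<le> nrm A x * nrm A y"
    and cstar_identity: "x \<in> carrier A \<Longrightarrow> nrm A (star A x \<otimes> x) = (nrm A x)\<^sup>2"
    and complete: "Metric_space.mcomplete (carrier A) (ndist A)"

definition cstar_hom :: "'a cstar \<Rightarrow> 'b cstar \<Rightarrow> ('a \<Rightarrow> 'b) set" where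
  "cstar_hom A B = {f \<in> carrier A \<rightarrow> carrier B.
     (\<forall>x\<in>carrier A. \<forall>y\<in>carrier A.
        f (x \<oplus>\<^bsub>A\<^esub> y) = f x \<oplus>\<^bsub>B\<^esub> f y \<and> f (x \<otimes>\<^bsub>A\<^esub> y) = f x \<otimes>\<^bsub>B\<^esub> f y) \<and>
     (\<forall>c. \<forall>x\<in>carrier A. f (c \<odot>\<^bsub>A\<^esub> x) = c \<odot>\<^bsub>B\<^esub> f x) \<and>
     (\<forall>x\<in>carrier A. f (star A x) = star B (f x))}"

definition cstar_isomorphic :: "'a cstar \<Rightarrow> 'b cstar \<Rightarrow> bool" where
  "cstar_isomorphic A B \<longleftrightarrow> (\<exists>h \<in> cstar_hom A B. bij_betw h (carrier A) (carrier B))"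

definition lin_span :: "'a cstar \<Rightarrow> 'a set \<Rightarrow> 'a set" where
  "lin_span A S = \<Inter>{H. submodule H complex_ring A \<and> S \<subseteq> H}"

definition closed_span :: "'a cstar \<Rightarrow> 'a set \<Rightarrow> 'a set" where
  "closed_span A S = Abstract_Topology.closure_of (ntop A) (lin_span A S)"

definition cstar_subalgebra :: "'a set \<Rightarrow> 'a cstar \<Rightarrow> bool" where
  "cstar_subalgebra S A \<longleftrightarrow> submodule S complex_ring A \<and>
     (\<forall>x\<in>S. \<forall>y\<in>S. x \<otimes>\<^bsub>A\<^esub> y \<in> S) \<and> (\<forall>x\<in>S. star A x \<in> S) \<and> closedin (ntop A) S"

definition cstar_generated :: "'a cstar \<Rightarrow> 'a set \<Rightarrow> 'a set" where
  "cstar_generated A G = \<Inter>{S. cstar_subalgebra S A \<and> G \<subseteq> S}"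

definition positive :: "'a cstar \<Rightarrow> 'a \<Rightarrow> bool" where
  "positive A a \<longleftrightarrow> (\<exists>c\<in>carrier A. a = star A c \<otimes>\<^bsub>A\<^esub> c)"

definition hereditary_subalgebra :: "'a set \<Rightarrow> 'a cstar \<Rightarrow> bool" where
  "hereditary_subalgebra S A \<longleftrightarrow> cstar_subalgebra S A \<and>
     (\<forall>a\<in>carrier A. \<forall>b\<in>S. positive A a \<and> positive A (b \<ominus>\<^bsub>A\<^esub> a) \<longrightarrow> a \<in> S)"


section \<open>Multiplier algebras and extendible endomorphisms\<close>

text \<open>\<open>M(A)\<close> as the algebra of double centralizers: \<open>(l, r)\<close> stands for the multiplier \<open>m\<close>
  with \<open>m a = l a\<close> and \<open>a m = r a\<close>.\<close>

definition star_conj :: "'a cstar \<Rightarrow> ('a \<Rightarrow> 'a) \<Rightarrow> 'a \<Rightarrow> 'a" where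
  "star_conj A f = (\<lambda>a\<in>carrier A. star A (f (star A a)))"

definition multiplier :: "'a cstar \<Rightarrow> (('a \<Rightarrow> 'a) \<times> ('a \<Rightarrow> 'a)) cstar" where
  "multiplier A =
    \<lparr>carrier = {(l, r). l \<in> carrier A \<rightarrow>\<^sub>E carrier A \<and> r \<in> carrier A \<rightarrow>\<^sub>E carrier A \<and>
        (\<forall>a\<in>carrier A. \<forall>b\<in>carrier A. a \<otimes>\<^bsub>A\<^esub> l b = r a \<otimes>\<^bsub>A\<^esub> b)},
     mult = (\<lambda>(l, r) (l', r'). (compose (carrier A) l l', compose (carrier A) r' r)),
     one = (\<lambda>a\<in>carrier A. a, \<lambda>a\<in>carrier A. a),
     zero = (\<lambda>a\<in>carrier A. \<zero>\<^bsub>A\<^esub>, \<lambda>a\<in>carrier A. \<zero>\<^bsub>A\<^esub>),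
     add = (\<lambda>(l, r) (l', r'). (\<lambda>a\<in>carrier A. l a \<oplus>\<^bsub>A\<^esub> l' a, \<lambda>a\<in>carrier A. r a \<oplus>\<^bsub>A\<^esub> r' a)),
     smult = (\<lambda>c (l, r). (\<lambda>a\<in>carrier A. c \<odot>\<^bsub>A\<^esub> l a, \<lambda>a\<in>carrier A. c \<odot>\<^bsub>A\<^esub> r a)),
     star = (\<lambda>(l, r). (star_conj A r, star_conj A l)),
     nrm = (\<lambda>(l, r). Sup {nrm A (l a) | a. a \<in> carrier A \<and> nrm A a \<le> 1})\<rparr>"

definition mult_emb :: "'a cstar \<Rightarrow> 'a \<Rightarrow> ('a \<Rightarrow> 'a) \<times> ('a \<Rightarrow> 'a)" where
  "mult_emb A a = (\<lambda>b\<in>carrier A. a \<otimes>\<^bsub>A\<^esub> b, \<lambda>b\<in>carrier A. b \<otimes>\<^bsub>A\<^esub> a)"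

definition strict_limit ::
  "'a cstar \<Rightarrow> ('i \<Rightarrow> ('a \<Rightarrow> 'a) \<times> ('a \<Rightarrow> 'a)) \<Rightarrow> ('a \<Rightarrow> 'a) \<times> ('a \<Rightarrow> 'a) \<Rightarrow> 'i filter \<Rightarrow> bool"
  where
  "strict_limit A f m F \<longleftrightarrow> (\<forall>a\<in>carrier A.
     ((\<lambda>i. nrm A (fst (f i) a \<ominus>\<^bsub>A\<^esub> fst m a)) \<longlongrightarrow> 0) F \<and>
     ((\<lambda>i. nrm A (snd (f i) a \<ominus>\<^bsub>A\<^esub> snd m a)) \<longlongrightarrow> 0) F)"

text \<open>A net in \<open>A\<close> is represented by its filter of tails (sets that eventually contain the
  net); all notions of convergence used below depend on this filter only.\<close>

definition approximate_unit :: "'a cstar \<Rightarrow> 'a filter \<Rightarrow> bool" where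
  "approximate_unit A F \<longleftrightarrow> F \<noteq> bot \<and>
     (\<forall>\<^sub>F u in F. u \<in> carrier A \<and> positive A u \<and> nrm A u \<le> 1) \<and>
     (\<forall>a\<in>carrier A. ((\<lambda>u. nrm A (u \<otimes>\<^bsub>A\<^esub> a \<ominus>\<^bsub>A\<^esub> a)) \<longlongrightarrow> 0) F \<and>
        ((\<lambda>u. nrm A (a \<otimes>\<^bsub>A\<^esub> u \<ominus>\<^bsub>A\<^esub> a)) \<longlongrightarrow> 0) F)"

definition is_extension ::
  "'a cstar \<Rightarrow> ('a \<Rightarrow> 'a) \<Rightarrow>
   (('a \<Rightarrow> 'a) \<times> ('a \<Rightarrow> 'a) \<Rightarrow> ('a \<Rightarrow> 'a) \<times> ('a \<Rightarrow> 'a)) \<Rightarrow> bool" where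
  "is_extension A f g \<longleftrightarrow>
     g \<in> cstar_hom (multiplier A) (multiplier A) \<inter> extensional (carrier (multiplier A)) \<and>
     (\<forall>a\<in>carrier A. g (mult_emb A a) = mult_emb A (f a)) \<and>
     (\<exists>F. approximate_unit A F \<and>
        strict_limit A (\<lambda>u. mult_emb A (f u)) (g \<one>\<^bsub>multiplier A\<^esub>) F)"

definition extendible :: "'a cstar \<Rightarrow> ('a \<Rightarrow> 'a) \<Rightarrow> bool" where
  "extendible A f \<longleftrightarrow> (\<exists>!g. is_extension A f g)"

definition ext_one :: "'a cstar \<Rightarrow> ('a \<Rightarrow> 'a) \<Rightarrow> ('a \<Rightarrow> 'a) \<times> ('a \<Rightarrow> 'a)" where
  "ext_one A f = (THE g. is_extension A f g) \<one>\<^bsub>multiplier A\<^esub>"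

definition endo_action :: "'a cstar \<Rightarrow> (nat \<Rightarrow> 'a \<Rightarrow> 'a) \<Rightarrow> bool" where
  "endo_action A \<alpha> \<longleftrightarrow> (\<forall>n. \<alpha> n \<in> cstar_hom A A) \<and> (\<forall>a\<in>carrier A. \<alpha> 0 a = a) \<and>
     (\<forall>m n. \<forall>a\<in>carrier A. \<alpha> (m + n) a = \<alpha> m (\<alpha> n a))"

text \<open>With \<open>p = ext_one A (\<alpha> n)\<close>, the argument of the inverse is \<open>p a p\<close>.\<close>

definition transfer_op :: "'a cstar \<Rightarrow> (nat \<Rightarrow> 'a \<Rightarrow> 'a) \<Rightarrow> nat \<Rightarrow> 'a \<Rightarrow> 'a" where
  "transfer_op A \<alpha> n a = the_inv_into (carrier A) (\<alpha> n)
     (snd (ext_one A (\<alpha> n)) (fst (ext_one A (\<alpha> n)) a))"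


section \<open>Hilbert bimodules\<close>

text \<open>\<open>ip\<close> is the \<open>A\<close>-valued inner product, conjugate linear in its first argument.\<close>

record ('a, 'y) hbimod = "(complex, 'y) module" +
  ract :: "'y \<Rightarrow> 'a \<Rightarrow> 'y"
  ip :: "'y \<Rightarrow> 'y \<Rightarrow> 'a"
  lact :: "'a \<Rightarrow> 'y \<Rightarrow> 'y"

definition hnorm :: "'a cstar \<Rightarrow> ('a, 'y) hbimod \<Rightarrow> 'y \<Rightarrow> real" where
  "hnorm A Y y = sqrt (nrm A (ip Y y y))"

definition is_adjoint :: "('a, 'y) hbimod \<Rightarrow> ('y \<Rightarrow> 'y) \<Rightarrow> ('y \<Rightarrow> 'y) \<Rightarrow> bool" where
  "is_adjoint Y T S \<longleftrightarrow>
     (\<forall>x\<in>carrier Y. \<forall>y\<in>carrier Y. ip Y (T x) y = ip Y x (S y))"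

definition adjointables :: "'a cstar \<Rightarrow> ('a, 'y) hbimod \<Rightarrow> ('y \<Rightarrow> 'y) cstar" where
  "adjointables A Y =
    \<lparr>carrier = {T \<in> carrier Y \<rightarrow>\<^sub>E carrier Y. \<exists>S \<in> carrier Y \<rightarrow>\<^sub>E carrier Y. is_adjoint Y T S},
     mult = compose (carrier Y),
     one = (\<lambda>y\<in>carrier Y. y),
     zero = (\<lambda>y\<in>carrier Y. \<zero>\<^bsub>Y\<^esub>),
     add = (\<lambda>T S. \<lambda>y\<in>carrier Y. T y \<oplus>\<^bsub>Y\<^esub> S y),
     smult = (\<lambda>c T. \<lambda>y\<in>carrier Y. c \<odot>\<^bsub>Y\<^esub> T y),
     star = (\<lambda>T. THE S. S \<in> carrier Y \<rightarrow>\<^sub>E carrier Y \<and> is_adjoint Y T S),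
     nrm = (\<lambda>T. Sup {hnorm A Y (T y) | y. y \<in> carrier Y \<and> hnorm A Y y \<le> 1})\<rparr>"

definition theta :: "('a, 'y) hbimod \<Rightarrow> 'y \<Rightarrow> 'y \<Rightarrow> 'y \<Rightarrow> 'y" where
  "theta Y u v = (\<lambda>w\<in>carrier Y. ract Y u (ip Y v w))"

definition compacts :: "'a cstar \<Rightarrow> ('a, 'y) hbimod \<Rightarrow> ('y \<Rightarrow> 'y) cstar" where
  "compacts A Y = (adjointables A Y)
     \<lparr>carrier := closed_span (adjointables A Y) {theta Y u v | u v. u \<in> carrier Y \<and> v \<in> carrier Y}\<rparr>"

definition left_action :: "('a, 'y) hbimod \<Rightarrow> 'a \<Rightarrow> 'y \<Rightarrow> 'y" where
  "left_action Y a = (\<lambda>y\<in>carrier Y. lact Y a y)"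


section \<open>Toeplitz representations and relative Cuntz-Pimsner algebras of a bimodule\<close>

definition toeplitz_rep ::
  "'a cstar \<Rightarrow> ('a, 'y) hbimod \<Rightarrow> 'b cstar \<Rightarrow> ('y \<Rightarrow> 'b) \<Rightarrow> ('a \<Rightarrow> 'b) \<Rightarrow> bool" where
  "toeplitz_rep A Y B \<psi> \<pi> \<longleftrightarrow>
     \<psi> \<in> carrier Y \<rightarrow> carrier B \<and>
     (\<forall>u\<in>carrier Y. \<forall>v\<in>carrier Y. \<psi> (u \<oplus>\<^bsub>Y\<^esub> v) = \<psi> u \<oplus>\<^bsub>B\<^esub> \<psi> v) \<and>
     (\<forall>c. \<forall>u\<in>carrier Y. \<psi> (c \<odot>\<^bsub>Y\<^esub> u) = c \<odot>\<^bsub>B\<^esub> \<psi> u) \<and>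
     \<pi> \<in> cstar_hom A B \<and>
     (\<forall>u\<in>carrier Y. \<forall>a\<in>carrier A. \<psi> (ract Y u a) = \<psi> u \<otimes>\<^bsub>B\<^esub> \<pi> a) \<and>
     (\<forall>u\<in>carrier Y. \<forall>v\<in>carrier Y. star B (\<psi> u) \<otimes>\<^bsub>B\<^esub> \<psi> v = \<pi> (ip Y u v)) \<and>
     (\<forall>a\<in>carrier A. \<forall>u\<in>carrier Y. \<psi> (lact Y a u) = \<pi> a \<otimes>\<^bsub>B\<^esub> \<psi> u)"

definition rep_compacts ::
  "'a cstar \<Rightarrow> ('a, 'y) hbimod \<Rightarrow> 'b cstar \<Rightarrow> ('y \<Rightarrow> 'b) \<Rightarrow> ('y \<Rightarrow> 'y) \<Rightarrow> 'b" where
  "rep_compacts A Y B \<psi> = (THE h.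
     h \<in> cstar_hom (compacts A Y) B \<inter> extensional (carrier (compacts A Y)) \<and>
     (\<forall>u\<in>carrier Y. \<forall>v\<in>carrier Y. h (theta Y u v) = \<psi> u \<otimes>\<^bsub>B\<^esub> star B (\<psi> v)))"

definition coisometric ::
  "'a cstar \<Rightarrow> ('a, 'y) hbimod \<Rightarrow> 'a set \<Rightarrow> 'b cstar \<Rightarrow> ('y \<Rightarrow> 'b) \<Rightarrow> ('a \<Rightarrow> 'b) \<Rightarrow> bool" where
  "coisometric A Y K B \<psi> \<pi> \<longleftrightarrow>
     (\<forall>a\<in>K. rep_compacts A Y B \<psi> (left_action Y a) = \<pi> a)"

text \<open>
  \<open>D\<close>, with the representation \<open>(i, j)\<close>, is a relative Cuntz-Pimsner algebra \<open>O(Y, K)\<close>: it is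
  generated by a universal Toeplitz representation that is coisometric on \<open>K\<close>. HOL has no
  quantification over types, so the test algebras \<open>C\<close> range over all $C^*$-algebras whose
  carrier is a subset of the type \<open>'b\<close> underlying \<open>D\<close>. For every sufficiently large \<open>'b\<close> this is
  the unrestricted universal property, as each representation generates a $C^*$-algebra whose
  cardinality is bounded in terms of \<open>A\<close> and \<open>Y\<close>.
\<close>

definition relative_cuntz_pimsner ::
  "'a cstar \<Rightarrow> ('a, 'y) hbimod \<Rightarrow> 'a set \<Rightarrow> 'b cstar \<Rightarrow> ('y \<Rightarrow> 'b) \<Rightarrow> ('a \<Rightarrow> 'b) \<Rightarrow> bool" where
  "relative_cuntz_pimsner A Y K D i j \<longleftrightarrow>
     cstar_algebra D \<and> toeplitz_rep A Y D i j \<and> coisometric A Y K D i j \<and>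
     cstar_generated D (i ` carrier Y \<union> j ` carrier A) = carrier D \<and>
     (\<forall>(C :: 'b cstar) \<psi> \<pi>.
        cstar_algebra C \<and> toeplitz_rep A Y C \<psi> \<pi> \<and> coisometric A Y K C \<psi> \<pi> \<longrightarrow>
        (\<exists>\<rho> \<in> cstar_hom D C.
           (\<forall>u\<in>carrier Y. \<rho> (i u) = \<psi> u) \<and> (\<forall>a\<in>carrier A. \<rho> (j a) = \<pi> a)))"


section \<open>Product systems over the natural numbers\<close>

text \<open>
  \<open>fibre X n\<close> is the bimodule over \<open>n\<close>; the product system itself is the disjoint union
  \<open>ps_carrier X\<close> of the \<open>{n} \<times> fibre X n\<close>. The map \<open>ps_coeff X\<close> is the identification of \<open>A\<close>
  with the fibre over 0.
\<close>

record ('a, 'y) product_system =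
  fibre :: "nat \<Rightarrow> ('a, 'y) hbimod"
  ps_mult :: "nat \<times> 'y \<Rightarrow> nat \<times> 'y \<Rightarrow> nat \<times> 'y"
  ps_coeff :: "'a \<Rightarrow> 'y"

definition ps_carrier :: "('a, 'y) product_system \<Rightarrow> (nat \<times> 'y) set" where
  "ps_carrier X = (SIGMA n:UNIV. carrier (fibre X n))"

definition fibre_rep :: "(nat \<times> 'y \<Rightarrow> 'b) \<Rightarrow> nat \<Rightarrow> 'y \<Rightarrow> 'b" where
  "fibre_rep \<psi> n = (\<lambda>y. \<psi> (n, y))"

definition coeff_rep ::
  "('a, 'y) product_system \<Rightarrow> (nat \<times> 'y \<Rightarrow> 'b) \<Rightarrow> 'a \<Rightarrow> 'b" where
  "coeff_rep X \<psi> = (\<lambda>a. \<psi> (0, ps_coeff X a))"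

definition ps_toeplitz_rep ::
  "'a cstar \<Rightarrow> ('a, 'y) product_system \<Rightarrow> 'b cstar \<Rightarrow> (nat \<times> 'y \<Rightarrow> 'b) \<Rightarrow> bool" where
  "ps_toeplitz_rep A X B \<psi> \<longleftrightarrow>
     (\<forall>u\<in>ps_carrier X. \<forall>v\<in>ps_carrier X. \<psi> u \<otimes>\<^bsub>B\<^esub> \<psi> v = \<psi> (ps_mult X u v)) \<and>
     (\<forall>n. toeplitz_rep A (fibre X n) B (fibre_rep \<psi> n) (coeff_rep X \<psi>))"

definition ps_coisometric ::
  "'a cstar \<Rightarrow> ('a, 'y) product_system \<Rightarrow> (nat \<Rightarrow> 'a set) \<Rightarrow> 'b cstar \<Rightarrow> (nat \<times> 'y \<Rightarrow> 'b) \<Rightarrow> bool"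
  where
  "ps_coisometric A X K B \<psi> \<longleftrightarrow>
     (\<forall>n. coisometric A (fibre X n) (K n) B (fibre_rep \<psi> n) (coeff_rep X \<psi>))"

definition ps_relative_cuntz_pimsner ::
  "'a cstar \<Rightarrow> ('a, 'y) product_system \<Rightarrow> (nat \<Rightarrow> 'a set) \<Rightarrow> 'b cstar \<Rightarrow> (nat \<times> 'y \<Rightarrow> 'b) \<Rightarrow> bool"
  where
  "ps_relative_cuntz_pimsner A X K D i \<longleftrightarrow>
     cstar_algebra D \<and> ps_toeplitz_rep A X D i \<and> ps_coisometric A X K D i \<and>
     cstar_generated D (i ` ps_carrier X) = carrier D \<and>
     (\<forall>(C :: 'b cstar) \<psi>.
        cstar_algebra C \<and> ps_toeplitz_rep A X C \<psi> \<and> ps_coisometric A X K C \<psi> \<longrightarrow>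
        (\<exists>\<rho> \<in> cstar_hom D C. \<forall>u\<in>ps_carrier X. \<rho> (i u) = \<psi> u))"


section \<open>The product system of a system with transfer operators\<close>

text \<open>
  \<open>pre_module A \<alpha> n\<close> is \<open>A p\<close> for \<open>p = ext_one A (\<alpha> n)\<close>. Its Hausdorff completion \<open>M_n\<close> (the
  quotient by the null vectors, completed) is the set of Cauchy sequences for the seminorm
  \<open>pre_norm\<close> modulo sequences of distance tending to 0.
\<close>

definition pre_module :: "'a cstar \<Rightarrow> (nat \<Rightarrow> 'a \<Rightarrow> 'a) \<Rightarrow> nat \<Rightarrow> 'a set" where
  "pre_module A \<alpha> n = snd (ext_one A (\<alpha> n)) ` carrier A"

definition pre_ip :: "'a cstar \<Rightarrow> (nat \<Rightarrow> 'a \<Rightarrow> 'a) \<Rightarrow> nat \<Rightarrow> 'a \<Rightarrow> 'a \<Rightarrow> 'a" where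
  "pre_ip A L n x y = L n (star A x \<otimes>\<^bsub>A\<^esub> y)"

definition pre_norm :: "'a cstar \<Rightarrow> (nat \<Rightarrow> 'a \<Rightarrow> 'a) \<Rightarrow> nat \<Rightarrow> 'a \<Rightarrow> real" where
  "pre_norm A L n x = sqrt (nrm A (pre_ip A L n x x))"

definition cauchy_seqs ::
  "'a cstar \<Rightarrow> (nat \<Rightarrow> 'a \<Rightarrow> 'a) \<Rightarrow> (nat \<Rightarrow> 'a \<Rightarrow> 'a) \<Rightarrow> nat \<Rightarrow> (nat \<Rightarrow> 'a) set" where
  "cauchy_seqs A \<alpha> L n = {x. (\<forall>k. x k \<in> pre_module A \<alpha> n) \<and>
     (\<forall>e>0. \<exists>N. \<forall>k\<ge>N. \<forall>l\<ge>N. pre_norm A L n (x k \<ominus>\<^bsub>A\<^esub> x l) < e)}"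

definition cauchy_rel ::
  "'a cstar \<Rightarrow> (nat \<Rightarrow> 'a \<Rightarrow> 'a) \<Rightarrow> (nat \<Rightarrow> 'a \<Rightarrow> 'a) \<Rightarrow> nat \<Rightarrow> ((nat \<Rightarrow> 'a) \<times> (nat \<Rightarrow> 'a)) set" where
  "cauchy_rel A \<alpha> L n = {(x, y). x \<in> cauchy_seqs A \<alpha> L n \<and> y \<in> cauchy_seqs A \<alpha> L n \<and>
     (\<lambda>k. pre_norm A L n (x k \<ominus>\<^bsub>A\<^esub> y k)) \<longlonglongrightarrow> 0}"

definition cls ::
  "'a cstar \<Rightarrow> (nat \<Rightarrow> 'a \<Rightarrow> 'a) \<Rightarrow> (nat \<Rightarrow> 'a \<Rightarrow> 'a) \<Rightarrow> nat \<Rightarrow> (nat \<Rightarrow> 'a) \<Rightarrow> (nat \<Rightarrow> 'a) set" where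
  "cls A \<alpha> L n x = cauchy_rel A \<alpha> L n `` {x}"

definition rep :: "(nat \<Rightarrow> 'a) set \<Rightarrow> nat \<Rightarrow> 'a" where
  "rep \<xi> = (SOME x. x \<in> \<xi>)"

definition dyn_fibre ::
  "'a cstar \<Rightarrow> (nat \<Rightarrow> 'a \<Rightarrow> 'a) \<Rightarrow> (nat \<Rightarrow> 'a \<Rightarrow> 'a) \<Rightarrow> nat \<Rightarrow> ('a, (nat \<Rightarrow> 'a) set) hbimod" where
  "dyn_fibre A \<alpha> L n =
    \<lparr>carrier = cauchy_seqs A \<alpha> L n // cauchy_rel A \<alpha> L n,
     mult = undefined,
     one = undefined,
     zero = cls A \<alpha> L n (\<lambda>k. \<zero>\<^bsub>A\<^esub>),
     add = (\<lambda>\<xi> \<eta>. cls A \<alpha> L n (\<lambda>k. rep \<xi> k \<oplus>\<^bsub>A\<^esub> rep \<eta> k)),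
     smult = (\<lambda>c \<xi>. cls A \<alpha> L n (\<lambda>k. c \<odot>\<^bsub>A\<^esub> rep \<xi> k)),
     ract = (\<lambda>\<xi> a. cls A \<alpha> L n (\<lambda>k. rep \<xi> k \<otimes>\<^bsub>A\<^esub> \<alpha> n a)),
     ip = (\<lambda>\<xi> \<eta>. THE l. limitin (ntop A) (\<lambda>k. pre_ip A L n (rep \<xi> k) (rep \<eta> k)) l sequentially),
     lact = (\<lambda>a \<xi>. cls A \<alpha> L n (\<lambda>k. a \<otimes>\<^bsub>A\<^esub> rep \<xi> k))\<rparr>"

text \<open>
  On classes of constant sequences the product is \<open>(m, x) (n, y) = (m + n, x \<alpha>\<^sub>m(y))\<close> for
  \<open>x \<in> A p\<^sub>m\<close> and \<open>y \<in> A p\<^sub>n\<close>, where \<open>p\<^sub>k = ext_one A (\<alpha> k)\<close>; this is the formula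
  \<open>(m, a p\<^sub>m) (n, b p\<^sub>n) = (m + n, a \<alpha>\<^sub>m(b p\<^sub>n))\<close> since \<open>p\<^sub>m \<alpha>\<^sub>m(c) = \<alpha>\<^sub>m(c)\<close>.
  It is extended by continuity along the representing Cauchy sequences.
\<close>

definition dyn_product_system ::
  "'a cstar \<Rightarrow> (nat \<Rightarrow> 'a \<Rightarrow> 'a) \<Rightarrow> (nat \<Rightarrow> 'a \<Rightarrow> 'a) \<Rightarrow> ('a, (nat \<Rightarrow> 'a) set) product_system"
  where
  "dyn_product_system A \<alpha> L =
    \<lparr>fibre = dyn_fibre A \<alpha> L,
     ps_mult = (\<lambda>(m, \<xi>) (n, \<eta>).
       (m + n, cls A \<alpha> L (m + n) (\<lambda>k. rep \<xi> k \<otimes>\<^bsub>A\<^esub> \<alpha> m (rep \<eta> k)))),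
     ps_coeff = (\<lambda>a. cls A \<alpha> L 0 (\<lambda>k. a))\<rparr>"

definition range_ideal :: "'a cstar \<Rightarrow> (nat \<Rightarrow> 'a \<Rightarrow> 'a) \<Rightarrow> nat \<Rightarrow> 'a set" where
  "range_ideal A \<alpha> n = closed_span A
     {a \<otimes>\<^bsub>A\<^esub> \<alpha> n b \<otimes>\<^bsub>A\<^esub> c | a b c. a \<in> carrier A \<and> b \<in> carrier A \<and> c \<in> carrier A}"

end

theory Submission
  imports Defs
begin

text \<open>
  As \<open>\<alpha>\<^sub>n\<close> is injective with hereditary range, the module \<open>M\<^sub>n\<close> is the closed left ideal
  \<open>V\<^sub>n = A p\<^sub>n\<close> of \<open>A\<close> itself, the inner product of \<open>x\<close> and \<open>y\<close> being the
  \<open>\<alpha>\<^sub>n\<close>-preimage of \<open>x\<^sup>* y\<close>. Its compact operators are the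
  left multiplications by elements of \<open>K\<^sub>n\<close>, the closed span of the products \<open>x y\<^sup>*\<close> with \<open>x, y \<in> V\<^sub>n\<close>, so
  that a Toeplitz representation \<open>(\<psi>, \<pi>)\<close> of \<open>V\<^sub>n\<close> is coisometric on \<open>K\<^sub>n\<close> iff
  \<open>\<pi> (x y\<^sup>*) = \<psi> x (\<psi> y)\<^sup>*\<close>. Such a representation of \<open>V\<^sub>1\<close> extends to all fibres: since
  \<open>V\<^sub>n\<^sub>+\<^sub>1 \<subseteq> V\<^sub>n\<close>, one can put \<open>\<psi>\<^sub>n\<^sub>+\<^sub>1 x = lim \<psi>\<^sub>n x \<psi>\<^sub>1 (\<alpha>\<^sub>1 u)\<close> along an approximate unit, and all
  the identities wanted, coisometry included, pass to the limit by induction on \<open>n\<close>. The two universal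
  properties then give mutually inverse homomorphisms.

  Homomorphisms are contractive for an elementary reason: for selfadjoint \<open>h\<close> of norm below 1 there is a
  selfadjoint \<open>k\<close> commuting with \<open>h\<close> such that \<open>h\<^sup>2 + (1 - k)\<^sup>2 = 1\<close>, so \<open>f h\<close> is the real part of the
  unitary \<open>f h + i (1 - f k)\<close>.
\<close>

section \<open>Normed modules on carriers\<close>

text \<open>Heredity is what removes the quotient and the completion: for x, y in \<open>V n\<close>
  the element x^* y lies in the range of \<open>\<alpha> n\<close>, so the seminorm of the module is
  the norm of A and a class of Cauchy sequences amounts to its limit. The obstacle is that A and B
  may lack a unit, and that the isometry s with \<psi>(x) = \<pi>(x) s need not lie in B. Formulas
  with p_n or s are therefore replaced by limits along an approximate unit; where such a limit is
  not evident, it is found on a dense set and carried over by uniform contractivity. The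
  homomorphism \<psi>^(1) is not extended from finite sums of rank one operators, where
  well-definedness would be a norm estimate on matrices; instead its graph is described by a
  relation that is stable under limits and bounds the norm of the image by that of the argument. D
  and E live on the same type, so each can serve as test algebra in the universal property of the
  other.\<close>

lemma complex_ring_simps [simp]:
  "carrier complex_ring = UNIV" "mult complex_ring = (*)" "\<one>\<^bsub>complex_ring\<^esub> = 1"
  "\<zero>\<^bsub>complex_ring\<^esub> = 0" "add complex_ring = (+)"
  by (simp_all add: complex_ring_def)

text \<open>Both C^*-algebras and the adjointable operators on a Hilbert module are instances. For
  the operators this is the whole interface: the closed span defining the compacts is formed there,
  and they are nowhere shown to be a C^*-algebra.\<close>

locale normed_module = Module.module complex_ring M for M :: "'a cstar" (structure) +
  assumes nrm_ge0 [simp]: "x \<in> carrier M \<Longrightarrow> 0 \<le> nrm M x"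
    and nrm_eq0: "x \<in> carrier M \<Longrightarrow> nrm M x = 0 \<longleftrightarrow> x = \<zero>"
    and nrm_add_le: "\<lbrakk>x \<in> carrier M; y \<in> carrier M\<rbrakk> \<Longrightarrow> nrm M (x \<oplus> y) \<le> nrm M x + nrm M y"
    and nrm_scale: "x \<in> carrier M \<Longrightarrow> nrm M (c \<odot> x) = cmod c * nrm M x"

sublocale cstar_algebra \<subseteq> normed_module A
  by unfold_locales (simp_all add: nrm_nonneg nrm_eq_0 nrm_triangle nrm_smult)

text \<open>Along an approximate unit the terms lie in the carrier only eventually, and off the
  carrier \<open>nrm\<close> means nothing; hence the eventual membership. A filter covers sequences
  and nets alike.\<close>

definition nconv :: "'a cstar \<Rightarrow> ('i \<Rightarrow> 'a) \<Rightarrow> 'a \<Rightarrow> 'i filter \<Rightarrow> bool" where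
  "nconv M f x F \<longleftrightarrow> x \<in> carrier M \<and> (\<forall>\<^sub>F i in F. f i \<in> carrier M) \<and>
     ((\<lambda>i. nrm M (f i \<ominus>\<^bsub>M\<^esub> x)) \<longlongrightarrow> 0) F"

context normed_module
begin

lemma scale_add_left: "x \<in> carrier M \<Longrightarrow> (c + d) \<odot> x = c \<odot> x \<oplus> d \<odot> x"
  using smult_l_distr[of c d x] by simp

lemma scale_add_right:
  "\<lbrakk>x \<in> carrier M; y \<in> carrier M\<rbrakk> \<Longrightarrow> c \<odot> (x \<oplus> y) = c \<odot> x \<oplus> c \<odot> y"
  using smult_r_distr[of c x y] by simp

lemma scale_scale: "x \<in> carrier M \<Longrightarrow> c \<odot> (d \<odot> x) = (c * d) \<odot> x"
  using smult_assoc1[of c d x] by simp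

lemma scale_one [simp]: "x \<in> carrier M \<Longrightarrow> 1 \<odot> x = x"
  using smult_one[of x] by simp

lemma scale_0_left [simp]: "x \<in> carrier M \<Longrightarrow> 0 \<odot> x = \<zero>"
  using smult_l_null[of x] by simp

lemma neg_scale: "x \<in> carrier M \<Longrightarrow> \<ominus> x = (-1) \<odot> x"
  using scale_add_left[of x "-1" 1] by (intro minus_equality) simp_all

lemma minus_scale: "\<lbrakk>x \<in> carrier M; y \<in> carrier M\<rbrakk> \<Longrightarrow> x \<ominus> y = x \<oplus> (-1) \<odot> y"
  by (simp add: minus_eq neg_scale)

lemma minus_self [simp]: "x \<in> carrier M \<Longrightarrow> x \<ominus> x = \<zero>"
  by (simp add: minus_eq r_neg)

lemma minus_zero_right [simp]: "x \<in> carrier M \<Longrightarrow> x \<ominus> \<zero> = x"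
  by (simp add: minus_eq)

lemma minus_add_cancel: "\<lbrakk>x \<in> carrier M; y \<in> carrier M\<rbrakk> \<Longrightarrow> (x \<ominus> y) \<oplus> y = x"
  by (simp add: minus_eq a_assoc l_neg)

lemma minus_eq_zero:
  assumes "x \<in> carrier M" "y \<in> carrier M" shows "x \<ominus> y = \<zero> \<longleftrightarrow> x = y"
proof
  assume "x \<ominus> y = \<zero>"
  then show "x = y" using minus_add_cancel[OF assms] assms by simp
qed (use assms in simp)

lemma scale_minus: "\<lbrakk>x \<in> carrier M; y \<in> carrier M\<rbrakk> \<Longrightarrow> c \<odot> (x \<ominus> y) = c \<odot> x \<ominus> c \<odot> y"
  by (simp add: minus_scale scale_add_right scale_scale)

lemma add_minus_add:
  "\<lbrakk>x \<in> carrier M; y \<in> carrier M; x' \<in> carrier M; y' \<in> carrier M\<rbrakk>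
    \<Longrightarrow> (x \<oplus> y) \<ominus> (x' \<oplus> y') = (x \<ominus> x') \<oplus> (y \<ominus> y')"
  by (simp add: minus_scale scale_add_right a_ac)

lemma minus_add_minus:
  "\<lbrakk>x \<in> carrier M; y \<in> carrier M; z \<in> carrier M\<rbrakk> \<Longrightarrow> (x \<ominus> y) \<oplus> (y \<ominus> z) = x \<ominus> z"
  by (simp add: minus_eq a_assoc r_neg1)

lemma minus_minus_self: "\<lbrakk>x \<in> carrier M; y \<in> carrier M\<rbrakk> \<Longrightarrow> x \<ominus> (x \<ominus> y) = y"
  by (simp add: minus_eq minus_add r_neg1 r_neg2)

lemma minus_swap: "\<lbrakk>x \<in> carrier M; y \<in> carrier M\<rbrakk> \<Longrightarrow> y \<ominus> x = (-1) \<odot> (x \<ominus> y)"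
  by (simp add: minus_scale scale_add_right scale_scale a_comm)

lemma nrm_zero [simp]: "nrm M \<zero> = 0"
  using nrm_eq0 by simp

lemma nrm_pos: "\<lbrakk>x \<in> carrier M; x \<noteq> \<zero>\<rbrakk> \<Longrightarrow> 0 < nrm M x"
  using nrm_ge0[of x] nrm_eq0[of x] by linarith

lemma nrm_minus_commute: "\<lbrakk>x \<in> carrier M; y \<in> carrier M\<rbrakk> \<Longrightarrow> nrm M (x \<ominus> y) = nrm M (y \<ominus> x)"
  by (subst minus_swap) (simp_all add: nrm_scale)

lemma nrm_minus_triangle:
  "\<lbrakk>x \<in> carrier M; y \<in> carrier M; z \<in> carrier M\<rbrakk>
    \<Longrightarrow> nrm M (x \<ominus> z) \<le> nrm M (x \<ominus> y) + nrm M (y \<ominus> z)"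
  using nrm_add_le[of "x \<ominus> y" "y \<ominus> z"] by (simp add: minus_add_minus)

lemma nrm_minus_le: "\<lbrakk>x \<in> carrier M; y \<in> carrier M\<rbrakk> \<Longrightarrow> nrm M (x \<ominus> y) \<le> nrm M x + nrm M y"
  using nrm_add_le[of x "(-1) \<odot> y"] by (simp add: minus_scale nrm_scale)

lemma nrm_diff_le: "\<lbrakk>x \<in> carrier M; y \<in> carrier M\<rbrakk> \<Longrightarrow> nrm M x \<le> nrm M (x \<ominus> y) + nrm M y"
  using nrm_add_le[of "x \<ominus> y" y] by (simp add: minus_add_cancel)

lemma nrm_diff_eq0: "\<lbrakk>x \<in> carrier M; y \<in> carrier M\<rbrakk> \<Longrightarrow> nrm M (x \<ominus> y) = 0 \<longleftrightarrow> x = y"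
  by (simp add: nrm_eq0 minus_eq_zero)

lemma metric: "Metric_space (carrier M) (ndist M)"
proof
  fix x y z
  show "0 \<le> ndist M x y" by (simp add: ndist_def)
  show "ndist M x y = ndist M y x" by (simp add: ndist_def nrm_minus_commute)
  assume "x \<in> carrier M" "y \<in> carrier M"
  then show "(ndist M x y = 0) = (x = y)" by (simp add: ndist_def nrm_diff_eq0)
  assume "z \<in> carrier M"
  with \<open>x \<in> carrier M\<close> \<open>y \<in> carrier M\<close> show "ndist M x z \<le> ndist M x y + ndist M y z"
    by (simp add: ndist_def nrm_minus_triangle)
qed

lemma topspace_ntop [simp]: "topspace (ntop M) = carrier M"
  by (simp add: Metric_space.topspace_mtopology[OF metric])

section \<open>Convergence in norm along a filter\<close>

lemma nconv_closed: "nconv M f x F \<Longrightarrow> x \<in> carrier M"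
  by (simp add: nconv_def)

lemma nconv_eventually: "nconv M f x F \<Longrightarrow> \<forall>\<^sub>F i in F. f i \<in> carrier M"
  by (simp add: nconv_def)

lemma nconvI_le:
  assumes "x \<in> carrier M" "\<forall>\<^sub>F i in F. f i \<in> carrier M \<and> nrm M (f i \<ominus> x) \<le> g i" "(g \<longlongrightarrow> 0) F"
  shows "nconv M f x F"
  unfolding nconv_def
proof (intro conjI)
  show "\<forall>\<^sub>F i in F. f i \<in> carrier M" using assms(2) by (rule eventually_mono) simp
  show "((\<lambda>i. nrm M (f i \<ominus> x)) \<longlongrightarrow> 0) F"
    using assms(2) by (intro tendsto_sandwich[OF _ _ tendsto_const assms(3)])
      (auto elim!: eventually_mono simp: assms(1))
qed (fact assms)

lemma nconv_const: "x \<in> carrier M \<Longrightarrow> nconv M (\<lambda>_. x) x F"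
  by (simp add: nconv_def)

lemma nconv_cong:
  assumes "\<forall>\<^sub>F i in F. f i = g i" shows "nconv M f x F \<longleftrightarrow> nconv M g x F"
proof -
  have "(\<forall>\<^sub>F i in F. f i \<in> carrier M) \<longleftrightarrow> (\<forall>\<^sub>F i in F. g i \<in> carrier M)"
    by (rule eventually_cong[OF assms]) simp
  moreover have "((\<lambda>i. nrm M (f i \<ominus> x)) \<longlongrightarrow> 0) F \<longleftrightarrow> ((\<lambda>i. nrm M (g i \<ominus> x)) \<longlongrightarrow> 0) F"
    by (rule tendsto_cong, rule eventually_mono[OF assms]) simp
  ultimately show ?thesis by (simp add: nconv_def)
qed

lemma nconv_add:
  assumes "nconv M f x F" "nconv M g y F" shows "nconv M (\<lambda>i. f i \<oplus> g i) (x \<oplus> y) F"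
proof (rule nconvI_le)
  show "((\<lambda>i. nrm M (f i \<ominus> x) + nrm M (g i \<ominus> y)) \<longlongrightarrow> 0) F"
    using assms by (auto simp: nconv_def intro!: tendsto_add_zero)
  show "\<forall>\<^sub>F i in F. f i \<oplus> g i \<in> carrier M \<and>
      nrm M (f i \<oplus> g i \<ominus> (x \<oplus> y)) \<le> nrm M (f i \<ominus> x) + nrm M (g i \<ominus> y)"
    using assms[THEN nconv_eventually] by eventually_elim
      (use assms[THEN nconv_closed] in \<open>simp add: add_minus_add nrm_add_le\<close>)
qed (use assms[THEN nconv_closed] in simp)

lemma nconv_scale:
  assumes "nconv M f x F" shows "nconv M (\<lambda>i. c \<odot> f i) (c \<odot> x) F"
proof (rule nconvI_le)
  show "((\<lambda>i. cmod c * nrm M (f i \<ominus> x)) \<longlongrightarrow> 0) F"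
    using assms by (auto simp: nconv_def intro!: tendsto_mult_right_zero)
  show "\<forall>\<^sub>F i in F. c \<odot> f i \<in> carrier M \<and>
      nrm M (c \<odot> f i \<ominus> c \<odot> x) \<le> cmod c * nrm M (f i \<ominus> x)"
    using assms[THEN nconv_eventually] by eventually_elim
      (use assms[THEN nconv_closed] in \<open>simp add: scale_minus[symmetric] nrm_scale\<close>)
qed (use assms[THEN nconv_closed] in simp)

lemma nconv_minus:
  assumes "nconv M f x F" "nconv M g y F" shows "nconv M (\<lambda>i. f i \<ominus> g i) (x \<ominus> y) F"
proof -
  have "nconv M (\<lambda>i. f i \<oplus> (-1) \<odot> g i) (x \<oplus> (-1) \<odot> y) F"
    using assms by (intro nconv_add nconv_scale)
  moreover have "\<forall>\<^sub>F i in F. f i \<oplus> (-1) \<odot> g i = f i \<ominus> g i"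
    using assms[THEN nconv_eventually] by eventually_elim (simp add: minus_scale)
  ultimately show ?thesis
    using assms[THEN nconv_closed] by (simp add: minus_scale nconv_cong)
qed

lemma nconv_nrm:
  assumes "nconv M f x F" shows "((\<lambda>i. nrm M (f i)) \<longlongrightarrow> nrm M x) F"
proof -
  have "((\<lambda>i. nrm M (f i) - nrm M x) \<longlongrightarrow> 0) F"
  proof (rule Lim_null_comparison)
    show "((\<lambda>i. nrm M (f i \<ominus> x)) \<longlongrightarrow> 0) F" using assms by (simp add: nconv_def)
    show "\<forall>\<^sub>F i in F. norm (nrm M (f i) - nrm M x) \<le> nrm M (f i \<ominus> x)"
      using assms[THEN nconv_eventually]
    proof eventually_elim
      case (elim i)
      have x: "x \<in> carrier M" using assms by (rule nconv_closed)
      show ?case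
        using nrm_diff_le[OF elim x] nrm_diff_le[OF x elim] nrm_minus_commute[OF elim x]
        by (simp add: abs_if)
    qed
  qed
  then show ?thesis by (rule Lim_null[THEN iffD2])
qed

lemma nconv_unique:
  assumes "nconv M f x F" "nconv M f y F" "F \<noteq> bot" shows "x = y"
proof -
  have xy: "x \<in> carrier M" "y \<in> carrier M" using assms by (auto dest: nconv_closed)
  have "nconv M (\<lambda>i. f i \<ominus> f i) (x \<ominus> y) F" using assms by (intro nconv_minus)
  moreover have "\<forall>\<^sub>F i in F. f i \<ominus> f i = \<zero>"
    using assms(1)[THEN nconv_eventually] by eventually_elim simp
  ultimately have "nconv M (\<lambda>i. \<zero>) (x \<ominus> y) F" by (simp add: nconv_cong)
  from nconv_nrm[OF this] have "nrm M (x \<ominus> y) = 0"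
    using assms(3) by (simp add: tendsto_const_iff)
  then show ?thesis using xy by (simp add: nrm_diff_eq0)
qed

lemma nrm_limit_le:
  assumes "nconv M f x F" "F \<noteq> bot" "\<forall>\<^sub>F i in F. nrm M (f i) \<le> g i" "(g \<longlongrightarrow> c) F"
  shows "nrm M x \<le> c"
  using tendsto_le[OF assms(2,4) nconv_nrm[OF assms(1)] assms(3)] .

section \<open>Closures and closed linear spans through sequences\<close>

lemma closure_iff:
  assumes "S \<subseteq> carrier M"
  shows "x \<in> (ntop M) closure_of S \<longleftrightarrow>
    x \<in> carrier M \<and> (\<forall>e>0. \<exists>s\<in>S. nrm M (s \<ominus> x) < e)"
  using assms unfolding Metric_space.metric_closure_of[OF metric]
  by (auto simp: Metric_space.in_mball[OF metric] ndist_def subset_iff nrm_minus_commute)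

lemma approx_sequence:
  assumes "S \<subseteq> carrier M" "x \<in> carrier M" "\<And>e. e > 0 \<Longrightarrow> \<exists>s\<in>S. nrm M (s \<ominus> x) < e"
  obtains s where "\<And>n::nat. s n \<in> S" "nconv M s x sequentially"
proof -
  have "\<forall>n::nat. \<exists>s\<in>S. nrm M (s \<ominus> x) < 1 / Suc n" using assms(3) by simp
  then obtain s where s: "\<And>n::nat. s n \<in> S \<and> nrm M (s n \<ominus> x) < 1 / Suc n" by metis
  have "nconv M s x sequentially"
  proof (rule nconvI_le)
    show "(\<lambda>n. 1 / real (Suc n)) \<longlonglongrightarrow> 0" using LIMSEQ_inverse_real_of_nat by (simp add: inverse_eq_divide)
    show "\<forall>\<^sub>F n in sequentially. s n \<in> carrier M \<and> nrm M (s n \<ominus> x) \<le> 1 / real (Suc n)"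
      using s assms(1) by (auto simp: less_imp_le subset_iff simp del: of_nat_Suc)
  qed fact
  with s that show ?thesis by blast
qed

lemma closure_sequence:
  assumes "x \<in> (ntop M) closure_of S" "S \<subseteq> carrier M"
  obtains s where "\<And>n::nat. s n \<in> S" "nconv M s x sequentially"
  using assms approx_sequence[OF assms(2)] by (auto simp: closure_iff)

lemma nconv_approx:
  assumes "nconv M f x F" "F \<noteq> bot" "\<forall>\<^sub>F i in F. f i \<in> S" "e > 0"
  shows "\<exists>s\<in>S. nrm M (s \<ominus> x) < e"
proof -
  have "\<forall>\<^sub>F i in F. nrm M (f i \<ominus> x) < e"
    using assms(1,4) by (auto simp: nconv_def elim: order_tendstoD)
  then have "\<forall>\<^sub>F i in F. f i \<in> S \<and> nrm M (f i \<ominus> x) < e"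
    using assms(3) by eventually_elim simp
  then show ?thesis using assms(2) eventually_happens' by blast
qed

lemma nconv_in_closure:
  assumes "nconv M f x F" "F \<noteq> bot" "\<forall>\<^sub>F i in F. f i \<in> S" "S \<subseteq> carrier M"
  shows "x \<in> (ntop M) closure_of S"
  using assms nconv_approx[OF assms(1-3)] by (simp add: closure_iff nconv_closed)

lemma closedI:
  assumes "S \<subseteq> carrier M"
    and "\<And>s x. \<lbrakk>\<And>n::nat. s n \<in> S; nconv M s x sequentially\<rbrakk> \<Longrightarrow> x \<in> S"
  shows "closedin (ntop M) S"
proof -
  have "x \<in> S" if "x \<in> (ntop M) closure_of S" for x
    using closure_sequence[OF that assms(1)] assms(2) by metis
  moreover have "S \<subseteq> (ntop M) closure_of S" using assms(1) by (simp add: closure_of_subset)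
  ultimately show ?thesis using assms(1) by (metis closure_of_eq subsetI subset_antisym)
qed

lemma closed_nconv:
  assumes "closedin (ntop M) S" "nconv M f x F" "F \<noteq> bot" "\<forall>\<^sub>F i in F. f i \<in> S"
  shows "x \<in> S"
proof -
  have "S \<subseteq> carrier M" using closedin_subset[OF assms(1)] by simp
  then show ?thesis using nconv_in_closure[OF assms(2-4)] closure_of_eq[of "ntop M" S] assms(1) by metis
qed

lemma limitin_iff_nconv:
  assumes "\<And>i. f i \<in> carrier M"
  shows "limitin (ntop M) f x F \<longleftrightarrow> nconv M f x F"
proof -
  have "limitin (ntop M) f x F \<longleftrightarrow> x \<in> carrier M \<and> ((\<lambda>i. ndist M (f i) x) \<longlongrightarrow> 0) F"
    using Metric_space.limitin_metric_dist_null[OF metric, of f x F] assms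
    by (simp add: eventually_True)
  then show ?thesis unfolding nconv_def using assms
    by (auto simp: ndist_def)
qed

lemma smodI:
  assumes "H \<subseteq> carrier M" "\<zero> \<in> H" "\<And>x y. \<lbrakk>x \<in> H; y \<in> H\<rbrakk> \<Longrightarrow> x \<oplus> y \<in> H"
    "\<And>c x. x \<in> H \<Longrightarrow> c \<odot> x \<in> H"
  shows "submodule H complex_ring M"
  using assms by (intro submoduleI) (auto simp: neg_scale subset_iff)

lemma smodD:
  assumes "submodule H complex_ring M"
  shows "H \<subseteq> carrier M" "\<zero> \<in> H" "\<And>x y. \<lbrakk>x \<in> H; y \<in> H\<rbrakk> \<Longrightarrow> x \<oplus> y \<in> H"
    "\<And>c x. x \<in> H \<Longrightarrow> c \<odot> x \<in> H" "\<And>x y. \<lbrakk>x \<in> H; y \<in> H\<rbrakk> \<Longrightarrow> x \<ominus> y \<in> H"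
proof -
  note E = submoduleE[OF assms]
  show sub: "H \<subseteq> carrier M" by (rule E)
  show sc: "\<And>c x. x \<in> H \<Longrightarrow> c \<odot> x \<in> H" using E(4) by simp
  show add: "\<And>x y. \<lbrakk>x \<in> H; y \<in> H\<rbrakk> \<Longrightarrow> x \<oplus> y \<in> H" by (rule E)
  obtain h where h: "h \<in> H" using E(2) by blast
  then show "\<zero> \<in> H" using sc[of h 0] sub by (auto simp: subset_iff)
  show "x \<ominus> y \<in> H" if "x \<in> H" "y \<in> H" for x y
  proof -
    have "x \<ominus> y = x \<oplus> (-1) \<odot> y" using that sub by (intro minus_scale) auto
    then show ?thesis using that add sc by auto
  qed
qed

lemma lin_span_props:
  assumes "S \<subseteq> carrier M"
  shows "submodule (lin_span M S) complex_ring M" "S \<subseteq> lin_span M S" "lin_span M S \<subseteq> carrier M"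
proof -
  have C: "submodule (carrier M) complex_ring M" by (rule carrier_is_submodule)
  show sub: "lin_span M S \<subseteq> carrier M" using C assms by (auto simp: lin_span_def)
  show "submodule (lin_span M S) complex_ring M"
    by (rule smodI[OF sub]) (auto simp: lin_span_def smodD)
  show "S \<subseteq> lin_span M S" by (auto simp: lin_span_def)
qed

lemma lin_span_le: "\<lbrakk>submodule H complex_ring M; S \<subseteq> H\<rbrakk> \<Longrightarrow> lin_span M S \<subseteq> H"
  by (auto simp: lin_span_def)

lemma closure_submodule:
  assumes "submodule H complex_ring M"
  shows "submodule ((ntop M) closure_of H) complex_ring M"
proof (rule smodI)
  note H = smodD[OF assms]
  show "(ntop M) closure_of H \<subseteq> carrier M" using closure_of_subset_topspace[of "ntop M" H] by simp
  show "\<zero> \<in> (ntop M) closure_of H" using closure_of_subset[of H "ntop M"] H by auto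
  show "x \<oplus> y \<in> (ntop M) closure_of H"
    if xy: "x \<in> (ntop M) closure_of H" "y \<in> (ntop M) closure_of H" for x y
  proof -
    obtain s where s: "\<And>n::nat. s n \<in> H" "nconv M s x sequentially"
      using closure_sequence[OF xy(1) H(1)] by blast
    obtain t where t: "\<And>n::nat. t n \<in> H" "nconv M t y sequentially"
      using closure_sequence[OF xy(2) H(1)] by blast
    show ?thesis
      using nconv_in_closure[OF nconv_add[OF s(2) t(2)] _ _ H(1)] s(1) t(1) H(3) by simp
  qed
  show "c \<odot> x \<in> (ntop M) closure_of H" if xy: "x \<in> (ntop M) closure_of H" for c x
  proof -
    obtain s where s: "\<And>n::nat. s n \<in> H" "nconv M s x sequentially"
      using closure_sequence[OF xy(1) H(1)] by blast
    show ?thesis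
      using nconv_in_closure[OF nconv_scale[OF s(2)] _ _ H(1)] s(1) H(4) by simp
  qed
qed

lemma closed_span_props:
  assumes "S \<subseteq> carrier M"
  shows "submodule (closed_span M S) complex_ring M" "S \<subseteq> closed_span M S"
    "closedin (ntop M) (closed_span M S)" "closed_span M S \<subseteq> carrier M"
proof -
  note L = lin_span_props[OF assms]
  show "submodule (closed_span M S) complex_ring M"
    unfolding closed_span_def by (rule closure_submodule[OF L(1)])
  then show "closed_span M S \<subseteq> carrier M" by (rule smodD)
  show "S \<subseteq> closed_span M S"
    unfolding closed_span_def using closure_of_subset[of "lin_span M S" "ntop M"] L by auto
  show "closedin (ntop M) (closed_span M S)" unfolding closed_span_def by simp
qed

lemma closed_span_le:
  assumes "submodule H complex_ring M" "closedin (ntop M) H" "S \<subseteq> H"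
  shows "closed_span M S \<subseteq> H"
  unfolding closed_span_def using lin_span_le[OF assms(1,3)] assms(2)
  by (rule closure_of_minimal)

section \<open>Completeness and Cauchy sequences\<close>

lemma complete_converges:
  assumes "Metric_space.mcomplete (carrier M) (ndist M)" "\<And>n::nat. s n \<in> carrier M"
    and "\<And>e. e > 0 \<Longrightarrow> \<exists>N. \<forall>m\<ge>N. \<forall>n\<ge>N. nrm M (s m \<ominus> s n) < e"
  obtains x where "nconv M s x sequentially"
proof -
  have "Metric_space.MCauchy (carrier M) (ndist M) s"
    unfolding Metric_space.MCauchy_def[OF metric] using assms(2,3)
    by (simp add: ndist_def image_subset_iff)
  then obtain x where "limitin (ntop M) s x sequentially"
    using assms(1) unfolding Metric_space.mcomplete_def[OF metric] by blast
  then show ?thesis using that limitin_iff_nconv[of s, OF assms(2)] by blast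
qed

lemma geometric_Cauchy:
  assumes "\<And>n::nat. s n \<in> carrier M" "0 \<le> r" "r < 1"
    and step: "\<And>n. nrm M (s (Suc n) \<ominus> s n) \<le> r ^ n" and "e > 0"
  shows "\<exists>N. \<forall>m\<ge>N. \<forall>n\<ge>N. nrm M (s m \<ominus> s n) < e"
proof -
  \<comment> \<open>The bound is the geometric sum r^n + ... + r^(n+d-1) in closed form.\<close>
  have le: "nrm M (s (n + d) \<ominus> s n) \<le> (r ^ n - r ^ (n + d)) / (1 - r)" for n d
  proof (induction d)
    case (Suc d)
    have "nrm M (s (n + Suc d) \<ominus> s n) \<le> r ^ (n + d) + (r ^ n - r ^ (n + d)) / (1 - r)"
      using nrm_minus_triangle[OF assms(1)[of "n + Suc d"] assms(1)[of "n + d"] assms(1)[of n]]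
        step[of "n + d"] Suc by simp
    also have "\<dots> = (r ^ n - r ^ (n + Suc d)) / (1 - r)"
      using assms(3) by (simp add: field_simps)
    finally show ?case .
  qed (use assms(1) in simp)
  have "(\<lambda>n. r ^ n / (1 - r)) \<longlonglongrightarrow> 0 / (1 - r)"
    using assms(2,3) by (intro tendsto_divide tendsto_const LIMSEQ_power_zero) auto
  then have "\<forall>\<^sub>F n in sequentially. r ^ n / (1 - r) < e"
    using order_tendstoD(2)[of "\<lambda>n. r ^ n / (1 - r)" 0 sequentially e] assms(5) by simp
  then obtain N where N: "\<And>n. n \<ge> N \<Longrightarrow> r ^ n / (1 - r) < e"
    by (auto simp: eventually_sequentially)
  have *: "nrm M (s m \<ominus> s n) < e" if "n \<ge> N" "m \<ge> n" for m n
  proof -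
    have "(r ^ n - r ^ m) / (1 - r) \<le> r ^ n / (1 - r)"
      using assms(2,3) by (simp add: divide_right_mono)
    then show ?thesis using le[of n "m - n"] N[OF that(1)] that(2) by simp
  qed
  have "nrm M (s m \<ominus> s n) < e" if "m \<ge> N" "n \<ge> N" for m n
    using *[of n m] *[of m n] that nrm_minus_commute[OF assms(1)[of m] assms(1)[of n]]
    by (cases "m \<ge> n") auto
  then show ?thesis by blast
qed

lemma nconv_compose:
  assumes "nconv M f x F" "filterlim g F G"
  shows "nconv M (\<lambda>i. f (g i)) x G"
  using assms filterlim_compose[of "\<lambda>i. nrm M (f i \<ominus> x)" "nhds 0" F g G]
    eventually_compose_filterlim[of "\<lambda>i. f i \<in> carrier M" F g G]
  by (simp add: nconv_def)

lemma nconv_Cauchy: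
  assumes "nconv M s x sequentially" "\<And>n::nat. s n \<in> carrier M" "e > 0"
  shows "\<exists>N. \<forall>m\<ge>N. \<forall>n\<ge>N. nrm M (s m \<ominus> s n) < e"
proof -
  have x: "x \<in> carrier M" using assms(1) by (rule nconv_closed)
  have "\<forall>\<^sub>F n in sequentially. nrm M (s n \<ominus> x) < e / 2"
    using assms(1,3) order_tendstoD(2)[of "\<lambda>n. nrm M (s n \<ominus> x)" 0 sequentially "e / 2"]
    by (simp add: nconv_def)
  then obtain N where N: "\<And>n. n \<ge> N \<Longrightarrow> nrm M (s n \<ominus> x) < e / 2"
    by (auto simp: eventually_sequentially)
  have "nrm M (s m \<ominus> s n) < e" if "m \<ge> N" "n \<ge> N" for m n
    using nrm_minus_triangle[OF assms(2)[of m] x assms(2)[of n]] N[OF that(1)] N[OF that(2)]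
      nrm_minus_commute[OF x assms(2)[of n]] by linarith
  then show ?thesis by blast
qed

end

section \<open>$C^*$-algebras\<close>

context cstar_algebra
begin

lemma zero_mult [simp]: "x \<in> carrier A \<Longrightarrow> \<zero> \<otimes> x = \<zero>"
  using smult_mult_l[of \<zero> x 0] by (simp add: m_closed)

lemma mult_zero [simp]: "x \<in> carrier A \<Longrightarrow> x \<otimes> \<zero> = \<zero>"
  using smult_mult_r[of x \<zero> 0] by (simp add: m_closed)

lemma star_zero [simp]: "star A \<zero> = \<zero>"
  using star_smult[of \<zero> 0] by (simp add: star_closed)

lemma minus_mult: "\<lbrakk>x \<in> carrier A; y \<in> carrier A; z \<in> carrier A\<rbrakk> \<Longrightarrow> (x \<ominus> y) \<otimes> z = x \<otimes> z \<ominus> y \<otimes> z"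
  by (simp add: minus_scale l_distr smult_mult_l m_closed)

lemma mult_minus: "\<lbrakk>x \<in> carrier A; y \<in> carrier A; z \<in> carrier A\<rbrakk> \<Longrightarrow> z \<otimes> (x \<ominus> y) = z \<otimes> x \<ominus> z \<otimes> y"
  by (simp add: minus_scale r_distr smult_mult_r m_closed)

lemma star_minus: "\<lbrakk>x \<in> carrier A; y \<in> carrier A\<rbrakk> \<Longrightarrow> star A (x \<ominus> y) = star A x \<ominus> star A y"
  by (simp add: minus_scale star_add star_smult star_closed)

lemma nrm_star_le: "x \<in> carrier A \<Longrightarrow> nrm A x \<le> nrm A (star A x)"
proof -
  assume x: "x \<in> carrier A"
  have "(nrm A x)\<^sup>2 \<le> nrm A (star A x) * nrm A x"
    using cstar_identity[OF x] nrm_mult[of "star A x" x] x by (simp add: star_closed)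
  then show ?thesis using nrm_ge0[OF x] nrm_ge0[OF star_closed[OF x]]
    by (cases "nrm A x = 0") (simp_all add: power2_eq_square)
qed

lemma nrm_star [simp]: "x \<in> carrier A \<Longrightarrow> nrm A (star A x) = nrm A x"
  using nrm_star_le[of x] nrm_star_le[of "star A x"] by (simp add: star_closed star_star)

lemma cstar_identity': "x \<in> carrier A \<Longrightarrow> nrm A (x \<otimes> star A x) = (nrm A x)\<^sup>2"
  using cstar_identity[of "star A x"] by (simp add: star_closed star_star)

lemma star_mult_eq_zero: "x \<in> carrier A \<Longrightarrow> star A x \<otimes> x = \<zero> \<Longrightarrow> x = \<zero>"
  using cstar_identity[of x] by (simp add: nrm_eq0)

lemma nconv_mult:
  assumes "nconv A f x F" "nconv A g y F" shows "nconv A (\<lambda>i. f i \<otimes> g i) (x \<otimes> y) F"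
proof (rule nconvI_le)
  note c = assms[THEN nconv_closed]
  show "x \<otimes> y \<in> carrier A" using c by (simp add: m_closed)
  have f: "((\<lambda>i. nrm A (f i \<ominus> x)) \<longlongrightarrow> 0) F" and g: "((\<lambda>i. nrm A (g i \<ominus> y)) \<longlongrightarrow> 0) F"
    using assms by (auto simp: nconv_def)
  \<comment> \<open>With d = f i - x and e = g i - y, the difference f g - x y is d e + d y + x e;
    in this form only d and e vary, so boundedness of g never comes up.\<close>
  have "((\<lambda>i. nrm A (f i \<ominus> x) * nrm A (g i \<ominus> y) + nrm A (f i \<ominus> x) * nrm A y
      + nrm A x * nrm A (g i \<ominus> y)) \<longlongrightarrow> 0 * 0 + 0 * nrm A y + nrm A x * 0) F"
    by (intro tendsto_intros f g)
  then show "((\<lambda>i. nrm A (f i \<ominus> x) * nrm A (g i \<ominus> y) + nrm A (f i \<ominus> x) * nrm A y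
      + nrm A x * nrm A (g i \<ominus> y)) \<longlongrightarrow> 0) F" by simp
  show "\<forall>\<^sub>F i in F. f i \<otimes> g i \<in> carrier A \<and> nrm A (f i \<otimes> g i \<ominus> x \<otimes> y) \<le>
      nrm A (f i \<ominus> x) * nrm A (g i \<ominus> y) + nrm A (f i \<ominus> x) * nrm A y + nrm A x * nrm A (g i \<ominus> y)"
    using assms[THEN nconv_eventually]
  proof eventually_elim
    case (elim i)
    let ?d = "f i \<ominus> x" and ?e = "g i \<ominus> y"
    have d: "?d \<in> carrier A" "?e \<in> carrier A" using elim c by auto
    have "f i \<otimes> g i \<ominus> x \<otimes> y = (?d \<otimes> g i) \<oplus> (x \<otimes> ?e)"
      using elim c by (simp add: minus_mult mult_minus m_closed minus_add_minus)
    also have "?d \<otimes> g i = ?d \<otimes> ?e \<oplus> ?d \<otimes> y"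
      using elim c d by (simp add: r_distr[symmetric] minus_add_cancel)
    finally have "nrm A (f i \<otimes> g i \<ominus> x \<otimes> y) \<le> nrm A (?d \<otimes> ?e) + nrm A (?d \<otimes> y) + nrm A (x \<otimes> ?e)"
      using nrm_add_le[of "?d \<otimes> ?e \<oplus> ?d \<otimes> y" "x \<otimes> ?e"] nrm_add_le[of "?d \<otimes> ?e" "?d \<otimes> y"] c d
      by (simp add: m_closed)
    then show ?case
      using nrm_mult[of ?d ?e] nrm_mult[of ?d y] nrm_mult[of x ?e] c d elim by (simp add: m_closed)
  qed
qed

lemma nconv_star:
  assumes "nconv A f x F" shows "nconv A (\<lambda>i. star A (f i)) (star A x) F"
proof (rule nconvI_le)
  note c = assms[THEN nconv_closed]
  show "star A x \<in> carrier A" using c by (rule star_closed)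
  show "((\<lambda>i. nrm A (f i \<ominus> x)) \<longlongrightarrow> 0) F" using assms by (simp add: nconv_def)
  show "\<forall>\<^sub>F i in F. star A (f i) \<in> carrier A \<and> nrm A (star A (f i) \<ominus> star A x) \<le> nrm A (f i \<ominus> x)"
    using assms[THEN nconv_eventually] by eventually_elim (use c in \<open>simp add: star_closed star_minus[symmetric]\<close>)
qed

lemma nconv_mult_left: "\<lbrakk>nconv A f x F; a \<in> carrier A\<rbrakk> \<Longrightarrow> nconv A (\<lambda>i. a \<otimes> f i) (a \<otimes> x) F"
  by (intro nconv_mult nconv_const)

lemma nconv_mult_right: "\<lbrakk>nconv A f x F; a \<in> carrier A\<rbrakk> \<Longrightarrow> nconv A (\<lambda>i. f i \<otimes> a) (x \<otimes> a) F"
  by (intro nconv_mult nconv_const)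

section \<open>Closed subalgebras, and a substitute for the square root of 1 - g\<close>

lemma subalgD:
  assumes "cstar_subalgebra S A"
  shows "S \<subseteq> carrier A" "\<zero> \<in> S" "\<And>x y. \<lbrakk>x \<in> S; y \<in> S\<rbrakk> \<Longrightarrow> x \<oplus> y \<in> S" "\<And>c x. x \<in> S \<Longrightarrow> c \<odot> x \<in> S"
    "\<And>x y. \<lbrakk>x \<in> S; y \<in> S\<rbrakk> \<Longrightarrow> x \<ominus> y \<in> S" "\<And>x y. \<lbrakk>x \<in> S; y \<in> S\<rbrakk> \<Longrightarrow> x \<otimes> y \<in> S"
    "\<And>x. x \<in> S \<Longrightarrow> star A x \<in> S" "closedin (ntop A) S"
proof -
  have S: "submodule S complex_ring A" using assms by (simp add: cstar_subalgebra_def)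
  show "S \<subseteq> carrier A" "\<zero> \<in> S" "\<And>x y. \<lbrakk>x \<in> S; y \<in> S\<rbrakk> \<Longrightarrow> x \<oplus> y \<in> S" "\<And>c x. x \<in> S \<Longrightarrow> c \<odot> x \<in> S"
    "\<And>x y. \<lbrakk>x \<in> S; y \<in> S\<rbrakk> \<Longrightarrow> x \<ominus> y \<in> S" using smodD[OF S] by auto
qed (use assms in \<open>auto simp: cstar_subalgebra_def\<close>)

lemma carrier_subalgebra: "cstar_subalgebra (carrier A) A"
  unfolding cstar_subalgebra_def using carrier_is_submodule closedin_topspace[of "ntop A"]
  by (auto simp: m_closed star_closed)

lemma complete_subset:
  assumes "closedin (ntop A) S" "\<And>n::nat. s n \<in> S"
    and "\<And>e. e > 0 \<Longrightarrow> \<exists>N. \<forall>m\<ge>N. \<forall>n\<ge>N. nrm A (s m \<ominus> s n) < e"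
  obtains x where "x \<in> S" "nconv A s x sequentially"
proof -
  have "s n \<in> carrier A" for n using assms(2) closedin_subset[OF assms(1)] by auto
  then obtain x where x: "nconv A s x sequentially"
    using complete_converges[OF complete, of s] assms(3) by blast
  then have "x \<in> S" using closed_nconv[OF assms(1) x] assms(2) by simp
  with x that show ?thesis by blast
qed

text \<open>The element \<open>k\<close> is \<open>1 - (1 - g)\<^sup>1\<^sup>/\<^sup>2\<close>, the fixed point of the contraction
  \<open>k \<mapsto> (g + k\<^sup>2) / 2\<close>. It stands in for the square root of \<open>1 - g\<close>, which need not lie in \<open>A\<close>.\<close>

lemma quasi_sqrt:
  assumes S: "cstar_subalgebra S A" and g: "g \<in> S" "star A g = g" "nrm A g < 1"
  obtains k where "k \<in> S" "star A k = k" "k \<oplus> k = g \<oplus> k \<otimes> k"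
    "\<And>h. \<lbrakk>h \<in> carrier A; h \<otimes> g = g \<otimes> h\<rbrakk> \<Longrightarrow> h \<otimes> k = k \<otimes> h"
proof -
  note S = subalgD[OF S]
  have gA: "g \<in> carrier A" using S g by auto
  define r where "r = nrm A g"
  have r: "0 \<le> r" "r < 1" using g gA by (auto simp: r_def)
  \<comment> \<open>The iterates from 0 are polynomials in g without constant term, so they stay in
    S and commute with whatever commutes with g.\<close>
  define s where "s = rec_nat \<zero> (\<lambda>_ k. (1/2) \<odot> (g \<oplus> k \<otimes> k))"
  have s0: "s 0 = \<zero>" and sS: "s (Suc n) = (1/2) \<odot> (g \<oplus> s n \<otimes> s n)" for n by (simp_all add: s_def)
  have sin: "s n \<in> S" for n by (induction n) (simp_all add: s0 sS S g)
  then have sA [simp]: "s n \<in> carrier A" for n using S by auto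
  have sstar: "star A (s n) = s n" for n
    by (induction n) (simp_all add: s0 sS gA g m_closed star_add star_mult star_smult)
  have snrm: "nrm A (s n) \<le> r" for n
  proof (induction n)
    case (Suc n)
    have "nrm A (s n \<otimes> s n) \<le> r * r"
      using nrm_mult[of "s n" "s n"] mult_mono[OF Suc Suc] r by simp
    also have "r * r \<le> r" using r mult_left_le[of r r] by simp
    finally have "nrm A (g \<oplus> s n \<otimes> s n) \<le> r + r"
      using nrm_add_le[of g "s n \<otimes> s n"] gA by (simp add: m_closed r_def)
    then show ?case by (simp add: sS gA m_closed nrm_scale)
  qed (simp add: s0 r)
  have "nrm A (s (Suc n) \<ominus> s n) \<le> r ^ n" for n
  proof (induction n)
    case 0 show ?case using r gA by (simp add: s0 sS nrm_scale r_def)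
  next
    case (Suc n)
    let ?k = "s (Suc n)" and ?l = "s n"
    have "s (Suc (Suc n)) \<ominus> s (Suc n) = (1/2) \<odot> ((g \<oplus> ?k \<otimes> ?k) \<ominus> (g \<oplus> ?l \<otimes> ?l))"
      unfolding sS[of "Suc n"] sS[of n, symmetric]
      by (subst (2) sS) (simp add: scale_minus gA m_closed)
    also have "(g \<oplus> ?k \<otimes> ?k) \<ominus> (g \<oplus> ?l \<otimes> ?l) = ?k \<otimes> ?k \<ominus> ?l \<otimes> ?l"
      using gA by (simp add: add_minus_add m_closed)
    \<comment> \<open>Both k and l have norm at most r, so this splitting, together with the factor
      1/2, bounds the next step by r times the previous one.\<close>
    also have "\<dots> = ?k \<otimes> (?k \<ominus> ?l) \<oplus> (?k \<ominus> ?l) \<otimes> ?l"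
      by (simp add: minus_mult mult_minus m_closed minus_add_minus)
    finally have "nrm A (s (Suc (Suc n)) \<ominus> s (Suc n)) =
        (1/2) * nrm A (?k \<otimes> (?k \<ominus> ?l) \<oplus> (?k \<ominus> ?l) \<otimes> ?l)"
      by (simp add: nrm_scale m_closed)
    also have "\<dots> \<le> (1/2) * (r * r ^ n + r ^ n * r)"
    proof -
      have "nrm A (?k \<otimes> (?k \<ominus> ?l)) \<le> r * r ^ n"
        using nrm_mult[of ?k "?k \<ominus> ?l"] mult_mono[OF snrm[of "Suc n"] Suc] r by simp
      moreover have "nrm A ((?k \<ominus> ?l) \<otimes> ?l) \<le> r ^ n * r"
        using nrm_mult[of "?k \<ominus> ?l" ?l] mult_mono[OF Suc snrm[of n]] r by simp
      ultimately show ?thesis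
        using nrm_add_le[of "?k \<otimes> (?k \<ominus> ?l)" "(?k \<ominus> ?l) \<otimes> ?l"] by (simp add: m_closed mult.commute)
    qed
    also have "\<dots> = r ^ Suc n" by simp
    finally show ?case .
  qed
  then obtain k where k: "k \<in> S" "nconv A s k sequentially"
    using complete_subset[OF S(8), of s] sin geometric_Cauchy[of s, OF sA r] by blast
  have kA: "k \<in> carrier A" using k S by auto
  have "nconv A (\<lambda>n. star A (s n)) (star A k) sequentially" using k(2) by (rule nconv_star)
  then have "nconv A s (star A k) sequentially" by (simp only: sstar)
  then have kstar: "star A k = k" using k(2) by (rule nconv_unique) simp
  have "nconv A (\<lambda>n. s (Suc n)) k sequentially"
    using k(2) by (rule nconv_compose) (rule filterlim_Suc)
  moreover have "nconv A (\<lambda>n. s (Suc n)) ((1/2) \<odot> (g \<oplus> k \<otimes> k)) sequentially"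
    unfolding sS by (intro nconv_scale nconv_add nconv_const nconv_mult gA k)
  ultimately have keq: "k = (1/2) \<odot> (g \<oplus> k \<otimes> k)" by (rule nconv_unique) simp
  have "k \<oplus> k = (1/2) \<odot> (g \<oplus> k \<otimes> k) \<oplus> (1/2) \<odot> (g \<oplus> k \<otimes> k)"
    using keq by metis
  also have "\<dots> = g \<oplus> k \<otimes> k"
    using scale_add_left[of "g \<oplus> k \<otimes> k" "1/2" "1/2"] gA kA by (simp add: m_closed)
  finally have kk: "k \<oplus> k = g \<oplus> k \<otimes> k" .
  have "h \<otimes> k = k \<otimes> h" if h: "h \<in> carrier A" "h \<otimes> g = g \<otimes> h" for h
  proof -
    have "h \<otimes> s n = s n \<otimes> h" for n
    proof (induction n)
      case (Suc n)
      have "h \<otimes> (s n \<otimes> s n) = s n \<otimes> s n \<otimes> h"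
        using h(1) Suc by (metis m_assoc sA)
      then show ?case using h gA
        by (simp add: sS smult_mult_r smult_mult_l r_distr l_distr m_closed)
    qed (use h in \<open>simp add: s0\<close>)
    then have "nconv A (\<lambda>n. h \<otimes> s n) (k \<otimes> h) sequentially"
      using nconv_mult_right[OF k(2) h(1)] by simp
    from nconv_unique[OF nconv_mult_left[OF k(2) h(1)] this] show ?thesis by simp
  qed
  with k(1) kstar kk that show ?thesis by blast
qed

text \<open>The hypotheses say that \<open>X b\<^sup>-\<^sup>1 + i Y b\<^sup>-\<^sup>1\<close> behaves like a unitary, of which
  \<open>X b\<^sup>-\<^sup>1\<close> is the mean with its adjoint.\<close>

lemma nrm_le_of_unitary_pair:
  assumes X: "X \<in> carrier A" and Y: "Y \<in> carrier A" and b: "b \<in> carrier A"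
    and sq: "star A X \<otimes> X \<oplus> star A Y \<otimes> Y = star A b \<otimes> b"
    and comm: "star A X \<otimes> Y = star A Y \<otimes> X"
  shows "nrm A X \<le> nrm A b"
proof -
  \<comment> \<open>The conditions hold for c = i and c = -i. As X^* Y = Y^* X, the cross terms of
    U^* U for U = X + c Y are c + cnj c times X^* Y, which is 0.\<close>
  have *: "nrm A (X \<oplus> c \<odot> Y) = nrm A b" if c: "c * cnj c = 1" "cnj c = - c" for c
  proof -
    let ?U = "X \<oplus> c \<odot> Y" and ?p = "star A X \<otimes> X" and ?q = "star A Y \<otimes> X" and ?r = "star A Y \<otimes> Y"
    have cl: "?p \<in> carrier A" "?q \<in> carrier A" "?r \<in> carrier A" using X Y by (auto simp: m_closed star_closed)
    have "star A ?U \<otimes> ?U = (?p \<oplus> c \<odot> ?q) \<oplus> (cnj c \<odot> ?q \<oplus> (cnj c * c) \<odot> ?r)"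
      using X Y by (simp add: star_add star_smult star_closed l_distr r_distr m_closed smult_mult_l
        smult_mult_r scale_scale comm scale_add_right a_ac mult.commute)
    also have "\<dots> = ?p \<oplus> ?r \<oplus> (c \<odot> ?q \<oplus> cnj c \<odot> ?q)"
      using cl c by (simp add: a_ac mult.commute)
    also have "c \<odot> ?q \<oplus> cnj c \<odot> ?q = \<zero>"
      using scale_add_left[of ?q c "cnj c"] cl c by simp
    finally have "star A ?U \<otimes> ?U = star A b \<otimes> b" using sq b by (simp add: m_closed star_closed)
    then have "(nrm A ?U)\<^sup>2 = (nrm A b)\<^sup>2"
      using cstar_identity[of ?U] cstar_identity[of b] X Y b by simp
    then show ?thesis using X Y b by (simp add: power2_eq_iff_nonneg)
  qed
  have "(X \<oplus> \<i> \<odot> Y) \<oplus> (X \<oplus> (- \<i>) \<odot> Y) = (X \<oplus> X) \<oplus> (\<i> \<odot> Y \<oplus> (- \<i>) \<odot> Y)"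
    using X Y by (simp add: a_ac)
  also have "\<i> \<odot> Y \<oplus> (- \<i>) \<odot> Y = \<zero>" using scale_add_left[of Y \<i> "- \<i>"] Y by simp
  also have "X \<oplus> X = 2 \<odot> X" using scale_add_left[of X 1 1] X by simp
  finally have "2 * nrm A X = nrm A ((X \<oplus> \<i> \<odot> Y) \<oplus> (X \<oplus> (- \<i>) \<odot> Y))"
    using X by (simp add: nrm_scale)
  also have "\<dots> \<le> nrm A b + nrm A b"
    using nrm_add_le[of "X \<oplus> \<i> \<odot> Y" "X \<oplus> (- \<i>) \<odot> Y"] *[of \<i>] *[of "- \<i>"] X Y by simp
  finally show ?thesis by simp
qed

text \<open>Formally h + i (1 - k) is a unitary, but 1 may be missing. Multiplying by h keeps
  everything in A: \<open>nrm_le_of_unitary_pair\<close> is applied to X = h h, Y = (1 - k) h and b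
  = h. The result |h h| \<le> |h| suffices, as |h h| = |h|^2.\<close>

lemma selfadjoint_nrm_le_1:
  assumes h: "h \<in> carrier A" "star A h = h" and k: "k \<in> carrier A" "star A k = k"
    and sq: "k \<oplus> k = h \<otimes> h \<oplus> k \<otimes> k" and comm: "h \<otimes> k = k \<otimes> h"
  shows "nrm A h \<le> 1"
proof -
  let ?X = "h \<otimes> h" and ?Y = "h \<ominus> k \<otimes> h" and ?hh = "h \<otimes> h"
  note cl = h(1) k(1) m_closed
  have "nrm A ?X \<le> nrm A h"
  proof (rule nrm_le_of_unitary_pair)
    have eq: "h \<otimes> (k \<otimes> h) \<oplus> h \<otimes> (k \<otimes> h) = h \<otimes> (?hh \<otimes> h) \<oplus> h \<otimes> (k \<otimes> k \<otimes> h)"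
      using arg_cong[OF sq, of "\<lambda>z. h \<otimes> (z \<otimes> h)"] cl by (simp add: l_distr r_distr)
    have "star A ?Y = h \<ominus> h \<otimes> k" using cl h k by (simp add: star_minus star_mult)
    then have "star A ?Y \<otimes> ?Y = (h \<otimes> h \<ominus> h \<otimes> (k \<otimes> h)) \<ominus> (h \<otimes> (k \<otimes> h) \<ominus> h \<otimes> (k \<otimes> k \<otimes> h))"
      using cl by (simp add: minus_mult mult_minus m_assoc)
    also have "\<dots> = (h \<otimes> h \<oplus> h \<otimes> (k \<otimes> k \<otimes> h)) \<ominus> (h \<otimes> (k \<otimes> h) \<oplus> h \<otimes> (k \<otimes> h))"
      using cl by (simp add: minus_scale scale_add_right scale_scale a_ac)
    also have "\<dots> = h \<otimes> h \<ominus> h \<otimes> (?hh \<otimes> h)"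
      unfolding eq using cl by (simp add: add_minus_add)
    finally have YY: "star A ?Y \<otimes> ?Y = h \<otimes> h \<ominus> h \<otimes> (?hh \<otimes> h)" .
    have "star A ?X \<otimes> ?X = h \<otimes> (?hh \<otimes> h)" using cl h by (simp add: star_mult m_assoc)
    then show "star A ?X \<otimes> ?X \<oplus> star A ?Y \<otimes> ?Y = star A h \<otimes> h"
      unfolding YY using cl h by (simp add: a_comm[of "h \<otimes> (?hh \<otimes> h)"] minus_add_cancel)
    have "h \<otimes> h \<otimes> (k \<otimes> h) = h \<otimes> k \<otimes> (h \<otimes> h)"
      using cl comm by (metis m_assoc)
    then show "star A ?X \<otimes> ?Y = star A ?Y \<otimes> ?X"
      using cl h k by (simp add: star_mult star_minus minus_mult mult_minus m_assoc)
  qed (use cl in auto)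
  moreover have "nrm A ?X = (nrm A h)\<^sup>2" using cstar_identity[OF h(1)] h by simp
  ultimately show ?thesis
    using nrm_ge0[OF h(1)] mult_left_le_imp_le[of "nrm A h" "nrm A h" 1]
    by (cases "nrm A h = 0") (simp_all add: power2_eq_square)
qed

end

section \<open>Norms of homomorphisms\<close>

lemma sub_homD:
  assumes "f \<in> cstar_hom (A\<lparr>carrier := S\<rparr>) B"
  shows "x \<in> S \<Longrightarrow> f x \<in> carrier B"
    "\<lbrakk>x \<in> S; y \<in> S\<rbrakk> \<Longrightarrow> f (x \<oplus>\<^bsub>A\<^esub> y) = f x \<oplus>\<^bsub>B\<^esub> f y"
    "\<lbrakk>x \<in> S; y \<in> S\<rbrakk> \<Longrightarrow> f (x \<otimes>\<^bsub>A\<^esub> y) = f x \<otimes>\<^bsub>B\<^esub> f y"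
    "x \<in> S \<Longrightarrow> f (c \<odot>\<^bsub>A\<^esub> x) = c \<odot>\<^bsub>B\<^esub> f x"
    "x \<in> S \<Longrightarrow> f (star A x) = star B (f x)"
  using assms by (auto simp: cstar_hom_def)

lemma sub_homI:
  assumes "\<And>x. x \<in> S \<Longrightarrow> f x \<in> carrier B"
    "\<And>x y. \<lbrakk>x \<in> S; y \<in> S\<rbrakk> \<Longrightarrow> f (x \<oplus>\<^bsub>A\<^esub> y) = f x \<oplus>\<^bsub>B\<^esub> f y"
    "\<And>x y. \<lbrakk>x \<in> S; y \<in> S\<rbrakk> \<Longrightarrow> f (x \<otimes>\<^bsub>A\<^esub> y) = f x \<otimes>\<^bsub>B\<^esub> f y"
    "\<And>x c. x \<in> S \<Longrightarrow> f (c \<odot>\<^bsub>A\<^esub> x) = c \<odot>\<^bsub>B\<^esub> f x"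
    "\<And>x. x \<in> S \<Longrightarrow> f (star A x) = star B (f x)"
  shows "f \<in> cstar_hom (A\<lparr>carrier := S\<rparr>) B"
  using assms by (auto simp: cstar_hom_def)


text \<open>A subalgebra as domain covers the inverse of an injective homomorphism, which lives on
  its range, and the ideal of compacts. The relations between h and its companion k are algebraic,
  so f carries them to B, where they bound the norm of f h by 1; scaling and the C^*-identity do the
  rest.\<close>

lemma sub_hom_contractive:
  assumes A: "cstar_algebra A" and B: "cstar_algebra B" and S: "cstar_subalgebra S A"
    and f: "f \<in> cstar_hom (A\<lparr>carrier := S\<rparr>) B" and x: "x \<in> S"
  shows "nrm B (f x) \<le> nrm A x"
proof -
  interpret A: cstar_algebra A by fact
  interpret B: cstar_algebra B by fact
  note S' = A.subalgD[OF S]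
  note f' = sub_homD[OF f]
  have inA: "y \<in> carrier A" if "y \<in> S" for y using that S' by auto
  have unit_ball: "nrm B (f h) \<le> 1" if h: "h \<in> S" "star A h = h" "nrm A h < 1" for h
  proof -
    have "nrm A (h \<otimes>\<^bsub>A\<^esub> h) = (nrm A h)\<^sup>2" using A.cstar_identity[OF inA[OF h(1)]] h by simp
    also have "\<dots> < 1" using h inA[OF h(1)] by (simp add: power_less_one_iff abs_square_less_1)
    finally have 1: "nrm A (h \<otimes>\<^bsub>A\<^esub> h) < 1" .
    have 2: "star A (h \<otimes>\<^bsub>A\<^esub> h) = h \<otimes>\<^bsub>A\<^esub> h" using h inA by (simp add: A.star_mult)
    \<comment> \<open>The companion of h, for g = h h; it is taken inside S so that f applies to
      it.\<close>
    obtain k where k: "k \<in> S" "star A k = k" "k \<oplus>\<^bsub>A\<^esub> k = h \<otimes>\<^bsub>A\<^esub> h \<oplus>\<^bsub>A\<^esub> k \<otimes>\<^bsub>A\<^esub> k"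
      "\<And>z. \<lbrakk>z \<in> carrier A; z \<otimes>\<^bsub>A\<^esub> (h \<otimes>\<^bsub>A\<^esub> h) = h \<otimes>\<^bsub>A\<^esub> h \<otimes>\<^bsub>A\<^esub> z\<rbrakk> \<Longrightarrow> z \<otimes>\<^bsub>A\<^esub> k = k \<otimes>\<^bsub>A\<^esub> z"
      using A.quasi_sqrt[OF S S'(6)[OF h(1) h(1)] 2 1] by metis
    have hk: "h \<otimes>\<^bsub>A\<^esub> k = k \<otimes>\<^bsub>A\<^esub> h" using k(4) inA[OF h(1)] by (simp add: A.m_assoc)
    show ?thesis
    proof (rule B.selfadjoint_nrm_le_1)
      show "f k \<oplus>\<^bsub>B\<^esub> f k = f h \<otimes>\<^bsub>B\<^esub> f h \<oplus>\<^bsub>B\<^esub> f k \<otimes>\<^bsub>B\<^esub> f k"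
        using arg_cong[OF k(3), of f] h(1) k(1) S'(6) f'(2,3) by simp
      show "f h \<otimes>\<^bsub>B\<^esub> f k = f k \<otimes>\<^bsub>B\<^esub> f h" using arg_cong[OF hk, of f] h(1) k(1) f'(3) by simp
      show "star B (f h) = f h" "star B (f k) = f k" using f'(5)[of h] f'(5)[of k] h k by auto
    qed (use f' h k in auto)
  qed
  have sa: "nrm B (f h) \<le> nrm A h" if h: "h \<in> S" "star A h = h" for h
  proof (rule field_le_epsilon)
    fix e :: real assume e: "e > 0"
    \<comment> \<open>The unit ball argument asks for norm strictly below 1, so h is divided by a
      number slightly above its norm.\<close>
    define t where "t = nrm A h + e"
    have t: "t > 0" "nrm A h < t" using e A.nrm_ge0[OF inA[OF h(1)]] by (auto simp: t_def)
    let ?h = "complex_of_real (1 / t) \<odot>\<^bsub>A\<^esub> h"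
    have "nrm B (f ?h) \<le> 1"
    proof (rule unit_ball)
      show "?h \<in> S" using h S' by simp
      show "star A ?h = ?h" using h inA by (simp add: A.star_smult)
      show "nrm A ?h < 1" using h inA t by (simp add: A.nrm_scale norm_divide)
    qed
    then have "nrm B (f h) / t \<le> 1" using h f' t by (simp add: B.nrm_scale norm_divide)
    then show "nrm B (f h) \<le> nrm A h + e" using t by (simp add: t_def field_simps)
  qed
  have "(nrm B (f x))\<^sup>2 = nrm B (f (star A x \<otimes>\<^bsub>A\<^esub> x))"
    using x f' S' B.cstar_identity[of "f x"] by simp
  also have "\<dots> \<le> nrm A (star A x \<otimes>\<^bsub>A\<^esub> x)"
    using x S' inA by (intro sa) (simp_all add: A.star_mult A.star_star)
  also have "\<dots> = (nrm A x)\<^sup>2" using x inA by (simp add: A.cstar_identity)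
  finally show ?thesis using x inA by (simp add: power2_le_iff_abs_le)
qed

lemma hom_contractive:
  assumes "cstar_algebra A" "cstar_algebra B" "f \<in> cstar_hom A B" "x \<in> carrier A"
  shows "nrm B (f x) \<le> nrm A x"
  using sub_hom_contractive[OF assms(1,2) cstar_algebra.carrier_subalgebra[OF assms(1)], of f] assms(3,4)
  by simp

lemma homD:
  assumes "f \<in> cstar_hom A B"
  shows "x \<in> carrier A \<Longrightarrow> f x \<in> carrier B"
    "\<lbrakk>x \<in> carrier A; y \<in> carrier A\<rbrakk> \<Longrightarrow> f (x \<oplus>\<^bsub>A\<^esub> y) = f x \<oplus>\<^bsub>B\<^esub> f y"
    "\<lbrakk>x \<in> carrier A; y \<in> carrier A\<rbrakk> \<Longrightarrow> f (x \<otimes>\<^bsub>A\<^esub> y) = f x \<otimes>\<^bsub>B\<^esub> f y"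
    "x \<in> carrier A \<Longrightarrow> f (c \<odot>\<^bsub>A\<^esub> x) = c \<odot>\<^bsub>B\<^esub> f x"
    "x \<in> carrier A \<Longrightarrow> f (star A x) = star B (f x)"
  using assms by (auto simp: cstar_hom_def)

text \<open>Contractions on submodules, rather than homomorphisms, because it also serves a
  representation on \<open>V\<close>, left multiplication into the operators, and right
  multiplication by p_n.\<close>

lemma contractive_nconv:
  assumes A: "normed_module A" and B: "normed_module B" and S: "submodule S complex_ring A"
    and f: "\<And>x. x \<in> S \<Longrightarrow> f x \<in> carrier B"
      "\<And>x y. \<lbrakk>x \<in> S; y \<in> S\<rbrakk> \<Longrightarrow> f (x \<oplus>\<^bsub>A\<^esub> y) = f x \<oplus>\<^bsub>B\<^esub> f y"
      "\<And>x c. x \<in> S \<Longrightarrow> f (c \<odot>\<^bsub>A\<^esub> x) = c \<odot>\<^bsub>B\<^esub> f x"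
      "\<And>x. x \<in> S \<Longrightarrow> nrm B (f x) \<le> nrm A x"
    and s: "nconv A s x F" "\<forall>\<^sub>F i in F. s i \<in> S" "x \<in> S"
  shows "nconv B (\<lambda>i. f (s i)) (f x) F"
proof -
  interpret A: normed_module A by fact
  interpret B: normed_module B by fact
  note S' = A.smodD[OF S]
  have fm: "f (y \<ominus>\<^bsub>A\<^esub> z) = f y \<ominus>\<^bsub>B\<^esub> f z" if "y \<in> S" "z \<in> S" for y z
  proof -
    have "y \<ominus>\<^bsub>A\<^esub> z = y \<oplus>\<^bsub>A\<^esub> (-1) \<odot>\<^bsub>A\<^esub> z" using that S'(1) by (intro A.minus_scale) auto
    then show ?thesis using that S' f by (simp add: B.minus_scale)
  qed
  show ?thesis
  proof (rule B.nconvI_le)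
    show "((\<lambda>i. nrm A (s i \<ominus>\<^bsub>A\<^esub> x)) \<longlongrightarrow> 0) F" using s by (simp add: nconv_def)
    show "\<forall>\<^sub>F i in F. f (s i) \<in> carrier B \<and> nrm B (f (s i) \<ominus>\<^bsub>B\<^esub> f x) \<le> nrm A (s i \<ominus>\<^bsub>A\<^esub> x)"
      using s(2) by eventually_elim (use s(3) f S' fm in \<open>simp flip: fm\<close>)
  qed (use s f in simp)
qed

lemma hom_nconv:
  assumes A: "cstar_algebra A" and B: "cstar_algebra B" and f: "f \<in> cstar_hom A B"
    and s: "nconv A s x F"
  shows "nconv B (\<lambda>i. f (s i)) (f x) F"
proof -
  interpret A: cstar_algebra A by fact
  interpret B: cstar_algebra B by fact
  show ?thesis
    by (rule contractive_nconv[OF A.normed_module_axioms B.normed_module_axioms A.carrier_is_submodule])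
      (use s A.nconv_closed[OF s] A.nconv_eventually[OF s] homD[OF f] hom_contractive[OF A B f] in auto)
qed

lemma hom_minus:
  assumes "normed_module A" "normed_module B" "f \<in> cstar_hom A B" "x \<in> carrier A" "y \<in> carrier A"
  shows "f (x \<ominus>\<^bsub>A\<^esub> y) = f x \<ominus>\<^bsub>B\<^esub> f y"
proof -
  interpret A: normed_module A by fact
  interpret B: normed_module B by fact
  show ?thesis using assms(4,5) homD[OF assms(3)] by (simp add: A.minus_scale B.minus_scale)
qed

lemma generated_induct:
  assumes "x \<in> cstar_generated A G" "cstar_subalgebra S A" "G \<subseteq> S"
  shows "x \<in> S"
  using assms by (auto simp: cstar_generated_def)

text \<open>Makes a homomorphism determined by its values on generators; closedness is the
  continuity of homomorphisms.\<close>

lemma equalizer_subalgebra: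
  assumes A: "cstar_algebra A" and B: "cstar_algebra B" and f: "f \<in> cstar_hom A B" and g: "g \<in> cstar_hom A B"
  shows "cstar_subalgebra {x \<in> carrier A. f x = g x} A"
proof -
  interpret A: cstar_algebra A by fact
  interpret B: cstar_algebra B by fact
  note f' = homD[OF f] and g' = homD[OF g]
  have z: "f \<zero>\<^bsub>A\<^esub> = \<zero>\<^bsub>B\<^esub>" "g \<zero>\<^bsub>A\<^esub> = \<zero>\<^bsub>B\<^esub>"
    using f'(4)[of "\<zero>\<^bsub>A\<^esub>" 0] g'(4)[of "\<zero>\<^bsub>A\<^esub>" 0] f'(1) g'(1) by auto
  have "closedin (ntop A) {x \<in> carrier A. f x = g x}"
  proof (rule A.closedI)
    fix s :: "nat \<Rightarrow> _" and x
    assume s: "\<And>n. s n \<in> {x \<in> carrier A. f x = g x}" and c: "nconv A s x sequentially"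
    have "nconv B (\<lambda>i. f (s i)) (g x) sequentially" using hom_nconv[OF A B g c] s by simp
    then have "f x = g x" using B.nconv_unique[OF hom_nconv[OF A B f c]] by simp
    then show "x \<in> {x \<in> carrier A. f x = g x}" using A.nconv_closed[OF c] by simp
  qed auto
  moreover have "submodule {x \<in> carrier A. f x = g x} complex_ring A"
    by (rule A.smodI) (auto simp: z f' g')
  ultimately show ?thesis
    by (auto simp: cstar_subalgebra_def f' g' A.m_closed A.star_closed)
qed

text \<open>The inverse is again a homomorphism, defined on the range, and contractive like every
  other. That the range is closed is a hypothesis; for \<open>\<alpha> n\<close> it is part of
  having hereditary range.\<close>

lemma hom_isometric:
  assumes A: "cstar_algebra A" and B: "cstar_algebra B" and f: "f \<in> cstar_hom A B"
    and inj: "inj_on f (carrier A)" and S: "cstar_subalgebra (f ` carrier A) B" and x: "x \<in> carrier A"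
  shows "nrm B (f x) = nrm A x"
proof -
  interpret A: cstar_algebra A by fact
  note f' = homD[OF f]
  let ?g = "the_inv_into (carrier A) f"
  have g: "?g (f y) = y" if "y \<in> carrier A" for y using the_inv_into_f_f[OF inj that] .
  have "?g \<in> cstar_hom (B\<lparr>carrier := f ` carrier A\<rparr>) A"
    by (rule sub_homI) (auto simp: g A.m_closed A.star_closed simp flip: f'(2-5))
  from sub_hom_contractive[OF B A S this, of "f x"] have "nrm A x \<le> nrm B (f x)" using x g by simp
  then show ?thesis using hom_contractive[OF A B f x] by simp
qed

section \<open>Consequences of heredity\<close>

context cstar_algebra
begin

text \<open>Squares of sums put x^* y + y^* x in S. Doing this for the pairs z, w and i z, w and
  combining with weights 1 and i leaves 2 z^* w.\<close>

lemma polarization: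
  assumes S: "submodule S complex_ring A" and T: "submodule T complex_ring A"
    and sq: "\<And>z. z \<in> T \<Longrightarrow> star A z \<otimes> z \<in> S" and z: "z \<in> T" and w: "w \<in> T"
  shows "star A z \<otimes> w \<in> S"
proof -
  note S' = smodD[OF S] and T' = smodD[OF T]
  have sym: "star A x \<otimes> y \<oplus> star A y \<otimes> x \<in> S" if "x \<in> T" "y \<in> T" for x y
  proof -
    have xy: "x \<in> carrier A" "y \<in> carrier A" using that T' by auto
    let ?a = "star A x \<otimes> x" and ?b = "star A x \<otimes> y" and ?c = "star A y \<otimes> x" and ?d = "star A y \<otimes> y"
    have cl: "?a \<in> carrier A" "?b \<in> carrier A" "?c \<in> carrier A" "?d \<in> carrier A"
      using xy by (auto simp: m_closed star_closed)
    have "star A (x \<oplus> y) \<otimes> (x \<oplus> y) = (?b \<oplus> ?c) \<oplus> (?a \<oplus> ?d)"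
      using xy by (simp add: star_add star_closed l_distr r_distr m_closed a_ac)
    moreover have "star A (x \<oplus> y) \<otimes> (x \<oplus> y) \<ominus> (?a \<oplus> ?d) \<in> S"
      using that T' by (intro S' sq) auto
    ultimately have "((?b \<oplus> ?c) \<oplus> (?a \<oplus> ?d)) \<ominus> (?a \<oplus> ?d) \<in> S" by simp
    moreover have "((?b \<oplus> ?c) \<oplus> (?a \<oplus> ?d)) \<ominus> (?a \<oplus> ?d) = ?b \<oplus> ?c"
      using cl add_minus_add[of "?b \<oplus> ?c" "?a \<oplus> ?d" \<zero> "?a \<oplus> ?d"] by simp
    ultimately show ?thesis by simp
  qed
  have zw: "z \<in> carrier A" "w \<in> carrier A" using z w T' by auto
  let ?b = "star A z \<otimes> w" and ?c = "star A w \<otimes> z"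
  have cl: "?b \<in> carrier A" "?c \<in> carrier A" using zw by (auto simp: m_closed star_closed)
  have "star A (\<i> \<odot> z) \<otimes> w \<oplus> star A w \<otimes> (\<i> \<odot> z) = (- \<i>) \<odot> ?b \<oplus> \<i> \<odot> ?c"
    using zw by (simp add: star_smult smult_mult_l smult_mult_r star_closed)
  with sym[of "\<i> \<odot> z" w] z w T' have "(- \<i>) \<odot> ?b \<oplus> \<i> \<odot> ?c \<in> S" by simp
  then have "(?b \<oplus> ?c) \<oplus> \<i> \<odot> ((- \<i>) \<odot> ?b \<oplus> \<i> \<odot> ?c) \<in> S" using sym[OF z w] S' by simp
  also have "(?b \<oplus> ?c) \<oplus> \<i> \<odot> ((- \<i>) \<odot> ?b \<oplus> \<i> \<odot> ?c) = (?b \<oplus> ?b) \<oplus> (?c \<oplus> (-1) \<odot> ?c)"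
    using cl by (simp add: scale_add_right scale_scale a_ac)
  also have "?c \<oplus> (-1) \<odot> ?c = \<zero>" using scale_add_left[of ?c 1 "-1"] cl by simp
  also have "?b \<oplus> ?b = 2 \<odot> ?b" using scale_add_left[of ?b 1 1] cl by simp
  finally have "(1/2) \<odot> (2 \<odot> ?b \<oplus> \<zero>) \<in> S" using S' by blast
  then show ?thesis using cl by (simp add: scale_scale)
qed

text \<open>For |c| < 1 the square of c b is dominated by b^* b, which lies in S, so heredity
  captures it; scaling removes the bound on c, and polarization passes from squares to mixed
  products.\<close>

lemma hereditary_corner:
  assumes H: "hereditary_subalgebra S A" and b: "b \<in> S" and x: "x \<in> carrier A" and y: "y \<in> carrier A"
  shows "star A (x \<otimes> b) \<otimes> (y \<otimes> b) \<in> S"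
proof -
  have S: "cstar_subalgebra S A" using H by (simp add: hereditary_subalgebra_def)
  note S' = subalgD[OF S]
  have bA: "b \<in> carrier A" using b S' by auto
  have small: "star A (c \<otimes> b) \<otimes> (c \<otimes> b) \<in> S" if c: "c \<in> carrier A" "nrm A c < 1" for c
  proof -
    let ?g = "star A c \<otimes> c"
    have g: "?g \<in> carrier A" "star A ?g = ?g" using c by (auto simp: m_closed star_closed star_mult star_star)
    have "nrm A ?g < 1" using c by (simp add: cstar_identity abs_square_less_1)
    then obtain k where k: "k \<in> carrier A" "star A k = k" "k \<oplus> k = ?g \<oplus> k \<otimes> k"
      using quasi_sqrt[OF carrier_subalgebra g] by metis
    \<comment> \<open>Formally d = (1 - k) b with (1 - k)^2 = 1 - c^* c, so d^* d is the difference
      b^* b - b^* c^* c b, which is thereby positive.\<close>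
    let ?d = "b \<ominus> k \<otimes> b" and ?s = "star A b"
    note cl = g bA k(1) star_closed m_closed
    have eq: "?s \<otimes> (k \<otimes> b) \<oplus> ?s \<otimes> (k \<otimes> b) = ?s \<otimes> (?g \<otimes> b) \<oplus> ?s \<otimes> (k \<otimes> k \<otimes> b)"
      using arg_cong[OF k(3), of "\<lambda>z. ?s \<otimes> (z \<otimes> b)"] cl by (simp add: l_distr r_distr)
    have "star A ?d = ?s \<ominus> ?s \<otimes> k" using cl k by (simp add: star_minus star_mult)
    then have "star A ?d \<otimes> ?d = (?s \<otimes> b \<ominus> ?s \<otimes> (k \<otimes> b)) \<ominus> (?s \<otimes> (k \<otimes> b) \<ominus> ?s \<otimes> (k \<otimes> k \<otimes> b))"
      using cl by (simp add: minus_mult mult_minus m_assoc)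
    also have "\<dots> = (?s \<otimes> b \<oplus> ?s \<otimes> (k \<otimes> k \<otimes> b)) \<ominus> (?s \<otimes> (k \<otimes> b) \<oplus> ?s \<otimes> (k \<otimes> b))"
      using cl by (simp add: minus_scale scale_add_right scale_scale a_ac)
    also have "\<dots> = ?s \<otimes> b \<ominus> ?s \<otimes> (?g \<otimes> b)"
      unfolding eq using cl by (simp add: add_minus_add)
    also have "?s \<otimes> (?g \<otimes> b) = star A (c \<otimes> b) \<otimes> (c \<otimes> b)"
      using c bA by (simp add: star_mult star_closed m_closed m_assoc)
    finally have d: "?s \<otimes> b \<ominus> star A (c \<otimes> b) \<otimes> (c \<otimes> b) = star A ?d \<otimes> ?d" by simp
    have "positive A (star A (c \<otimes> b) \<otimes> (c \<otimes> b))" "positive A (?s \<otimes> b \<ominus> star A (c \<otimes> b) \<otimes> (c \<otimes> b))"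
      unfolding positive_def d using c cl by auto
    moreover have "?s \<otimes> b \<in> S" using b S' by simp
    moreover have "star A (c \<otimes> b) \<otimes> (c \<otimes> b) \<in> carrier A" using c cl by simp
    ultimately show ?thesis using H unfolding hereditary_subalgebra_def by blast
  qed
  let ?T = "(\<lambda>c. c \<otimes> b) ` carrier A"
  have T: "submodule ?T complex_ring A"
  proof (rule smodI)
    show "\<zero> \<in> ?T" using bA zero_mult[of b] by (metis imageI zero_closed)
    show "c \<odot> z \<in> ?T" if "z \<in> ?T" for c z
      using that bA by (auto simp flip: smult_mult_l)
    show "z \<oplus> w \<in> ?T" if "z \<in> ?T" "w \<in> ?T" for z w
      using that bA by (auto simp flip: l_distr)
  qed (use bA in \<open>auto simp: m_closed\<close>)
  have "star A z \<otimes> z \<in> S" if "z \<in> ?T" for z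
  proof -
    obtain c where c: "c \<in> carrier A" "z = c \<otimes> b" using \<open>z \<in> ?T\<close> by auto
    \<comment> \<open>Any positive t with t |c| < 1 would do; adding 1 avoids dividing by 0.\<close>
    define t where "t = 1 / (nrm A c + 1)"
    have t: "t > 0" "t * nrm A c < 1" using nrm_ge0[OF c(1)] by (auto simp: t_def divide_simps)
    let ?c = "complex_of_real t \<odot> c"
    have "star A (?c \<otimes> b) \<otimes> (?c \<otimes> b) \<in> S"
      using c t by (intro small) (auto simp: nrm_scale)
    also have "star A (?c \<otimes> b) \<otimes> (?c \<otimes> b) = complex_of_real (t * t) \<odot> (star A z \<otimes> z)"
      using c bA by (simp add: smult_mult_l smult_mult_r star_smult m_closed star_closed scale_scale)
    finally have "complex_of_real (1 / (t * t)) \<odot> (complex_of_real (t * t) \<odot> (star A z \<otimes> z)) \<in> S"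
      by (rule S')
    then show ?thesis using t c bA by (simp add: scale_scale m_closed star_closed flip: of_real_mult)
  qed
  moreover have "submodule S complex_ring A" using S by (simp add: cstar_subalgebra_def)
  ultimately show ?thesis using polarization[OF _ T, of S] x y by blast
qed

end

section \<open>Hilbert bimodules given by closed left ideals\<close>

text \<open>A bimodule \<open>Y\<close> identified by \<open>e\<close> with a closed left ideal \<open>V\<close>, with right action and inner
  product twisted by an isometric endomorphism \<open>\<beta>\<close>.\<close>

locale corner_module = cstar_algebra A for A :: "'a cstar" (structure) +
  fixes Y :: "('a, 'y) hbimod" and V :: "'a set" and \<beta> :: "'a \<Rightarrow> 'a" and e :: "'a \<Rightarrow> 'y"
  assumes V_submodule: "submodule V complex_ring A" and V_closedin: "closedin (ntop A) V"
    and V_left: "\<lbrakk>a \<in> carrier A; x \<in> V\<rbrakk> \<Longrightarrow> a \<otimes> x \<in> V"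
    and V_right: "\<lbrakk>x \<in> V; a \<in> carrier A\<rbrakk> \<Longrightarrow> x \<otimes> \<beta> a \<in> V"
    and beta_closed: "a \<in> carrier A \<Longrightarrow> \<beta> a \<in> carrier A"
    and beta_minus: "\<lbrakk>a \<in> carrier A; b \<in> carrier A\<rbrakk> \<Longrightarrow> \<beta> (a \<ominus> b) = \<beta> a \<ominus> \<beta> b"
    and beta_nrm: "a \<in> carrier A \<Longrightarrow> nrm A (\<beta> a) = nrm A a"
    and e_bij: "bij_betw e V (carrier Y)"
    and Y_zero: "\<zero>\<^bsub>Y\<^esub> = e \<zero>"
    and Y_add: "\<lbrakk>x \<in> V; y \<in> V\<rbrakk> \<Longrightarrow> e x \<oplus>\<^bsub>Y\<^esub> e y = e (x \<oplus> y)"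
    and Y_scale: "x \<in> V \<Longrightarrow> c \<odot>\<^bsub>Y\<^esub> e x = e (c \<odot> x)"
    and Y_ract: "\<lbrakk>x \<in> V; a \<in> carrier A\<rbrakk> \<Longrightarrow> ract Y (e x) a = e (x \<otimes> \<beta> a)"
    and Y_lact: "\<lbrakk>x \<in> V; a \<in> carrier A\<rbrakk> \<Longrightarrow> lact Y a (e x) = e (a \<otimes> x)"
    and Y_ip_closed: "\<lbrakk>x \<in> V; y \<in> V\<rbrakk> \<Longrightarrow> ip Y (e x) (e y) \<in> carrier A"
    and Y_ip: "\<lbrakk>x \<in> V; y \<in> V\<rbrakk> \<Longrightarrow> \<beta> (ip Y (e x) (e y)) = star A x \<otimes> y"
begin

lemmas V_D = smodD[OF V_submodule]

lemma V_carrier [simp]: "x \<in> V \<Longrightarrow> x \<in> carrier A" using V_D by auto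

lemma V_simps [simp]: "\<zero> \<in> V" "\<lbrakk>x \<in> V; y \<in> V\<rbrakk> \<Longrightarrow> x \<oplus> y \<in> V" "x \<in> V \<Longrightarrow> c \<odot> x \<in> V"
    "\<lbrakk>x \<in> V; y \<in> V\<rbrakk> \<Longrightarrow> x \<ominus> y \<in> V"
  using V_D by auto

lemma e_closed [simp]: "x \<in> V \<Longrightarrow> e x \<in> carrier Y"
  using e_bij by (auto simp: bij_betw_def)

lemma e_eq [simp]: "\<lbrakk>x \<in> V; y \<in> V\<rbrakk> \<Longrightarrow> e x = e y \<longleftrightarrow> x = y"
  using e_bij by (auto simp: bij_betw_def inj_on_def)

lemma carrier_Y: "carrier Y = e ` V"
  using e_bij by (simp add: bij_betw_def)

lemma ballY: "(\<forall>u\<in>carrier Y. P u) \<longleftrightarrow> (\<forall>x\<in>V. P (e x))"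
  by (simp add: carrier_Y)

lemma beta_inj: "\<lbrakk>a \<in> carrier A; b \<in> carrier A; \<beta> a = \<beta> b\<rbrakk> \<Longrightarrow> a = b"
  using beta_nrm[of "a \<ominus> b"] by (simp add: beta_minus beta_closed nrm_diff_eq0)

text \<open>As \<open>\<beta>\<close> is injective, identities between inner products can be checked
  as identities between products x^* y in A.\<close>

lemma ip_eq_iff:
  "\<lbrakk>x \<in> V; y \<in> V; x' \<in> V; y' \<in> V\<rbrakk>
    \<Longrightarrow> ip Y (e x) (e y) = ip Y (e x') (e y') \<longleftrightarrow> star A x \<otimes> y = star A x' \<otimes> y'"
  by (metis Y_ip Y_ip_closed beta_inj)

lemma hnorm_e [simp]: "x \<in> V \<Longrightarrow> hnorm A Y (e x) = nrm A x"
proof -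
  assume x: "x \<in> V"
  have "nrm A (ip Y (e x) (e x)) = (nrm A x)\<^sup>2"
    using beta_nrm[of "ip Y (e x) (e x)"] x by (simp add: Y_ip Y_ip_closed cstar_identity)
  then show ?thesis using x by (simp add: hnorm_def)
qed

text \<open>Take w = z - z' and apply the C^*-identity. This nondegeneracy of the inner product
  yields linearity of adjointable maps and uniqueness of adjoints.\<close>

lemma V_eqI:
  assumes "z \<in> V" "z' \<in> V" "\<And>w. w \<in> V \<Longrightarrow> star A z \<otimes> w = star A z' \<otimes> w"
  shows "z = z'"
proof -
  have "star A (z \<ominus> z') \<otimes> (z \<ominus> z') = \<zero>"
    using assms(3)[of "z \<ominus> z'"] assms(1,2) by (simp add: star_minus star_closed minus_mult m_closed)
  then show ?thesis using star_mult_eq_zero[of "z \<ominus> z'"] assms by (simp add: minus_eq_zero)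
qed

section \<open>Adjointable operators, read on the ideal\<close>

definition adj_pair :: "('a \<Rightarrow> 'a) \<Rightarrow> ('a \<Rightarrow> 'a) \<Rightarrow> bool" where
  "adj_pair t s \<longleftrightarrow> t \<in> V \<rightarrow> V \<and> s \<in> V \<rightarrow> V \<and>
     (\<forall>x\<in>V. \<forall>y\<in>V. star A (t x) \<otimes> y = star A x \<otimes> s y)"

lemma adj_pairD:
  assumes "adj_pair t s"
  shows "x \<in> V \<Longrightarrow> t x \<in> V" "x \<in> V \<Longrightarrow> s x \<in> V"
    "\<lbrakk>x \<in> V; y \<in> V\<rbrakk> \<Longrightarrow> star A (t x) \<otimes> y = star A x \<otimes> s y"
  using assms by (auto simp: adj_pair_def)

lemma adj_pair_sym: "adj_pair t s \<Longrightarrow> adj_pair s t"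
  unfolding adj_pair_def
proof (intro conjI ballI; (elim conjE)?)
  fix x y assume V: "x \<in> V" "y \<in> V" and ts: "t \<in> V \<rightarrow> V" "s \<in> V \<rightarrow> V"
    and eq: "\<forall>x\<in>V. \<forall>y\<in>V. star A (t x) \<otimes> y = star A x \<otimes> s y"
  have "star A (star A (t y) \<otimes> x) = star A (star A y \<otimes> s x)" using eq V by simp
  moreover have "t y \<in> V" "s x \<in> V" using V ts by auto
  ultimately show "star A (s x) \<otimes> y = star A x \<otimes> t y"
    using V by (simp add: star_mult star_closed star_star)
qed auto

text \<open>Linearity is forced by the adjoint: the inner product of t (x + y) with w is that of x +
  y with s w, which is additive in x and y.\<close>

lemma adj_pair_add:
  assumes "adj_pair t s" "x \<in> V" "y \<in> V" shows "t (x \<oplus> y) = t x \<oplus> t y"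
proof (rule V_eqI)
  note D = adj_pairD[OF assms(1)]
  show "star A (t (x \<oplus> y)) \<otimes> w = star A (t x \<oplus> t y) \<otimes> w" if "w \<in> V" for w
    using that assms(2,3) D by (simp add: star_add star_closed l_distr)
qed (use assms adj_pairD[OF assms(1)] in auto)

lemma adj_pair_scale:
  assumes "adj_pair t s" "x \<in> V" shows "t (c \<odot> x) = c \<odot> t x"
proof (rule V_eqI)
  note D = adj_pairD[OF assms(1)]
  show "star A (t (c \<odot> x)) \<otimes> w = star A (c \<odot> t x) \<otimes> w" if "w \<in> V" for w
    using that assms(2) D by (simp add: star_smult star_closed smult_mult_l)
qed (use assms adj_pairD[OF assms(1)] in auto)

lemma adj_pair_minus:
  assumes "adj_pair t s" "x \<in> V" "y \<in> V" shows "t (x \<ominus> y) = t x \<ominus> t y"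
  using assms adj_pair_add[OF assms(1), of x "(-1) \<odot> y"] adj_pair_scale[OF assms(1), of y "-1"]
    adj_pairD[OF assms(1)] by (simp add: minus_scale)

text \<open>The operator norm is a \<open>Sup\<close> of reals, which says nothing about unbounded
  sets; hence the need for a bound. It comes from uniform boundedness by Baire category: the sets
  \<open>E n\<close> of points where t has size at most n are closed and cover the complete space
  V.\<close>

lemma adj_pair_bounded:
  assumes "adj_pair t s"
  obtains C where "C \<ge> 0" "\<And>x. x \<in> V \<Longrightarrow> nrm A (t x) \<le> C * nrm A x"
proof -
  note D = adj_pairD[OF assms]
  note t_minus = adj_pair_minus[OF assms] and t_scale = adj_pair_scale[OF assms]
  interpret SM: Submetric "carrier A" "ndist A" V
    using metric V_D(1) by (simp add: Submetric_def Submetric_axioms_def)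
  define E where "E n = {x \<in> V. nrm A (t x) \<le> real n}" for n
  \<comment> \<open>The adjoint replaces continuity of t: for y = t x, the square y^* y = (s y)^* x
    is the limit of (s y)^* z_i = y^* t(z_i), so |y|^2 \<le> n |y|.\<close>
  have E_closed: "closedin (ntop A) (E n)" for n
  proof (rule closedI)
    fix x and z :: "nat \<Rightarrow> 'a"
    assume z: "\<And>i. z i \<in> E n" "nconv A z x sequentially"
    have zV: "z i \<in> V" "nrm A (t (z i)) \<le> real n" for i using z by (auto simp: E_def)
    have x: "x \<in> V" using closed_nconv[OF V_closedin z(2)] zV by simp
    let ?y = "t x"
    have "nconv A (\<lambda>i. star A (s ?y) \<otimes> z i) (star A (s ?y) \<otimes> x) sequentially"
      using z(2) x D by (intro nconv_mult_left) (auto simp: star_closed)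
    moreover have "star A (s ?y) \<otimes> x = star A ?y \<otimes> ?y"
      using adj_pairD(3)[OF adj_pair_sym[OF assms], of ?y x] x D by simp
    ultimately have c: "nconv A (\<lambda>i. star A (s ?y) \<otimes> z i) (star A ?y \<otimes> ?y) sequentially" by simp
    have "nrm A (star A ?y \<otimes> ?y) \<le> nrm A ?y * n"
    proof (rule nrm_limit_le[OF c _ _ tendsto_const])
      have "nrm A (star A (s ?y) \<otimes> z i) \<le> nrm A ?y * n" for i
      proof -
        have "star A (s ?y) \<otimes> z i = star A ?y \<otimes> t (z i)"
          using adj_pairD(3)[OF adj_pair_sym[OF assms], of ?y "z i"] x D zV by simp
        then show ?thesis
          using nrm_mult[of "star A ?y" "t (z i)"] mult_left_mono[OF zV(2)[of i], of "nrm A ?y"] x D zV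
          by (simp add: star_closed)
      qed
      then show "\<forall>\<^sub>F i in sequentially. nrm A (star A (s ?y) \<otimes> z i) \<le> nrm A ?y * n" by simp
    qed simp
    then have "nrm A ?y * nrm A ?y \<le> nrm A ?y * n"
      using x D(1)[OF x] by (simp add: cstar_identity power2_eq_square)
    then have "nrm A ?y \<le> n" using nrm_ge0[of ?y] x D
      by (cases "nrm A ?y = 0") (simp_all add: mult_le_cancel_left)
    then show "x \<in> E n" using x by (simp add: E_def)
  qed (auto simp: E_def)
  have EU: "\<Union> (range E) = V"
    using real_arch_simple by (auto simp: E_def)
  have "\<exists>n. SM.sub.mtopology interior_of (E n) \<noteq> {}"
  proof (rule ccontr)
    assume no: "\<not> ?thesis"
    have "SM.sub.mtopology interior_of \<Union> (range E) = {}"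
    proof (rule SM.sub.metric_Baire_category_alt)
      show "SM.sub.mcomplete" using V_closedin complete by (intro SM.closedin_mcomplete_imp_mcomplete)
      show "closedin SM.sub.mtopology T \<and> SM.sub.mtopology interior_of T = {}" if "T \<in> range E" for T
        using that no E_closed unfolding SM.mtopology_submetric
        by (auto intro!: closedin_subset_topspace simp: E_def)
    qed auto
    then have "V = {}" unfolding EU
      using interior_of_topspace[of SM.sub.mtopology] by simp
    then show False using V_simps by auto
  qed
  then obtain n x where "x \<in> SM.sub.mtopology interior_of (E n)" by blast
  then obtain r where r: "r > 0" "SM.sub.mball x r \<subseteq> E n" "x \<in> E n"
    unfolding SM.sub.metric_interior_of by auto
  have x: "x \<in> V" "nrm A (t x) \<le> n" using r by (auto simp: E_def)
  \<comment> \<open>The interior point x is moved to the origin: z = x - (x - z), where both x and x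
    - z lie in \<open>E n\<close>.\<close>
  have small: "nrm A (t z) \<le> 2 * n" if z: "z \<in> V" "nrm A z < r" for z
  proof -
    have "ndist A x (x \<ominus> z) = nrm A z"
      using x z by (simp add: ndist_def minus_minus_self)
    then have "x \<ominus> z \<in> SM.sub.mball x r" using x z by (simp add: SM.sub.in_mball)
    then have "nrm A (t (x \<ominus> z)) \<le> n" using r by (auto simp: E_def)
    moreover have "t z = t x \<ominus> t (x \<ominus> z)"
      using t_minus[of x "x \<ominus> z"] x z by (simp add: minus_minus_self)
    ultimately show ?thesis using nrm_minus_le[of "t x" "t (x \<ominus> z)"] x z D by simp
  qed
  \<comment> \<open>The factor 4 is 2 from the bound 2 n and 2 from scaling z to norm r / 2, safely
    inside the ball.\<close>
  define C where "C = 4 * real n / r"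
  have "nrm A (t z) \<le> C * nrm A z" if z: "z \<in> V" for z
  proof (cases "z = \<zero>")
    case True
    then have "t z = \<zero>" using t_minus[of z z] z D by simp
    then show ?thesis using True by simp
  next
    case False
    then have p: "nrm A z > 0" using nrm_pos z by simp
    define c where "c = r / (2 * nrm A z)"
    have c: "c > 0" using p r by (simp add: c_def)
    have "nrm A (t (complex_of_real c \<odot> z)) \<le> 2 * n"
    proof (rule small)
      have "c * nrm A z < r" using p r by (simp add: c_def)
      then show "nrm A (complex_of_real c \<odot> z) < r" using z c by (simp add: nrm_scale)
    qed (use z in simp)
    then have "c * nrm A (t z) \<le> 2 * n" using z D c by (simp add: t_scale nrm_scale)
    then show ?thesis using p r by (simp add: c_def C_def field_simps)
  qed
  moreover have "C \<ge> 0" using r by (simp add: C_def)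
  ultimately show ?thesis using that by blast
qed

definition lift_op :: "('a \<Rightarrow> 'a) \<Rightarrow> 'y \<Rightarrow> 'y" where
  "lift_op t = (\<lambda>u\<in>carrier Y. e (t (the_inv_into V e u)))"

lemma lift_op_e [simp]: "x \<in> V \<Longrightarrow> lift_op t (e x) = e (t x)"
  using e_bij by (simp add: lift_op_def the_inv_into_f_f bij_betw_def)

lemma lift_op_ext: "lift_op t \<in> extensional (carrier Y)"
  by (simp add: lift_op_def)

lemma lift_op_eqI:
  assumes "T \<in> extensional (carrier Y)" "\<And>x. x \<in> V \<Longrightarrow> T (e x) = e (t x)"
  shows "T = lift_op t"
  by (rule extensionalityI[OF assms(1) lift_op_ext]) (auto simp: carrier_Y assms(2))

lemma lift_op_closed: "t \<in> V \<rightarrow> V \<Longrightarrow> lift_op t \<in> carrier Y \<rightarrow>\<^sub>E carrier Y"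
  by (auto simp: carrier_Y PiE_iff lift_op_ext[unfolded carrier_Y] image_iff Pi_iff)

lemma lift_op_cases:
  assumes "T \<in> carrier Y \<rightarrow>\<^sub>E carrier Y"
  obtains t where "t \<in> V \<rightarrow> V" "T = lift_op t"
proof -
  have "\<forall>x\<in>V. \<exists>y\<in>V. T (e x) = e y" using assms by (auto simp: carrier_Y PiE_iff image_iff)
  then obtain t where "\<forall>x\<in>V. t x \<in> V \<and> T (e x) = e (t x)" by metis
  then show ?thesis using that[of t] lift_op_eqI[of T t] assms by (auto simp: PiE_iff)
qed

lemma is_adjoint_lift:
  assumes "t \<in> V \<rightarrow> V" "s \<in> V \<rightarrow> V"
  shows "is_adjoint Y (lift_op t) (lift_op s) \<longleftrightarrow> adj_pair t s"
  using assms by (auto simp: is_adjoint_def adj_pair_def ballY ip_eq_iff Pi_iff)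

lemma adjointable_iff:
  "T \<in> carrier (adjointables A Y) \<longleftrightarrow> (\<exists>t s. adj_pair t s \<and> T = lift_op t)"
proof
  assume "T \<in> carrier (adjointables A Y)"
  then obtain S where T: "T \<in> carrier Y \<rightarrow>\<^sub>E carrier Y" and S: "S \<in> carrier Y \<rightarrow>\<^sub>E carrier Y" "is_adjoint Y T S"
    by (auto simp: adjointables_def)
  obtain t s where "t \<in> V \<rightarrow> V" "T = lift_op t" "s \<in> V \<rightarrow> V" "S = lift_op s"
    using lift_op_cases[OF T] lift_op_cases[OF S(1)] by metis
  then show "\<exists>t s. adj_pair t s \<and> T = lift_op t" using S is_adjoint_lift by auto
next
  assume "\<exists>t s. adj_pair t s \<and> T = lift_op t"
  then obtain t s where ts: "adj_pair t s" "T = lift_op t" by blast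
  then have tV: "t \<in> V \<rightarrow> V" "s \<in> V \<rightarrow> V" by (auto simp: adj_pair_def)
  then show "T \<in> carrier (adjointables A Y)"
    using ts is_adjoint_lift[OF tV] lift_op_closed[OF tV(1)] lift_op_closed[OF tV(2)]
    by (simp add: adjointables_def) blast
qed

text \<open>\<open>star\<close> is given by a \<open>THE\<close>; nondegeneracy of the inner product
  makes the adjoint unique.\<close>

lemma adj_star: 
  assumes "adj_pair t s" shows "star (adjointables A Y) (lift_op t) = lift_op s"
proof -
  have V: "t \<in> V \<rightarrow> V" "s \<in> V \<rightarrow> V" using assms by (auto simp: adj_pair_def)
  have "S = lift_op s" if S: "S \<in> carrier Y \<rightarrow>\<^sub>E carrier Y" "is_adjoint Y (lift_op t) S" for S
  proof -
    obtain r where r: "r \<in> V \<rightarrow> V" "S = lift_op r" using lift_op_cases[OF S(1)] .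
    then have ad: "adj_pair t r" using S is_adjoint_lift V by simp
    have "r x = s x" if x: "x \<in> V" for x
    proof (rule V_eqI)
      show "star A (r x) \<otimes> w = star A (s x) \<otimes> w" if "w \<in> V" for w
        using adj_pairD(3)[OF adj_pair_sym[OF ad] x that] adj_pairD(3)[OF adj_pair_sym[OF assms] x that]
        by simp
    qed (use x r V in auto)
    then show ?thesis unfolding r(2) by (intro lift_op_eqI lift_op_ext) simp
  qed
  then have "(THE S. S \<in> carrier Y \<rightarrow>\<^sub>E carrier Y \<and> is_adjoint Y (lift_op t) S) = lift_op s"
    using is_adjoint_lift[OF V] assms lift_op_closed[OF V(2)] by (intro the_equality) blast+
  then show ?thesis by (simp add: adjointables_def)
qed

lemma adj_ops:
  assumes "t \<in> V \<rightarrow> V" "s \<in> V \<rightarrow> V"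
  shows "lift_op t \<oplus>\<^bsub>adjointables A Y\<^esub> lift_op s = lift_op (\<lambda>x. t x \<oplus> s x)"
    "c \<odot>\<^bsub>adjointables A Y\<^esub> lift_op t = lift_op (\<lambda>x. c \<odot> t x)"
    "lift_op t \<otimes>\<^bsub>adjointables A Y\<^esub> lift_op s = lift_op (\<lambda>x. t (s x))"
    "\<zero>\<^bsub>adjointables A Y\<^esub> = lift_op (\<lambda>x. \<zero>)"
  using assms
  by (auto intro!: lift_op_eqI simp: adjointables_def Y_add Y_scale Y_zero Pi_iff compose_def)

lemma adj_pair_ops:
  assumes "adj_pair t s" "adj_pair t' s'"
  shows "adj_pair (\<lambda>x. t x \<oplus> t' x) (\<lambda>x. s x \<oplus> s' x)" "adj_pair (\<lambda>x. c \<odot> t x) (\<lambda>x. cnj c \<odot> s x)"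
    "adj_pair (\<lambda>x. \<zero>) (\<lambda>x. \<zero>)"
  using adj_pairD[OF assms(1)] adj_pairD[OF assms(2)]
  by (auto simp: adj_pair_def star_add star_closed l_distr r_distr star_smult smult_mult_l smult_mult_r)

section \<open>The operator norm\<close>

lemma adj_nrm_set:
  "{hnorm A Y (lift_op t y) | y. y \<in> carrier Y \<and> hnorm A Y y \<le> 1} =
    {nrm A (t x) | x. x \<in> V \<and> nrm A x \<le> 1}" if "t \<in> V \<rightarrow> V"
proof (intro Set.set_eqI iffI)
  fix z assume "z \<in> {hnorm A Y (lift_op t y) | y. y \<in> carrier Y \<and> hnorm A Y y \<le> 1}"
  then obtain x where "x \<in> V" "hnorm A Y (e x) \<le> 1" "z = hnorm A Y (lift_op t (e x))"
    by (auto simp: carrier_Y)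
  moreover from this have "t x \<in> V" using that by auto
  ultimately show "z \<in> {nrm A (t x) | x. x \<in> V \<and> nrm A x \<le> 1}" by auto
next
  fix z assume "z \<in> {nrm A (t x) | x. x \<in> V \<and> nrm A x \<le> 1}"
  then obtain x where x: "x \<in> V" "nrm A x \<le> 1" "z = nrm A (t x)" by auto
  moreover have "t x \<in> V" using that x by auto
  ultimately show "z \<in> {hnorm A Y (lift_op t y) | y. y \<in> carrier Y \<and> hnorm A Y y \<le> 1}"
    by (auto intro!: exI[of _ "e x"])
qed

lemma adj_nrm_le:
  assumes "adj_pair t s" "C \<ge> 0" "\<And>x. x \<in> V \<Longrightarrow> nrm A (t x) \<le> C * nrm A x"
  shows "nrm (adjointables A Y) (lift_op t) \<le> C"
proof -
  have t: "t \<in> V \<rightarrow> V" using assms by (auto simp: adj_pair_def)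
  have "z \<le> C" if z: "z \<in> {nrm A (t x) | x. x \<in> V \<and> nrm A x \<le> 1}" for z
  proof -
    obtain x where x: "x \<in> V" "nrm A x \<le> 1" "z = nrm A (t x)" using z by auto
    have "C * nrm A x \<le> C" using x assms(2) mult_left_le by blast
    then show ?thesis using assms(3)[OF x(1)] x by simp
  qed
  moreover have "nrm A (t \<zero>) \<in> {nrm A (t x) | x. x \<in> V \<and> nrm A x \<le> 1}"
    using V_simps(1) nrm_zero zero_le_one by (metis (mono_tags, lifting) mem_Collect_eq)
  ultimately show ?thesis unfolding adjointables_def
    by (simp add: adj_nrm_set[OF t]) (rule cSup_least; blast)
qed

lemma adj_nrm_ge:
  assumes "adj_pair t s" "x \<in> V"
  shows "nrm A (t x) \<le> nrm (adjointables A Y) (lift_op t) * nrm A x"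
proof -
  have t: "t \<in> V \<rightarrow> V" using assms by (auto simp: adj_pair_def)
  obtain C where C: "C \<ge> 0" "\<And>x. x \<in> V \<Longrightarrow> nrm A (t x) \<le> C * nrm A x"
    using adj_pair_bounded[OF assms(1)] by blast
  have "z \<le> C" if z: "z \<in> {nrm A (t x) | x. x \<in> V \<and> nrm A x \<le> 1}" for z
  proof -
    obtain x where x: "x \<in> V" "nrm A x \<le> 1" "z = nrm A (t x)" using z by auto
    have "C * nrm A x \<le> C" using x C mult_left_le by blast
    then show ?thesis using C(2)[OF x(1)] x by simp
  qed
  then have bdd: "bdd_above {nrm A (t x) | x. x \<in> V \<and> nrm A x \<le> 1}" by (auto simp: bdd_above_def)
  have unit: "nrm A (t y) \<le> nrm (adjointables A Y) (lift_op t)" if "y \<in> V" "nrm A y \<le> 1" for y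
    unfolding adjointables_def by (simp add: adj_nrm_set[OF t]) (rule cSup_upper[OF _ bdd], use that in auto)
  show ?thesis
  proof (cases "x = \<zero>")
    case True
    then have "t x = \<zero>" using adj_pair_minus[OF assms(1), of x x] assms adj_pairD[OF assms(1)] by simp
    then show ?thesis using True by simp
  next
    case False
    then have p: "nrm A x > 0" using nrm_pos assms by simp
    have "nrm A (t (complex_of_real (1 / nrm A x) \<odot> x)) \<le> nrm (adjointables A Y) (lift_op t)"
      using p assms by (intro unit) (auto simp: nrm_scale norm_divide)
    then have "nrm A (t x) / nrm A x \<le> nrm (adjointables A Y) (lift_op t)"
      using p assms adj_pairD[OF assms(1)]
      by (simp add: adj_pair_scale[OF assms(1)] nrm_scale norm_divide)
    then show ?thesis using p by (simp add: field_simps)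
  qed
qed

lemma adj_nrm_nonneg:
  assumes "adj_pair t s" shows "0 \<le> nrm (adjointables A Y) (lift_op t)"
proof (cases "\<exists>x\<in>V. x \<noteq> \<zero>")
  case True
  then obtain x where x: "x \<in> V" "x \<noteq> \<zero>" by blast
  then have p: "nrm A x > 0" using nrm_pos by simp
  have "0 \<le> nrm (adjointables A Y) (lift_op t) * nrm A x"
    using order_trans[OF nrm_nonneg adj_nrm_ge[OF assms x(1)]] adj_pairD(1)[OF assms x(1)] by simp
  then show ?thesis using p by (simp add: zero_le_mult_iff)
next
  \<comment> \<open>For V = 0 no nonzero x is available, and the norm is computed as the supremum of
    {0}.\<close>
  case False
  then have V0: "V = {\<zero>}" using V_simps(1) by blast
  have t: "t \<in> V \<rightarrow> V" using assms by (auto simp: adj_pair_def)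
  then have "{nrm A (t x) | x. x \<in> V \<and> nrm A x \<le> 1} = {0}" by (auto simp: V0)
  then show ?thesis unfolding adjointables_def by (simp add: adj_nrm_set[OF t])
qed

lemma adjointables_normed: "normed_module (adjointables A Y)"
proof -
  let ?B = "adjointables A Y"
  have abel: "abelian_group ?B"
  proof (rule abelian_groupI)
    fix T S R assume "T \<in> carrier ?B" "S \<in> carrier ?B" "R \<in> carrier ?B"
    then obtain t s r t' s' r' where p: "adj_pair t t'" "adj_pair s s'" "adj_pair r r'"
      and eq: "T = lift_op t" "S = lift_op s" "R = lift_op r"
      unfolding adjointable_iff by metis
    then have V: "t \<in> V \<rightarrow> V" "s \<in> V \<rightarrow> V" "r \<in> V \<rightarrow> V" by (auto simp: adj_pair_def)
    then have V': "(\<lambda>x. t x \<oplus> s x) \<in> V \<rightarrow> V" "(\<lambda>x. s x \<oplus> r x) \<in> V \<rightarrow> V" by (auto simp: Pi_iff)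
    show "T \<oplus>\<^bsub>?B\<^esub> S \<oplus>\<^bsub>?B\<^esub> R = T \<oplus>\<^bsub>?B\<^esub> (S \<oplus>\<^bsub>?B\<^esub> R)"
      unfolding eq using V V' by (auto simp: adj_ops Pi_iff a_ac intro!: lift_op_eqI lift_op_ext)
  next
    fix T S assume "T \<in> carrier ?B" "S \<in> carrier ?B"
    then obtain t s t' s' where p: "adj_pair t t'" "adj_pair s s'"
      and eq: "T = lift_op t" "S = lift_op s"
      unfolding adjointable_iff by metis
    then have V: "t \<in> V \<rightarrow> V" "s \<in> V \<rightarrow> V" by (auto simp: adj_pair_def)
    show "T \<oplus>\<^bsub>?B\<^esub> S \<in> carrier ?B"
      unfolding eq adj_ops(1)[OF V] adjointable_iff using adj_pair_ops(1)[OF p] by blast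
    show "T \<oplus>\<^bsub>?B\<^esub> S = S \<oplus>\<^bsub>?B\<^esub> T"
      unfolding eq using V by (auto simp: adj_ops Pi_iff a_ac intro!: lift_op_eqI lift_op_ext)
  next
    have z: "(\<lambda>x. \<zero>) \<in> V \<rightarrow> V" by auto
    have p0: "adj_pair (\<lambda>x. \<zero>) (\<lambda>x. \<zero>)" by (auto simp: adj_pair_def star_closed)
    show "\<zero>\<^bsub>?B\<^esub> \<in> carrier ?B"
      unfolding adj_ops(4)[OF z z] adjointable_iff using p0 by blast
    fix T assume "T \<in> carrier ?B"
    then obtain t t' where p: "adj_pair t t'" and eq: "T = lift_op t" unfolding adjointable_iff by metis
    then have V: "t \<in> V \<rightarrow> V" by (auto simp: adj_pair_def)
    show "\<zero>\<^bsub>?B\<^esub> \<oplus>\<^bsub>?B\<^esub> T = T"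
      unfolding eq using V z by (auto simp: adj_ops adj_ops(4)[OF z z] Pi_iff intro!: lift_op_eqI[symmetric] lift_op_ext)
    have n: "adj_pair (\<lambda>x. (-1) \<odot> t x) (\<lambda>x. cnj (-1) \<odot> t' x)" by (rule adj_pair_ops(2)[OF p p])
    then have nV: "(\<lambda>x. (-1) \<odot> t x) \<in> V \<rightarrow> V" by (auto simp: adj_pair_def)
    have "lift_op (\<lambda>x. (-1) \<odot> t x) \<oplus>\<^bsub>?B\<^esub> T = \<zero>\<^bsub>?B\<^esub>"
      unfolding eq adj_ops(4)[OF z z] adj_ops(1)[OF nV V]
    proof (intro lift_op_eqI lift_op_ext)
      fix x assume x: "x \<in> V"
      then have tx: "t x \<in> V" using V by auto
      have "(-1) \<odot> t x \<oplus> t x = \<zero>" using scale_add_left[of "t x" "-1" 1] tx by simp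
      then show "lift_op (\<lambda>x. (- 1) \<odot> t x \<oplus> t x) (e x) = e \<zero>" using x by simp
    qed
    then show "\<exists>S\<in>carrier ?B. S \<oplus>\<^bsub>?B\<^esub> T = \<zero>\<^bsub>?B\<^esub>"
      using n adjointable_iff by blast
  qed
  have "Module.module complex_ring ?B"
  proof (rule moduleI[OF R.is_cring abel])
    fix c d T S assume "T \<in> carrier ?B" "S \<in> carrier ?B"
    then obtain t s t' s' where p: "adj_pair t t'" "adj_pair s s'"
      and eq: "T = lift_op t" "S = lift_op s"
      unfolding adjointable_iff by metis
    then have V: "t \<in> V \<rightarrow> V" "s \<in> V \<rightarrow> V" by (auto simp: adj_pair_def)
    then have V': "(\<lambda>x. t x \<oplus> s x) \<in> V \<rightarrow> V" "\<And>c. (\<lambda>x. c \<odot> t x) \<in> V \<rightarrow> V" "\<And>c. (\<lambda>x. c \<odot> s x) \<in> V \<rightarrow> V" by (auto simp: Pi_iff)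
    show "c \<odot>\<^bsub>?B\<^esub> (T \<oplus>\<^bsub>?B\<^esub> S) = c \<odot>\<^bsub>?B\<^esub> T \<oplus>\<^bsub>?B\<^esub> c \<odot>\<^bsub>?B\<^esub> S"
      unfolding eq using V V' by (auto simp: adj_ops Pi_iff scale_add_right intro!: lift_op_eqI lift_op_ext)
  next
    fix c d T assume "T \<in> carrier ?B"
    then obtain t t' where p: "adj_pair t t'" and eq: "T = lift_op t" unfolding adjointable_iff by metis
    then have V: "t \<in> V \<rightarrow> V" by (auto simp: adj_pair_def)
    then have V': "\<And>c. (\<lambda>x. c \<odot> t x) \<in> V \<rightarrow> V" by (auto simp: Pi_iff)
    show "c \<odot>\<^bsub>?B\<^esub> T \<in> carrier ?B"
      unfolding eq adj_ops(2)[OF V V] adjointable_iff using adj_pair_ops(2)[OF p p] by blast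
    show "(c \<oplus>\<^bsub>complex_ring\<^esub> d) \<odot>\<^bsub>?B\<^esub> T = c \<odot>\<^bsub>?B\<^esub> T \<oplus>\<^bsub>?B\<^esub> d \<odot>\<^bsub>?B\<^esub> T"
      "(c \<otimes>\<^bsub>complex_ring\<^esub> d) \<odot>\<^bsub>?B\<^esub> T = c \<odot>\<^bsub>?B\<^esub> (d \<odot>\<^bsub>?B\<^esub> T)"
      "\<one>\<^bsub>complex_ring\<^esub> \<odot>\<^bsub>?B\<^esub> T = T"
      unfolding eq using V V' by (auto simp: adj_ops Pi_iff scale_add_left scale_scale intro!: lift_op_eqI[symmetric] lift_op_ext)
  qed
  moreover have "normed_module_axioms ?B"
  proof
    fix T assume "T \<in> carrier ?B"
    then obtain t t' where p: "adj_pair t t'" and eq: "T = lift_op t" unfolding adjointable_iff by metis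
    then have V: "t \<in> V \<rightarrow> V" by (auto simp: adj_pair_def)
    show ge0: "0 \<le> nrm ?B T" unfolding eq using p by (rule adj_nrm_nonneg)
    show "nrm ?B T = 0 \<longleftrightarrow> T = \<zero>\<^bsub>?B\<^esub>"
    proof
      assume 0: "nrm ?B T = 0"
      have "t x = \<zero>" if "x \<in> V" for x
        using adj_nrm_ge[OF p that] 0 eq nrm_pos[of "t x"] adj_pairD(1)[OF p that] by fastforce
      then show "T = \<zero>\<^bsub>?B\<^esub>" unfolding eq adj_ops(4)[OF V V] by (intro lift_op_eqI lift_op_ext) simp
    next
      assume T: "T = \<zero>\<^bsub>?B\<^esub>"
      have "nrm ?B (lift_op (\<lambda>x. \<zero>)) \<le> 0" by (rule adj_nrm_le[OF adj_pair_ops(3)[OF p p]]) auto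
      then show "nrm ?B T = 0" using ge0 unfolding T adj_ops(4)[OF V V] by simp
    qed
    \<comment> \<open>This inequality for c, and once more for 1/c applied to c t, gives
      homogeneity.\<close>
    have le: "nrm ?B (lift_op (\<lambda>x. d \<odot> s x)) \<le> cmod d * nrm ?B (lift_op s)" if p: "adj_pair s s'" for d s s'
    proof (rule adj_nrm_le[OF adj_pair_ops(2)[OF p p]])
      show "nrm A (d \<odot> s x) \<le> cmod d * nrm ?B (lift_op s) * nrm A x" if "x \<in> V" for x
        using mult_left_mono[OF adj_nrm_ge[OF p that], of "cmod d"] adj_pairD[OF p] that by (simp add: nrm_scale)
    qed (use adj_nrm_nonneg[OF p] in simp)
    show "nrm ?B (c \<odot>\<^bsub>?B\<^esub> T) = cmod c * nrm ?B T" for c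
    proof (cases "c = 0")
      case True
      then show ?thesis using le[OF p, of 0] adj_nrm_nonneg[OF adj_pair_ops(2)[OF p p, of 0]]
        unfolding eq adj_ops(2)[OF V V] by simp
    next
      case False
      have "lift_op (\<lambda>x. inverse c \<odot> (c \<odot> t x)) = T" unfolding eq
        using adj_pairD(1)[OF p] False
        by (intro lift_op_eqI[symmetric] lift_op_ext) (simp add: scale_scale)
      then have "nrm ?B T \<le> cmod (inverse c) * nrm ?B (lift_op (\<lambda>x. c \<odot> t x))"
        using le[OF adj_pair_ops(2)[OF p p, of c], of "inverse c"] by simp
      then have "cmod c * nrm ?B T \<le> nrm ?B (lift_op (\<lambda>x. c \<odot> t x))"
        using False by (simp add: norm_divide field_simps)
      then show ?thesis using le[OF p, of c] unfolding eq adj_ops(2)[OF V V] by simp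
    qed
    fix S assume "S \<in> carrier ?B"
    then obtain s s' where q: "adj_pair s s'" and eq': "S = lift_op s" unfolding adjointable_iff by metis
    then have V': "s \<in> V \<rightarrow> V" by (auto simp: adj_pair_def)
    show "nrm ?B (T \<oplus>\<^bsub>?B\<^esub> S) \<le> nrm ?B T + nrm ?B S"
      unfolding eq eq' adj_ops(1)[OF V V']
    proof (rule adj_nrm_le[OF adj_pair_ops(1)[OF p q]])
      show "nrm A (t x \<oplus> s x) \<le> (nrm ?B (lift_op t) + nrm ?B (lift_op s)) * nrm A x" if "x \<in> V" for x
        using nrm_add_le[of "t x" "s x"] adj_nrm_ge[OF p that] adj_nrm_ge[OF q that]
          adj_pairD[OF p] adj_pairD[OF q] that by (simp add: distrib_right)
    qed (use adj_nrm_nonneg[OF p] adj_nrm_nonneg[OF q] in simp)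
  qed
  ultimately show ?thesis by (rule normed_module.intro)
qed

end

section \<open>Compact operators and coisometric representations\<close>

context cstar_algebra
begin

text \<open>\<open>g\<close> is the identity for left multiplications and complex conjugation for
  the involution. With it, invariance of a closed span is reduced to its generators.\<close>

lemma preimage_closed_submodule:
  assumes S: "submodule S complex_ring A" "closedin (ntop A) S"
    and f: "\<And>x. x \<in> carrier A \<Longrightarrow> f x \<in> carrier A"
      "\<And>x y. \<lbrakk>x \<in> carrier A; y \<in> carrier A\<rbrakk> \<Longrightarrow> f (x \<oplus> y) = f x \<oplus> f y"
      "\<And>x c. x \<in> carrier A \<Longrightarrow> f (c \<odot> x) = g c \<odot> f x"
      "\<And>s x. nconv A s x sequentially \<Longrightarrow> nconv A (\<lambda>n::nat. f (s n)) (f x) sequentially"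
  shows "submodule {x \<in> carrier A. f x \<in> S} complex_ring A" "closedin (ntop A) {x \<in> carrier A. f x \<in> S}"
proof -
  note S' = smodD[OF S(1)]
  have "f \<zero> = g 0 \<odot> f \<zero>" using f(3)[of \<zero> 0] by simp
  have "f \<zero> \<oplus> f \<zero> = f \<zero>" using f(2)[of \<zero> \<zero>] by simp
  then have "f \<zero> = \<zero>" using f(1)[of \<zero>] by simp
  then show "submodule {x \<in> carrier A. f x \<in> S} complex_ring A"
    by (intro smodI) (auto simp: f S')
  show "closedin (ntop A) {x \<in> carrier A. f x \<in> S}"
  proof (rule closedI)
    fix s :: "nat \<Rightarrow> 'a" and x assume s: "\<And>n. s n \<in> {x \<in> carrier A. f x \<in> S}" "nconv A s x sequentially"
    have "f x \<in> S" using closed_nconv[OF S(2) f(4)[OF s(2)]] s(1) by simp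
    then show "x \<in> {x \<in> carrier A. f x \<in> S}" using nconv_closed[OF s(2)] by simp
  qed auto
qed

lemma ideal_subalgebra:
  assumes S: "submodule S complex_ring A" "closedin (ntop A) S"
    and "\<And>a x. \<lbrakk>a \<in> carrier A; x \<in> S\<rbrakk> \<Longrightarrow> a \<otimes> x \<in> S" "\<And>x. x \<in> S \<Longrightarrow> star A x \<in> S"
  shows "cstar_subalgebra S A"
  using assms smodD[OF S(1)] by (auto simp: cstar_subalgebra_def)

end

context corner_module
begin

text \<open>Left multiplication by x y^* is the rank one operator \<open>theta\<close> at x and y,
  so this is the candidate for the compacts inside A. For fibre n it turns out to be
  \<open>range_ideal A \<alpha> n\<close>.\<close>

definition compact_ideal :: "'a set" where
  "compact_ideal = closed_span A {x \<otimes> star A y | x y. x \<in> V \<and> y \<in> V}"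

lemma gens_carrier: "{x \<otimes> star A y | x y. x \<in> V \<and> y \<in> V} \<subseteq> carrier A"
  by (auto simp: m_closed star_closed)

lemmas ideal_props = closed_span_props[OF gens_carrier, folded compact_ideal_def]

lemma ideal_carrier [simp]: "k \<in> compact_ideal \<Longrightarrow> k \<in> carrier A"
  using ideal_props by auto

lemma ideal_gen: "\<lbrakk>x \<in> V; y \<in> V\<rbrakk> \<Longrightarrow> x \<otimes> star A y \<in> compact_ideal"
  using ideal_props(2) by auto

text \<open>Serves as induction principle for the ideal, with H the set of elements having the
  desired property.\<close>

lemma ideal_le:
  assumes "submodule H complex_ring A" "closedin (ntop A) H"
    "\<And>x y. \<lbrakk>x \<in> V; y \<in> V\<rbrakk> \<Longrightarrow> x \<otimes> star A y \<in> H"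
  shows "compact_ideal \<subseteq> H"
  unfolding compact_ideal_def using assms by (intro closed_span_le) auto

lemma ideal_left: 
  assumes a: "a \<in> carrier A" and k: "k \<in> compact_ideal" shows "a \<otimes> k \<in> compact_ideal"
proof -
  have "compact_ideal \<subseteq> {x \<in> carrier A. a \<otimes> x \<in> compact_ideal}"
  proof (rule ideal_le)
    show "submodule {x \<in> carrier A. a \<otimes> x \<in> compact_ideal} complex_ring A"
      "closedin (ntop A) {x \<in> carrier A. a \<otimes> x \<in> compact_ideal}"
      by (rule preimage_closed_submodule[OF ideal_props(1,3), of "\<lambda>x. a \<otimes> x" "\<lambda>c. c"];
        use a in \<open>auto simp: m_closed r_distr smult_mult_r intro: nconv_mult_left\<close>)+
    show "x \<otimes> star A y \<in> {x \<in> carrier A. a \<otimes> x \<in> compact_ideal}" if "x \<in> V" "y \<in> V" for x y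
      using that a ideal_gen[OF V_left[OF a that(1)] that(2)] by (simp add: m_closed star_closed m_assoc)
  qed
  then show ?thesis using k by auto
qed

lemma ideal_star:
  assumes k: "k \<in> compact_ideal" shows "star A k \<in> compact_ideal"
proof -
  have "compact_ideal \<subseteq> {x \<in> carrier A. star A x \<in> compact_ideal}"
  proof (rule ideal_le)
    show "submodule {x \<in> carrier A. star A x \<in> compact_ideal} complex_ring A"
      "closedin (ntop A) {x \<in> carrier A. star A x \<in> compact_ideal}"
      by (rule preimage_closed_submodule[OF ideal_props(1,3), of "star A" cnj];
        auto simp: star_closed star_add star_smult intro: nconv_star)+
    show "x \<otimes> star A y \<in> {x \<in> carrier A. star A x \<in> compact_ideal}" if "x \<in> V" "y \<in> V" for x y
      using that ideal_gen[OF that(2,1)] by (simp add: m_closed star_closed star_mult star_star)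
  qed
  then show ?thesis using k by auto
qed

lemma ideal_subalg: "cstar_subalgebra compact_ideal A"
  using ideal_props ideal_left ideal_star by (intro ideal_subalgebra)

lemmas ideal_D = subalgD[OF ideal_subalg]

definition lmul :: "'a \<Rightarrow> 'y \<Rightarrow> 'y" where
  "lmul k = lift_op (\<lambda>x. k \<otimes> x)"

lemma left_action_eq: "k \<in> carrier A \<Longrightarrow> left_action Y k = lmul k"
  unfolding lmul_def by (rule lift_op_eqI) (auto simp: left_action_def Y_lact)

lemma lmul_pair: "k \<in> carrier A \<Longrightarrow> adj_pair (\<lambda>x. k \<otimes> x) (\<lambda>x. star A k \<otimes> x)"
  by (auto simp: adj_pair_def V_left star_closed star_mult m_assoc)

lemma lmul_V: "k \<in> carrier A \<Longrightarrow> (\<lambda>x. k \<otimes> x) \<in> V \<rightarrow> V"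
  by (auto simp: V_left)

lemma lmul_closed: "k \<in> carrier A \<Longrightarrow> lmul k \<in> carrier (adjointables A Y)"
  unfolding adjointable_iff lmul_def using lmul_pair by blast

lemma lmul_e [simp]: "x \<in> V \<Longrightarrow> lmul k (e x) = e (k \<otimes> x)"
  by (simp add: lmul_def)

lemma lmul_add:
  assumes "k \<in> carrier A" "l \<in> carrier A"
  shows "lmul (k \<oplus> l) = lmul k \<oplus>\<^bsub>adjointables A Y\<^esub> lmul l"
  unfolding lmul_def adj_ops[OF lmul_V[OF assms(1)] lmul_V[OF assms(2)]] using assms
  by (auto intro!: lift_op_eqI lift_op_ext simp: l_distr)

lemma lmul_mult:
  assumes "k \<in> carrier A" "l \<in> carrier A"
  shows "lmul (k \<otimes> l) = lmul k \<otimes>\<^bsub>adjointables A Y\<^esub> lmul l"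
  unfolding lmul_def adj_ops[OF lmul_V[OF assms(1)] lmul_V[OF assms(2)]] using assms
  by (auto intro!: lift_op_eqI lift_op_ext simp: m_assoc)

lemma lmul_scale:
  assumes "k \<in> carrier A"
  shows "lmul (c \<odot> k) = c \<odot>\<^bsub>adjointables A Y\<^esub> lmul k"
  unfolding lmul_def adj_ops[OF lmul_V[OF assms] lmul_V[OF assms]] using assms
  by (auto intro!: lift_op_eqI lift_op_ext simp: smult_mult_l)

lemma lmul_star: "k \<in> carrier A \<Longrightarrow> star (adjointables A Y) (lmul k) = lmul (star A k)"
  unfolding lmul_def by (rule adj_star[OF lmul_pair])

lemma lmul_zero: "\<zero>\<^bsub>adjointables A Y\<^esub> = lmul \<zero>"
  unfolding lmul_def adj_ops[OF lmul_V[OF zero_closed] lmul_V[OF zero_closed]]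
  by (auto intro!: lift_op_eqI lift_op_ext)

lemmas lmul_ops = lmul_add lmul_scale lmul_mult lmul_star lmul_zero

lemma lmul_nrm_le: "k \<in> carrier A \<Longrightarrow> nrm (adjointables A Y) (lmul k) \<le> nrm A k"
  unfolding lmul_def by (rule adj_nrm_le[OF lmul_pair]) (auto intro: nrm_mult)

lemma lmul_nconv:
  assumes k: "nconv A k l F"
  shows "nconv (adjointables A Y) (\<lambda>i. lmul (k i)) (lmul l) F"
  by (rule contractive_nconv[OF normed_module_axioms adjointables_normed carrier_is_submodule _ _ _ _ k])
    (use nconv_eventually[OF k] nconv_closed[OF k] in \<open>auto simp: lmul_ops lmul_closed lmul_nrm_le\<close>)

text \<open>If the left multiplication by \<open>h\<close> had norm below \<open>nrm A h\<close>, then, after normalising \<open>h\<close>, the powers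
  \<open>h\<^sup>m z\<close> would tend to 0 for \<open>z \<in> V\<close>, hence for \<open>z = h\<close>; but the powers of a selfadjoint
  element of norm 1 do not tend to 0.\<close>

lemma selfadjoint_nrm_le:
  assumes h: "h \<in> compact_ideal" "star A h = h" and s: "0 \<le> s"
    and le: "\<And>w. w \<in> V \<Longrightarrow> nrm A (h \<otimes> w) \<le> s * nrm A w"
  shows "nrm A h \<le> s"
proof (rule ccontr)
  assume "\<not> ?thesis"
  then have sh: "s < nrm A h" by simp
  \<comment> \<open>Normalisation: g = t h has norm 1, while left multiplication by g on V has norm
    at most r = t s < 1.\<close>
  define t where "t = 1 / nrm A h"
  have t: "t > 0" using sh s by (simp add: t_def)
  define g where "g = complex_of_real t \<odot> h"
  have hA: "h \<in> carrier A" using h by simp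
  have gI: "g \<in> compact_ideal" using h ideal_D by (simp add: g_def)
  then have g: "g \<in> carrier A" by simp
  have gstar: "star A g = g" using hA h by (simp add: g_def star_smult)
  have gnrm: "nrm A g = 1" using hA t sh s by (simp add: g_def nrm_scale t_def norm_divide)
  define r where "r = t * s"
  have r: "0 \<le> r" "r < 1" using sh s t by (auto simp: r_def t_def)
  have gw: "nrm A (g \<otimes> w) \<le> r * nrm A w" if "w \<in> V" for w
    using mult_left_mono[OF le[OF that], of t] t hA that
    by (simp add: g_def r_def smult_mult_l nrm_scale m_closed)
  define P where "P m z = (((\<otimes>) g) ^^ m) z" for m z
  have P0: "P 0 z = z" and PS: "P (Suc m) z = g \<otimes> P m z" for m z by (simp_all add: P_def)
  have Pc [simp]: "P m z \<in> carrier A" if "z \<in> carrier A" for m z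
    using that g by (induction m) (simp_all add: P0 PS m_closed)
  have Padd: "P m (z \<oplus> w) = P m z \<oplus> P m w" if "z \<in> carrier A" "w \<in> carrier A" for m z w
    using that g by (induction m) (simp_all add: P0 PS r_distr)
  have Pscale: "P m (c \<odot> z) = c \<odot> P m z" if "z \<in> carrier A" for m c z
    using that g by (induction m) (simp_all add: P0 PS smult_mult_r)
  have Pmult: "P m (z \<otimes> w) = P m z \<otimes> w" if "z \<in> carrier A" "w \<in> carrier A" for m z w
    using that g by (induction m) (simp_all add: P0 PS m_assoc)
  have Pnrm: "nrm A (P m z) \<le> nrm A z" if "z \<in> carrier A" for m z
  proof (induction m)
    case (Suc m)
    then show ?case using nrm_mult[OF g Pc[OF that, of m]] gnrm by (simp add: PS)
  qed (simp add: P0)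
  have Pminus: "P m (z \<ominus> w) = P m z \<ominus> P m w" if "z \<in> carrier A" "w \<in> carrier A" for m z w
    using that by (simp add: minus_scale Padd Pscale)
  \<comment> \<open>H is closed because the powers of g are contractive, and contains each x y^*
    because g^m x tends to 0 geometrically; so the whole ideal, and g with it, lies in H.\<close>
  let ?H = "{z \<in> carrier A. nconv A (\<lambda>m. P m z) \<zero> sequentially}"
  have "compact_ideal \<subseteq> ?H"
  proof (rule ideal_le)
    show "submodule ?H complex_ring A"
    proof (rule smodI)
      have "P m \<zero> = \<zero>" for m using Pscale[of \<zero> m 0] by simp
      then show "\<zero> \<in> ?H" by (simp add: nconv_const)
      show "x \<oplus> y \<in> ?H" if "x \<in> ?H" "y \<in> ?H" for x y
        using that nconv_add[of "\<lambda>m. P m x" \<zero> sequentially "\<lambda>m. P m y" \<zero>] by (simp add: Padd)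
      show "c \<odot> x \<in> ?H" if "x \<in> ?H" for c x
        using that nconv_scale[of "\<lambda>m. P m x" \<zero> sequentially c] smult_r_null[of c] by (simp add: Pscale)
    qed auto
    show "closedin (ntop A) ?H"
    proof (rule closedI)
      fix z :: "nat \<Rightarrow> 'a" and x assume z: "\<And>n. z n \<in> ?H" "nconv A z x sequentially"
      have x: "x \<in> carrier A" using z(2) by (rule nconv_closed)
      have "(\<lambda>m. nrm A (P m x)) \<longlonglongrightarrow> 0"
      proof (rule LIMSEQ_I)
        fix e :: real assume e: "e > 0"
        obtain n where n: "nrm A (z n \<ominus> x) < e / 2"
          using nconv_approx[OF z(2), of "range z" "e / 2"] e by auto
        have zn: "z n \<in> carrier A" "(\<lambda>m. nrm A (P m (z n))) \<longlonglongrightarrow> 0"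
          using z(1)[of n] nconv_nrm[of "\<lambda>m. P m (z n)" \<zero> sequentially] by auto
        then obtain N where N: "\<And>m. m \<ge> N \<Longrightarrow> nrm A (P m (z n)) < e / 2"
          using order_tendstoD(2)[OF zn(2), of "e / 2"] e by (auto simp: eventually_sequentially)
        have "nrm A (P m x) < e" if "m \<ge> N" for m
        proof -
          have "nrm A (P m x) \<le> nrm A (P m x \<ominus> P m (z n)) + nrm A (P m (z n))"
            using x zn by (intro nrm_diff_le) auto
          also have "nrm A (P m x \<ominus> P m (z n)) \<le> nrm A (z n \<ominus> x)"
            using Pnrm[of "x \<ominus> z n" m] x zn nrm_minus_commute[of x "z n"] by (simp add: Pminus)
          finally show ?thesis using n N[OF that] by simp
        qed
        then show "\<exists>N. \<forall>m\<ge>N. norm (nrm A (P m x) - 0) < e" using x by auto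
      qed
      then show "x \<in> ?H" using x by (auto simp: nconv_def)
    qed auto
    fix x y assume xy: "x \<in> V" "y \<in> V"
    have PV: "P m x \<in> V \<and> nrm A (P m x) \<le> r ^ m * nrm A x" for m
    proof (induction m)
      case (Suc m)
      then show ?case using gw[of "P m x"] V_left[OF g, of "P m x"] mult_left_mono[of "nrm A (P m x)" "r ^ m * nrm A x" r] r
        by (simp add: PS)
    qed (simp add: P0 xy)
    have "nconv A (\<lambda>m. P m x) \<zero> sequentially"
    proof (rule nconvI_le)
      show "(\<lambda>m. r ^ m * nrm A x) \<longlonglongrightarrow> 0"
        using r by (intro tendsto_mult_left_zero LIMSEQ_power_zero) auto
    qed (use PV xy in auto)
    from nconv_mult_right[OF this, of "star A y"] show "x \<otimes> star A y \<in> ?H"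
      using xy by (simp add: Pmult star_closed m_closed)
  qed
  then have lim: "(\<lambda>m. nrm A (P m g)) \<longlonglongrightarrow> 0"
    using gI nconv_nrm[of "\<lambda>m. P m g" \<zero> sequentially] by auto
  have Pg: "g \<otimes> P m g = P m g \<otimes> g" for m
  proof (induction m)
    case (Suc m)
    show ?case using g by (simp add: PS m_assoc flip: Suc)
  qed (simp add: P0)
  have Pstar: "star A (P m g) = P m g" for m
    using g gstar Pg by (induction m) (simp_all add: P0 PS star_mult)
  \<comment> \<open>As \<open>P m g\<close> is g^(m+1), its square is g^(2m+2).\<close>
  have PP: "P m g \<otimes> P m g = P (Suc (2 * m)) g" for m
  proof -
    have "P m g \<otimes> P m g = P m (P (Suc m) g)" using g by (simp add: Pmult PS)
    also have "\<dots> = P (m + Suc m) g" unfolding P_def by (simp only: funpow_add o_apply)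
    finally show ?thesis by (simp add: mult_2)
  qed
  \<comment> \<open>\<open>P (2 ^ j - 1) g\<close> is the power of g with exponent 2^j, reached by
    repeated squaring of a selfadjoint element, so the C^*-identity keeps its norm at 1.\<close>
  have one: "nrm A (P (2 ^ j - 1) g) = 1" for j
  proof (induction j)
    case (Suc j)
    have "nrm A (P (Suc (2 * (2 ^ j - 1))) g) = 1"
      using cstar_identity[of "P (2 ^ j - 1) g"] g Suc by (simp add: Pstar PP)
    moreover have "Suc (2 * (2 ^ j - 1)) = 2 ^ Suc j - 1"
    proof -
      obtain q :: nat where "2 ^ j = Suc q" using not0_implies_Suc[of "2 ^ j"] by auto
      then show ?thesis by simp
    qed
    ultimately show ?case by simp
  qed (simp add: P0 gnrm)
  obtain N where N: "\<And>m. m \<ge> N \<Longrightarrow> nrm A (P m g) < 1"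
    using order_tendstoD(2)[OF lim, of 1] by (auto simp: eventually_sequentially)
  have "N < 2 ^ N" by (rule less_exp)
  then have "N \<le> 2 ^ N - 1" by linarith
  from N[OF this] one[of N] show False by simp
qed

text \<open>Applied to k^* k, \<open>selfadjoint_nrm_le\<close> gives |k|^2 \<le> N^2, once left
  multiplication by k^* is known to obey the same bound N as that by k.\<close>

lemma lmul_isometric:
  assumes k: "k \<in> compact_ideal" shows "nrm (adjointables A Y) (lmul k) = nrm A k"
proof (rule antisym)
  have kA: "k \<in> carrier A" using k by simp
  then show "nrm (adjointables A Y) (lmul k) \<le> nrm A k" by (rule lmul_nrm_le)
  define N where "N = nrm (adjointables A Y) (lmul k)"
  have N0: "N \<ge> 0" unfolding N_def lmul_def by (rule adj_nrm_nonneg[OF lmul_pair[OF kA]])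
  have kw: "nrm A (k \<otimes> w) \<le> N * nrm A w" if "w \<in> V" for w
    unfolding N_def lmul_def by (rule adj_nrm_ge[OF lmul_pair[OF kA] that])
  \<comment> \<open>For z = k^* w: |z|^2 = |w^* k z| \<le> |w| N |z|, then cancel |z|.\<close>
  have kw': "nrm A (star A k \<otimes> w) \<le> N * nrm A w" if w: "w \<in> V" for w
  proof (cases "star A k \<otimes> w = \<zero>")
    case False
    let ?z = "star A k \<otimes> w"
    have z: "?z \<in> V" using kA w by (intro V_left star_closed)
    have "(nrm A ?z)\<^sup>2 = nrm A (star A w \<otimes> (k \<otimes> ?z))"
      using cstar_identity[of ?z] z kA w by (simp add: star_mult star_closed star_star m_assoc m_closed)
    also have "\<dots> \<le> nrm A w * (N * nrm A ?z)"
      using nrm_mult[of "star A w" "k \<otimes> ?z"] mult_left_mono[OF kw[OF z], of "nrm A w"] z kA w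
      by (simp add: star_closed m_closed)
    finally have "nrm A ?z * nrm A ?z \<le> (N * nrm A w) * nrm A ?z"
      by (simp add: power2_eq_square mult_ac)
    then show ?thesis using nrm_pos[OF _ False] z by simp
  qed (use N0 w in simp)
  have "nrm A (star A k \<otimes> k) \<le> N * N"
  proof (rule selfadjoint_nrm_le)
    show "star A k \<otimes> k \<in> compact_ideal" using k by (simp add: ideal_left star_closed)
    show "star A (star A k \<otimes> k) = star A k \<otimes> k" using kA by (simp add: star_mult star_closed star_star)
    fix w assume w: "w \<in> V"
    have "nrm A (star A k \<otimes> (k \<otimes> w)) \<le> N * (N * nrm A w)"
      using kw'[of "k \<otimes> w"] mult_left_mono[OF kw[OF w] N0] V_left[OF kA w] by simp
    then show "nrm A (star A k \<otimes> k \<otimes> w) \<le> N * N * nrm A w"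
      using kA w by (simp add: m_assoc star_closed mult.assoc)
  qed (use N0 in simp)
  then have "(nrm A k)\<^sup>2 \<le> N\<^sup>2" using kA by (simp add: cstar_identity power2_eq_square)
  then show "nrm A k \<le> nrm (adjointables A Y) (lmul k)"
    using N0 unfolding N_def by (rule power2_le_imp_le)
qed

lemma lmul_inj: "inj_on lmul compact_ideal"
proof (rule inj_onI)
  interpret N: normed_module "adjointables A Y" by (rule adjointables_normed)
  fix k l assume kl: "k \<in> compact_ideal" "l \<in> compact_ideal" "lmul k = lmul l"
  have d: "k \<ominus> l \<in> compact_ideal" using kl ideal_D by simp
  have "k \<otimes> x = l \<otimes> x" if "x \<in> V" for x
  proof -
    have "e (k \<otimes> x) = e (l \<otimes> x)" using lmul_e[OF that, of k] lmul_e[OF that, of l] kl(3) by metis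
    then show ?thesis using kl that by (simp add: V_left)
  qed
  then have "lmul (k \<ominus> l) = lmul \<zero>"
    unfolding lmul_def by (intro lift_op_eqI lift_op_ext) (use kl in \<open>auto simp: minus_mult m_closed\<close>)
  then have "nrm A (k \<ominus> l) = 0"
    using lmul_isometric[OF d] lmul_isometric[OF ideal_D(2)] by simp
  then show "k = l" using kl by (simp add: nrm_diff_eq0)
qed

text \<open>\<open>theta\<close> sends w to x times \<open>\<beta>\<close> of the inner product of y
  and w, and that is x y^* w.\<close>

lemma theta_eq: "\<lbrakk>x \<in> V; y \<in> V\<rbrakk> \<Longrightarrow> theta Y (e x) (e y) = lmul (x \<otimes> star A y)"
  unfolding lmul_def
  by (rule lift_op_eqI) (auto simp: theta_def Y_ract Y_ip_closed Y_ip m_assoc star_closed)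

text \<open>The image of the ideal contains the rank one operators and is closed, because left
  multiplication is isometric on the complete ideal. Conversely, the preimage of the closed span is
  a closed subspace containing all x y^*, hence the ideal.\<close>

lemma compacts_carrier: "carrier (compacts A Y) = lmul ` compact_ideal"
proof -
  let ?B = "adjointables A Y"
  interpret N: normed_module ?B by (rule adjointables_normed)
  let ?T = "{theta Y u v | u v. u \<in> carrier Y \<and> v \<in> carrier Y}"
  have T: "?T = {lmul (x \<otimes> star A y) | x y. x \<in> V \<and> y \<in> V}"
  proof (intro subset_antisym subsetI)
    fix z assume "z \<in> {lmul (x \<otimes> star A y) | x y. x \<in> V \<and> y \<in> V}"
    then obtain x y where "x \<in> V" "y \<in> V" "z = lmul (x \<otimes> star A y)" by blast
    then show "z \<in> ?T" by (intro CollectI exI[of _ "e x"] exI[of _ "e y"]) (simp add: theta_eq)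
  next
    fix z assume "z \<in> ?T"
    then obtain x y where "x \<in> V" "y \<in> V" "z = theta Y (e x) (e y)" unfolding carrier_Y by blast
    then show "z \<in> {lmul (x \<otimes> star A y) | x y. x \<in> V \<and> y \<in> V}" by (auto simp: theta_eq)
  qed
  have TB: "?T \<subseteq> carrier ?B" unfolding T by (auto intro!: lmul_closed simp: m_closed star_closed)
  note span = N.closed_span_props[OF TB]
  have "closed_span ?B ?T \<subseteq> lmul ` compact_ideal"
  proof (rule N.closed_span_le)
    show "submodule (lmul ` compact_ideal) complex_ring ?B"
    proof (rule N.smodI)
      show "lmul ` compact_ideal \<subseteq> carrier ?B" by (auto intro: lmul_closed)
      show "\<zero>\<^bsub>?B\<^esub> \<in> lmul ` compact_ideal"
        using lmul_ops(5) ideal_D(2) by (metis imageI zero_closed)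
      show "x \<oplus>\<^bsub>?B\<^esub> y \<in> lmul ` compact_ideal" if "x \<in> lmul ` compact_ideal" "y \<in> lmul ` compact_ideal" for x y
        using that ideal_D(3) by (auto simp flip: lmul_ops(1))
      show "c \<odot>\<^bsub>?B\<^esub> x \<in> lmul ` compact_ideal" if "x \<in> lmul ` compact_ideal" for c x
        using that ideal_D(4) by (auto simp flip: lmul_ops(2))
    qed
    show "closedin (ntop ?B) (lmul ` compact_ideal)"
    proof (rule N.closedI)
      fix s :: "nat \<Rightarrow> _" and T assume s: "\<And>n. s n \<in> lmul ` compact_ideal" "nconv ?B s T sequentially"
      have "\<forall>n. \<exists>k. k \<in> compact_ideal \<and> s n = lmul k" using s(1) by blast
      then obtain k where k: "\<And>n. k n \<in> compact_ideal" "\<And>n. s n = lmul (k n)" by metis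
      have diff: "nrm ?B (s m \<ominus>\<^bsub>?B\<^esub> s n) = nrm A (k m \<ominus> k n)" for m n
      proof -
        have kA: "k m \<in> carrier A" "k n \<in> carrier A" using k by auto
        have "s m \<ominus>\<^bsub>?B\<^esub> s n = lmul (k m \<ominus> k n)"
          using kA by (simp add: k(2) N.minus_scale lmul_closed minus_scale lmul_ops)
        then show ?thesis using lmul_isometric[of "k m \<ominus> k n"] k(1) ideal_D by simp
      qed
      obtain l where l: "l \<in> compact_ideal" "nconv A k l sequentially"
      proof (rule complete_subset[OF ideal_D(8), of k])
        show "k n \<in> compact_ideal" for n by (rule k)
        show "\<exists>N. \<forall>m\<ge>N. \<forall>n\<ge>N. nrm A (k m \<ominus> k n) < d" if "d > 0" for d
          unfolding diff[symmetric] by (rule N.nconv_Cauchy[OF s(2) _ that]) (simp add: k lmul_closed)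
      qed
      from lmul_nconv[OF l(2)] have "nconv ?B s (lmul l) sequentially" by (simp only: k(2)[symmetric])
      then have "T = lmul l" using N.nconv_unique[OF s(2)] by simp
      then show "T \<in> lmul ` compact_ideal" using l by auto
    qed (auto intro: lmul_closed)
    show "?T \<subseteq> lmul ` compact_ideal" unfolding T using ideal_gen by auto
  qed
  moreover have "lmul k \<in> closed_span ?B ?T" if "k \<in> compact_ideal" for k
  proof -
    let ?H = "{k \<in> carrier A. lmul k \<in> closed_span ?B ?T}"
    note span' = N.smodD[OF span(1)]
    have "compact_ideal \<subseteq> ?H"
    proof (rule ideal_le)
      show "submodule ?H complex_ring A"
        by (rule smodI) (use span' lmul_ops(5) in \<open>auto simp: lmul_ops\<close>)
      show "closedin (ntop A) ?H"
      proof (rule closedI)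
        fix s :: "nat \<Rightarrow> 'a" and x assume s: "\<And>n. s n \<in> ?H" "nconv A s x sequentially"
        from N.closed_nconv[OF span(3) lmul_nconv[OF s(2)]] have "lmul x \<in> closed_span ?B ?T" using s(1) by simp
        then show "x \<in> ?H" using nconv_closed[OF s(2)] by simp
      qed auto
      show "x \<otimes> star A y \<in> ?H" if "x \<in> V" "y \<in> V" for x y
        using that span(2) T by (auto simp: m_closed star_closed)
    qed
    then show ?thesis using that by auto
  qed
  ultimately show ?thesis by (auto simp: compacts_def)
qed

lemma compacts_ops:
  "mult (compacts A Y) = mult (adjointables A Y)" "add (compacts A Y) = add (adjointables A Y)"
  "smult (compacts A Y) = smult (adjointables A Y)" "star (compacts A Y) = star (adjointables A Y)"
  by (simp_all add: compacts_def)

end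

section \<open>Representations and the induced homomorphism on the compacts\<close>

locale corner_rep = corner_module A Y V \<beta> e + B: cstar_algebra B
  for A :: "'a cstar" (structure) and Y :: "('a, 'y) hbimod" and V \<beta> e and B :: "'b cstar" +
  fixes \<psi> :: "'y \<Rightarrow> 'b" and \<pi> :: "'a \<Rightarrow> 'b"
  assumes rep: "toeplitz_rep A Y B \<psi> \<pi>"
begin

abbreviation p :: "'a \<Rightarrow> 'b" where "p x \<equiv> \<psi> (e x)"

lemma pi_hom: "\<pi> \<in> cstar_hom A B" using rep by (simp add: toeplitz_rep_def)

lemmas pi = homD[OF pi_hom]

lemma p_closed [simp]: "x \<in> V \<Longrightarrow> p x \<in> carrier B"
  using rep by (auto simp: toeplitz_rep_def)

lemma p_add: "\<lbrakk>x \<in> V; y \<in> V\<rbrakk> \<Longrightarrow> p (x \<oplus> y) = p x \<oplus>\<^bsub>B\<^esub> p y"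
  using rep Y_add[of x y] by (auto simp: toeplitz_rep_def) (metis e_closed)

lemma p_scale: "x \<in> V \<Longrightarrow> p (c \<odot> x) = c \<odot>\<^bsub>B\<^esub> p x"
  using rep Y_scale[of x c] by (auto simp: toeplitz_rep_def) (metis e_closed)

lemma p_right: "\<lbrakk>x \<in> V; a \<in> carrier A\<rbrakk> \<Longrightarrow> p (x \<otimes> \<beta> a) = p x \<otimes>\<^bsub>B\<^esub> \<pi> a"
  using rep Y_ract[of x a] by (auto simp: toeplitz_rep_def) (metis e_closed)

lemma p_left: "\<lbrakk>x \<in> V; a \<in> carrier A\<rbrakk> \<Longrightarrow> p (a \<otimes> x) = \<pi> a \<otimes>\<^bsub>B\<^esub> p x"
  using rep Y_lact[of x a] by (auto simp: toeplitz_rep_def) (metis e_closed)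

lemma p_ip: "\<lbrakk>x \<in> V; y \<in> V\<rbrakk> \<Longrightarrow> star B (p x) \<otimes>\<^bsub>B\<^esub> p y = \<pi> (ip Y (e x) (e y))"
  using rep by (auto simp: toeplitz_rep_def)

lemma pi_nrm: "a \<in> carrier A \<Longrightarrow> nrm B (\<pi> a) \<le> nrm A a"
  by (rule hom_contractive[OF cstar_algebra_axioms B.cstar_algebra_axioms pi_hom])

lemma pi_nconv: "nconv A f x F \<Longrightarrow> nconv B (\<lambda>i. \<pi> (f i)) (\<pi> x) F"
  by (rule hom_nconv[OF cstar_algebra_axioms B.cstar_algebra_axioms pi_hom])

lemma p_nrm: "x \<in> V \<Longrightarrow> nrm B (p x) \<le> nrm A x"
proof -
  assume x: "x \<in> V"
  have "(nrm B (p x))\<^sup>2 \<le> nrm A (ip Y (e x) (e x))"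
    using B.cstar_identity[of "p x"] p_ip[OF x x] x
      pi_nrm[OF Y_ip_closed[OF x x]] by simp
  also have "\<dots> = (nrm A x)\<^sup>2"
    using beta_nrm[OF Y_ip_closed[OF x x]] x by (simp add: Y_ip cstar_identity)
  finally show ?thesis using x by (simp add: power2_le_iff_abs_le)
qed

lemma p_nconv:
  assumes "nconv A f x F" "\<forall>\<^sub>F i in F. f i \<in> V" "x \<in> V"
  shows "nconv B (\<lambda>i. p (f i)) (p x) F"
  by (rule contractive_nconv[OF normed_module_axioms B.normed_module_axioms V_submodule _ _ _ _ assms])
    (auto simp: p_add p_scale p_nrm)

text \<open>\<open>k_rel k t\<close> characterises the image \<open>t\<close> under \<open>\<psi>\<^sup>(\<^sup>1\<^sup>)\<close> of left multiplication by \<open>k\<close>;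
  the last condition says that \<open>t\<close> lives on the range of \<open>\<psi>\<close>.\<close>

definition k_rel :: "'a \<Rightarrow> 'b \<Rightarrow> bool" where
  "k_rel k t \<longleftrightarrow> k \<in> carrier A \<and> t \<in> carrier B \<and>
     (\<forall>w\<in>V. t \<otimes>\<^bsub>B\<^esub> p w = p (k \<otimes> w) \<and> star B t \<otimes>\<^bsub>B\<^esub> p w = p (star A k \<otimes> w)) \<and>
     (\<forall>b\<in>carrier B. (\<forall>w\<in>V. b \<otimes>\<^bsub>B\<^esub> p w = \<zero>\<^bsub>B\<^esub>) \<longrightarrow>
        b \<otimes>\<^bsub>B\<^esub> t = \<zero>\<^bsub>B\<^esub> \<and> b \<otimes>\<^bsub>B\<^esub> star B t = \<zero>\<^bsub>B\<^esub>)"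

lemma k_relD:
  assumes "k_rel k t"
  shows "k \<in> carrier A" "t \<in> carrier B" "w \<in> V \<Longrightarrow> t \<otimes>\<^bsub>B\<^esub> p w = p (k \<otimes> w)"
    "w \<in> V \<Longrightarrow> star B t \<otimes>\<^bsub>B\<^esub> p w = p (star A k \<otimes> w)"
    "\<lbrakk>b \<in> carrier B; \<And>w. w \<in> V \<Longrightarrow> b \<otimes>\<^bsub>B\<^esub> p w = \<zero>\<^bsub>B\<^esub>\<rbrakk> \<Longrightarrow> b \<otimes>\<^bsub>B\<^esub> t = \<zero>\<^bsub>B\<^esub>"
    "\<lbrakk>b \<in> carrier B; \<And>w. w \<in> V \<Longrightarrow> b \<otimes>\<^bsub>B\<^esub> p w = \<zero>\<^bsub>B\<^esub>\<rbrakk> \<Longrightarrow> b \<otimes>\<^bsub>B\<^esub> star B t = \<zero>\<^bsub>B\<^esub>"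
  using assms by (auto simp: k_rel_def)

lemma k_rel_star: "k_rel k t \<Longrightarrow> k_rel (star A k) (star B t)"
  by (auto simp: k_rel_def star_closed star_star B.star_closed B.star_star)

lemma k_rel_add:
  assumes "k_rel k t" "k_rel l s" shows "k_rel (k \<oplus> l) (t \<oplus>\<^bsub>B\<^esub> s)"
  using k_relD[OF assms(1)] k_relD[OF assms(2)] unfolding k_rel_def
  by (auto simp: l_distr B.l_distr B.r_distr star_add B.star_add star_closed B.star_closed p_add V_left)

lemma k_rel_scale:
  assumes "k_rel k t" shows "k_rel (c \<odot> k) (c \<odot>\<^bsub>B\<^esub> t)"
  using k_relD[OF assms(1)] unfolding k_rel_def
  by (auto simp: smult_mult_l B.smult_mult_l B.smult_mult_r star_smult B.star_smult star_closed
    B.star_closed p_scale V_left)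

lemma k_rel_mult:
  assumes "k_rel k t" "k_rel l s" shows "k_rel (k \<otimes> l) (t \<otimes>\<^bsub>B\<^esub> s)"
proof -
  note K = k_relD[OF assms(1)] and L = k_relD[OF assms(2)]
  note cl = K(1,2) L(1,2)
  have "b \<otimes>\<^bsub>B\<^esub> (t \<otimes>\<^bsub>B\<^esub> s) = \<zero>\<^bsub>B\<^esub> \<and> b \<otimes>\<^bsub>B\<^esub> (star B s \<otimes>\<^bsub>B\<^esub> star B t) = \<zero>\<^bsub>B\<^esub>"
    if b: "b \<in> carrier B" "\<forall>w\<in>V. b \<otimes>\<^bsub>B\<^esub> p w = \<zero>\<^bsub>B\<^esub>" for b
    using K(5)[OF b(1)] L(6)[OF b(1)] b cl by (simp add: B.star_closed flip: B.m_assoc)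
  then show ?thesis unfolding k_rel_def using cl
    by (auto simp: m_closed B.m_closed star_mult B.star_mult m_assoc B.m_assoc star_closed B.star_closed
      K(3,4) L(3,4) V_left)
qed

text \<open>t and \<open>\<pi> k\<close> act equally on the range of \<psi>, so t - \<pi> k
  annihilates t^* by the last condition of \<open>k_rel\<close>, and |t|^2 = |\<pi>(k) t^*| \<le>
  |k| |t|. This bound makes t unique and turns convergence of k into convergence of t.\<close>

lemma k_rel_nrm:
  assumes "k_rel k t" shows "nrm B t \<le> nrm A k"
proof -
  note K = k_relD[OF assms]
  have "t \<ominus>\<^bsub>B\<^esub> \<pi> k \<in> carrier B" using K pi by simp
  moreover have "(t \<ominus>\<^bsub>B\<^esub> \<pi> k) \<otimes>\<^bsub>B\<^esub> p w = \<zero>\<^bsub>B\<^esub>" if "w \<in> V" for w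
    using that K pi by (simp add: B.minus_mult p_left V_left B.m_closed)
  ultimately have "(t \<ominus>\<^bsub>B\<^esub> \<pi> k) \<otimes>\<^bsub>B\<^esub> star B t = \<zero>\<^bsub>B\<^esub>" by (rule K(6))
  then have eq: "t \<otimes>\<^bsub>B\<^esub> star B t = \<pi> k \<otimes>\<^bsub>B\<^esub> star B t"
    using K pi by (simp add: B.minus_mult B.star_closed B.m_closed B.minus_eq_zero)
  have "(nrm B t)\<^sup>2 = nrm B (\<pi> k \<otimes>\<^bsub>B\<^esub> star B t)"
    using B.cstar_identity'[OF K(2)] eq by simp
  also have "\<dots> \<le> nrm B (\<pi> k) * nrm B t"
    using B.nrm_mult[of "\<pi> k" "star B t"] K pi by (simp add: B.star_closed)
  also have "\<dots> \<le> nrm A k * nrm B t"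
    using K pi_nrm[OF K(1)]
    by (intro mult_right_mono) auto
  finally have *: "nrm B t * nrm B t \<le> nrm A k * nrm B t" by (simp add: power2_eq_square)
  show ?thesis
  proof (cases "t = \<zero>\<^bsub>B\<^esub>")
    case False
    then show ?thesis using * B.nrm_pos[OF K(2)] by simp
  qed (use K in simp)
qed

lemma k_rel_minus:
  assumes "k_rel k t" "k_rel l s" shows "k_rel (k \<ominus> l) (t \<ominus>\<^bsub>B\<^esub> s)"
  using k_rel_add[OF assms(1) k_rel_scale[OF assms(2), of "-1"]] k_relD(1,2)[OF assms(1)]
    k_relD(1,2)[OF assms(2)] by (simp add: minus_scale B.minus_scale)

lemma k_rel_unique:
  assumes "k_rel k t" "k_rel k s" shows "t = s"
  using k_rel_nrm[OF k_rel_minus[OF assms]] k_relD(1,2)[OF assms(1)] k_relD(2)[OF assms(2)]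
    B.nrm_ge0[of "t \<ominus>\<^bsub>B\<^esub> s"] B.nrm_diff_eq0[of t s] by (simp del: B.nrm_ge0)

text \<open>By the inner product relation and the right action, p x (p y)^* p w = p (x y^*
  w).\<close>

lemma k_rel_gen:
  assumes "x \<in> V" "y \<in> V" shows "k_rel (x \<otimes> star A y) (p x \<otimes>\<^bsub>B\<^esub> star B (p y))"
proof -
  have *: "p x \<otimes>\<^bsub>B\<^esub> star B (p y) \<otimes>\<^bsub>B\<^esub> p w = p (x \<otimes> star A y \<otimes> w)"
    if "x \<in> V" "y \<in> V" "w \<in> V" for x y w
  proof -
    have "p x \<otimes>\<^bsub>B\<^esub> star B (p y) \<otimes>\<^bsub>B\<^esub> p w = p x \<otimes>\<^bsub>B\<^esub> \<pi> (ip Y (e y) (e w))"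
      using that by (simp add: B.m_assoc B.star_closed p_ip)
    also have "\<dots> = p (x \<otimes> (star A y \<otimes> w))"
      using that by (simp add: Y_ip_closed Y_ip flip: p_right)
    finally show ?thesis using that by (simp add: m_assoc star_closed)
  qed
  show ?thesis unfolding k_rel_def using assms *[OF assms] *[OF assms(2,1)]
    by (auto simp: m_closed B.m_closed star_closed B.star_closed star_mult B.star_mult star_star B.star_star
      simp flip: B.m_assoc)
qed

lemma k_rel_limit:
  assumes kt: "\<And>n::nat. k_rel (k n) (t n)" and k: "nconv A k l sequentially" and t: "nconv B t s sequentially"
  shows "k_rel l s"
proof -
  note K = k_relD[OF kt]
  have ls: "l \<in> carrier A" "s \<in> carrier B" using nconv_closed[OF k] B.nconv_closed[OF t] by auto
  have p_lim: "nconv B (\<lambda>n. p (f n \<otimes> w)) (p (x \<otimes> w)) sequentially"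
    if "nconv A f x sequentially" "w \<in> V" "\<And>n. f n \<in> carrier A" for f x w
    using that nconv_closed[OF that(1)] by (intro p_nconv nconv_mult_right) (auto simp: V_left)
  have z: "b \<otimes>\<^bsub>B\<^esub> s' = \<zero>\<^bsub>B\<^esub>"
    if "nconv B t' s' sequentially" "\<And>n::nat. b \<otimes>\<^bsub>B\<^esub> t' n = \<zero>\<^bsub>B\<^esub>" "b \<in> carrier B" for s' t' b
  proof -
    have "nconv B (\<lambda>n. \<zero>\<^bsub>B\<^esub>) (b \<otimes>\<^bsub>B\<^esub> s') sequentially"
      using B.nconv_mult_left[OF that(1,3)] by (simp add: that(2))
    then show ?thesis using B.nconv_const[OF B.zero_closed] by (rule B.nconv_unique) simp
  qed
  show ?thesis unfolding k_rel_def
  proof (intro conjI ballI impI ls)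
    fix w assume w: "w \<in> V"
    show "s \<otimes>\<^bsub>B\<^esub> p w = p (l \<otimes> w)"
      using B.nconv_unique[OF B.nconv_mult_right[OF t, of "p w"] ] p_lim[OF k w K(1)] w by (simp add: K(3))
    show "star B s \<otimes>\<^bsub>B\<^esub> p w = p (star A l \<otimes> w)"
      using B.nconv_unique[OF B.nconv_mult_right[OF B.nconv_star[OF t], of "p w"]]
        p_lim[OF nconv_star[OF k] w star_closed[OF K(1)]] w by (simp add: K(4))
  next
    fix b assume b: "b \<in> carrier B" "\<forall>w\<in>V. b \<otimes>\<^bsub>B\<^esub> p w = \<zero>\<^bsub>B\<^esub>"
    show "b \<otimes>\<^bsub>B\<^esub> s = \<zero>\<^bsub>B\<^esub>" using b K(5)[OF b(1)] by (intro z[OF t]) auto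
    show "b \<otimes>\<^bsub>B\<^esub> star B s = \<zero>\<^bsub>B\<^esub>"
      using b K(6)[OF b(1)] by (intro z[OF B.nconv_star[OF t]]) auto
  qed
qed

text \<open>The k related to some t form a closed subspace: for k_n converging to l, the norm bound
  makes the t_n a Cauchy sequence, and the relation survives in the limit.\<close>

lemma k_rel_ex: "k \<in> compact_ideal \<Longrightarrow> \<exists>t. k_rel k t"
proof -
  let ?H = "{k \<in> carrier A. \<exists>t. k_rel k t}"
  have "compact_ideal \<subseteq> ?H"
  proof (rule ideal_le)
    have z: "k_rel \<zero> \<zero>\<^bsub>B\<^esub>" using k_rel_scale[OF k_rel_gen[of \<zero> \<zero>], of 0]
      by (simp add: m_closed star_closed B.m_closed B.star_closed)
    show "submodule ?H complex_ring A"
      by (rule smodI) (use z k_rel_add k_rel_scale in \<open>auto; blast\<close>)+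
    show "closedin (ntop A) ?H"
    proof (rule closedI)
      fix k :: "nat \<Rightarrow> 'a" and l assume k: "\<And>n. k n \<in> ?H" "nconv A k l sequentially"
      then obtain t where t: "\<And>n. k_rel (k n) (t n)" by auto metis
      note K = k_relD[OF t]
      have "\<exists>N. \<forall>m\<ge>N. \<forall>n\<ge>N. nrm B (t m \<ominus>\<^bsub>B\<^esub> t n) < d" if "d > 0" for d
        using nconv_Cauchy[OF k(2) K(1) that] k_rel_nrm[OF k_rel_minus[OF t t]] by (meson le_less_trans)
      then obtain s where "nconv B t s sequentially"
        using B.complete_converges[OF B.complete, of t] K(2) by blast
      from k_rel_limit[OF t k(2) this] show "l \<in> ?H" using nconv_closed[OF k(2)] by blast
    qed auto
    show "x \<otimes> star A y \<in> ?H" if "x \<in> V" "y \<in> V" for x y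
      using k_rel_gen[OF that] k_relD(1) by blast
  qed
  then show "k \<in> compact_ideal \<Longrightarrow> \<exists>t. k_rel k t" by auto
qed

text \<open>Gives both the uniqueness of \<psi>^(1) and the reduction of coisometry to the products
  x y^*.\<close>

lemma ideal_hom_eq:
  assumes f: "f \<in> cstar_hom (A\<lparr>carrier := compact_ideal\<rparr>) B" and g: "g \<in> cstar_hom (A\<lparr>carrier := compact_ideal\<rparr>) B"
    and eq: "\<And>x y. \<lbrakk>x \<in> V; y \<in> V\<rbrakk> \<Longrightarrow> f (x \<otimes> star A y) = g (x \<otimes> star A y)"
    and k: "k \<in> compact_ideal"
  shows "f k = g k"
proof -
  note F = sub_homD[OF f] and G = sub_homD[OF g]
  let ?H = "{k \<in> compact_ideal. f k = g k}"
  have lim: "nconv B (\<lambda>n. h (s n)) (h x) sequentially"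
    if h: "h \<in> cstar_hom (A\<lparr>carrier := compact_ideal\<rparr>) B" and s: "nconv A s x sequentially" "\<And>n. s n \<in> compact_ideal" "x \<in> compact_ideal"
    for h x and s :: "nat \<Rightarrow> 'a"
    by (rule contractive_nconv[OF normed_module_axioms B.normed_module_axioms ideal_props(1)])
      (use s sub_homD[OF h] sub_hom_contractive[OF cstar_algebra_axioms B.cstar_algebra_axioms ideal_subalg h] in auto)
  have "compact_ideal \<subseteq> ?H"
  proof (rule ideal_le)
    have "f \<zero> = \<zero>\<^bsub>B\<^esub>" "g \<zero> = \<zero>\<^bsub>B\<^esub>"
      using F(4)[of \<zero> 0] G(4)[of \<zero> 0] F(1)[of \<zero>] G(1)[of \<zero>] ideal_D(2) by auto
    then show "submodule ?H complex_ring A"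
      by (intro smodI) (auto simp: ideal_D F G)
    show "closedin (ntop A) ?H"
    proof (rule closedI)
      fix s :: "nat \<Rightarrow> 'a" and x assume s: "\<And>n. s n \<in> ?H" "nconv A s x sequentially"
      have x: "x \<in> compact_ideal" using closed_nconv[OF ideal_props(3) s(2)] s(1) by simp
      have "nconv B (\<lambda>n. f (s n)) (g x) sequentially" using lim[OF g s(2)] s(1) x by simp
      then have "f x = g x" using B.nconv_unique[OF lim[OF f s(2)]] s(1) x by simp
      then show "x \<in> ?H" using x by simp
    qed auto
    show "x \<otimes> star A y \<in> ?H" if "x \<in> V" "y \<in> V" for x y using that eq ideal_gen by simp
  qed
  then show ?thesis using k by auto
qed

text \<open>The choice is harmless: T determines k since \<open>lmul\<close> is injective on the
  ideal, and k determines t by \<open>k_rel_unique\<close>. Restricting the domain provides the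
  extensionality that \<open>rep_compacts\<close> asks for.\<close>

definition k_hom :: "('y \<Rightarrow> 'y) \<Rightarrow> 'b" where
  "k_hom = (\<lambda>T\<in>lmul ` compact_ideal. SOME t. \<exists>k\<in>compact_ideal. T = lmul k \<and> k_rel k t)"

lemma k_hom_lmul: "\<lbrakk>k \<in> compact_ideal; k_rel k t\<rbrakk> \<Longrightarrow> k_hom (lmul k) = t"
proof -
  assume k: "k \<in> compact_ideal" "k_rel k t"
  have "k_rel k (k_hom (lmul k))"
    using someI_ex[of "\<lambda>t. \<exists>l\<in>compact_ideal. lmul k = lmul l \<and> k_rel l t"] k inj_onD[OF lmul_inj]
    unfolding k_hom_def by fastforce
  then show ?thesis using k(2) by (rule k_rel_unique)
qed

lemma k_hom_hom: "k_hom \<in> cstar_hom (compacts A Y) B"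
proof -
  have *: "\<exists>k t. T = lmul k \<and> k \<in> compact_ideal \<and> k_rel k t" if "T \<in> lmul ` compact_ideal" for T
    using that k_rel_ex by blast
  show ?thesis unfolding cstar_hom_def mem_Collect_eq compacts_carrier compacts_ops
  proof (intro conjI ballI allI funcsetI)
    fix T assume "T \<in> lmul ` compact_ideal"
    then obtain k t where k: "T = lmul k" "k \<in> compact_ideal" "k_rel k t" using * by blast
    show "k_hom T \<in> carrier B" using k k_hom_lmul k_relD(2) by simp
    show "k_hom (c \<odot>\<^bsub>adjointables A Y\<^esub> T) = c \<odot>\<^bsub>B\<^esub> k_hom T" for c
      using k k_hom_lmul[OF k(2,3)] k_hom_lmul[OF ideal_D(4)[OF k(2)] k_rel_scale[OF k(3)], of c] by (simp add: lmul_ops)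
    show "k_hom (star (adjointables A Y) T) = star B (k_hom T)"
      using k k_hom_lmul[OF k(2,3)] k_hom_lmul[OF ideal_D(7)[OF k(2)] k_rel_star[OF k(3)]] by (simp add: lmul_ops)
    fix S assume "S \<in> lmul ` compact_ideal"
    then obtain l s where l: "S = lmul l" "l \<in> compact_ideal" "k_rel l s" using * by blast
    show "k_hom (T \<oplus>\<^bsub>adjointables A Y\<^esub> S) = k_hom T \<oplus>\<^bsub>B\<^esub> k_hom S"
      using k l k_hom_lmul[OF k(2,3)] k_hom_lmul[OF l(2,3)]
        k_hom_lmul[OF ideal_D(3)[OF k(2) l(2)] k_rel_add[OF k(3) l(3)]] by (simp add: lmul_ops)
    show "k_hom (T \<otimes>\<^bsub>adjointables A Y\<^esub> S) = k_hom T \<otimes>\<^bsub>B\<^esub> k_hom S"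
      using k l k_hom_lmul[OF k(2,3)] k_hom_lmul[OF l(2,3)]
        k_hom_lmul[OF ideal_D(6)[OF k(2) l(2)] k_rel_mult[OF k(3) l(3)]] by (simp add: lmul_ops)
  qed
qed

lemma compacts_hom_lmul:
  assumes h: "h \<in> cstar_hom (compacts A Y) B"
  shows "(\<lambda>k. h (lmul k)) \<in> cstar_hom (A\<lparr>carrier := compact_ideal\<rparr>) B"
proof (rule sub_homI)
  have H: "T \<in> lmul ` compact_ideal \<Longrightarrow> h T \<in> carrier B"
    "\<lbrakk>T \<in> lmul ` compact_ideal; S \<in> lmul ` compact_ideal\<rbrakk> \<Longrightarrow> h (T \<oplus>\<^bsub>adjointables A Y\<^esub> S) = h T \<oplus>\<^bsub>B\<^esub> h S"
    "\<lbrakk>T \<in> lmul ` compact_ideal; S \<in> lmul ` compact_ideal\<rbrakk> \<Longrightarrow> h (T \<otimes>\<^bsub>adjointables A Y\<^esub> S) = h T \<otimes>\<^bsub>B\<^esub> h S"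
    "T \<in> lmul ` compact_ideal \<Longrightarrow> h (c \<odot>\<^bsub>adjointables A Y\<^esub> T) = c \<odot>\<^bsub>B\<^esub> h T"
    "T \<in> lmul ` compact_ideal \<Longrightarrow> h (star (adjointables A Y) T) = star B (h T)" for T S c
    using homD[OF h, unfolded compacts_carrier compacts_ops] by auto
  fix k l c assume k: "k \<in> compact_ideal"
  then show "h (lmul k) \<in> carrier B" "h (lmul (c \<odot> k)) = c \<odot>\<^bsub>B\<^esub> h (lmul k)"
    "h (lmul (star A k)) = star B (h (lmul k))"
    using H by (auto simp: lmul_ops simp flip: lmul_ops(4))
  assume l: "l \<in> compact_ideal"
  show "h (lmul (k \<oplus> l)) = h (lmul k) \<oplus>\<^bsub>B\<^esub> h (lmul l)" "h (lmul (k \<otimes> l)) = h (lmul k) \<otimes>\<^bsub>B\<^esub> h (lmul l)"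
    using H k l by (auto simp: lmul_ops)
qed

text \<open>Existence and uniqueness behind the \<open>THE\<close> in
  \<open>rep_compacts\<close>.\<close>

lemma rep_compacts_eq: "rep_compacts A Y B \<psi> = k_hom"
proof -
  have gen: "k_hom (theta Y (e x) (e y)) = p x \<otimes>\<^bsub>B\<^esub> star B (p y)" if "x \<in> V" "y \<in> V" for x y
    using k_hom_lmul[OF ideal_gen k_rel_gen] that by (simp add: theta_eq)
  show ?thesis unfolding rep_compacts_def ballY
  proof (rule the_equality)
    show "k_hom \<in> cstar_hom (compacts A Y) B \<inter> extensional (carrier (compacts A Y)) \<and>
        (\<forall>x\<in>V. \<forall>y\<in>V. k_hom (theta Y (e x) (e y)) = p x \<otimes>\<^bsub>B\<^esub> star B (p y))"
      using k_hom_hom gen by (auto simp: compacts_carrier k_hom_def)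
    fix h assume h: "h \<in> cstar_hom (compacts A Y) B \<inter> extensional (carrier (compacts A Y)) \<and>
        (\<forall>x\<in>V. \<forall>y\<in>V. h (theta Y (e x) (e y)) = p x \<otimes>\<^bsub>B\<^esub> star B (p y))"
    show "h = k_hom"
    proof (rule extensionalityI)
      show "h \<in> extensional (lmul ` compact_ideal)" using h by (auto simp: compacts_carrier)
      show "k_hom \<in> extensional (lmul ` compact_ideal)" by (simp add: k_hom_def)
      fix T assume "T \<in> lmul ` compact_ideal"
      then obtain k where k: "k \<in> compact_ideal" "T = lmul k" by auto
      have "(\<lambda>k. h (lmul k)) k = (\<lambda>k. k_hom (lmul k)) k"
        by (rule ideal_hom_eq[OF compacts_hom_lmul compacts_hom_lmul[OF k_hom_hom] _ k(1)])
          (use h gen theta_eq in auto)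
      then show "h T = k_hom T" using k by simp
    qed
  qed
qed

text \<open>Both \<psi>^(1) after left multiplication and \<pi> are homomorphisms on the ideal, so
  comparing them on the products x y^* is enough. Operators drop out of the argument from here
  on.\<close>

lemma coisometric_iff:
  "coisometric A Y compact_ideal B \<psi> \<pi> \<longleftrightarrow>
    (\<forall>x\<in>V. \<forall>y\<in>V. \<pi> (x \<otimes> star A y) = p x \<otimes>\<^bsub>B\<^esub> star B (p y))"
proof -
  have gen: "k_hom (lmul (x \<otimes> star A y)) = p x \<otimes>\<^bsub>B\<^esub> star B (p y)" if "x \<in> V" "y \<in> V" for x y
    using k_hom_lmul[OF ideal_gen k_rel_gen] that by simp
  have pih: "\<pi> \<in> cstar_hom (A\<lparr>carrier := compact_ideal\<rparr>) B" by (rule sub_homI) (auto simp: pi)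
  have "coisometric A Y compact_ideal B \<psi> \<pi> \<longleftrightarrow> (\<forall>k\<in>compact_ideal. k_hom (lmul k) = \<pi> k)"
    by (simp add: coisometric_def rep_compacts_eq left_action_eq)
  also have "\<dots> \<longleftrightarrow> (\<forall>x\<in>V. \<forall>y\<in>V. \<pi> (x \<otimes> star A y) = p x \<otimes>\<^bsub>B\<^esub> star B (p y))"
    using ideal_hom_eq[OF compacts_hom_lmul[OF k_hom_hom] pih] gen ideal_gen by auto
  finally show ?thesis .
qed

end

section \<open>The fibres of the product system\<close>

text \<open>A three epsilon argument for uniformly contractive maps f u: if the limit along F exists
  at points s j approaching x, it exists at x and is the limit of those limits. It is used where a
  limit along an approximate unit is evident on a dense set only.\<close>

lemma contractive_limit_exists:
  assumes A: "normed_module A" and B: "cstar_algebra B" and S: "submodule S complex_ring A" and F: "F \<noteq> bot"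
    and ev: "\<forall>\<^sub>F u in F. (\<forall>x\<in>S. f u x \<in> carrier B \<and> nrm B (f u x) \<le> nrm A x) \<and>
      (\<forall>x\<in>S. \<forall>y\<in>S. f u (x \<ominus>\<^bsub>A\<^esub> y) = f u x \<ominus>\<^bsub>B\<^esub> f u y)"
    and s: "\<And>j::nat. s j \<in> S" "nconv A s x sequentially" and x: "x \<in> S"
    and t: "\<And>j. nconv B (\<lambda>u. f u (s j)) (t j) F"
  obtains l where "nconv B t l sequentially" "nconv B (\<lambda>u. f u x) l F"
proof -
  interpret A: normed_module A by fact
  interpret B: cstar_algebra B by fact
  note S' = A.smodD[OF S]
  have SA: "y \<in> carrier A" if "y \<in> S" for y using that S' by auto
  have tB: "t j \<in> carrier B" for j using B.nconv_closed[OF t] .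
  \<comment> \<open>Contractivity of the f u, uniform in u, makes the limits t j a Cauchy
    sequence.\<close>
  have t_le: "nrm B (t j \<ominus>\<^bsub>B\<^esub> t k) \<le> nrm A (s j \<ominus>\<^bsub>A\<^esub> s k)" for j k
  proof (rule B.nrm_limit_le[OF B.nconv_minus[OF t t] F _ tendsto_const])
    show "\<forall>\<^sub>F u in F. nrm B (f u (s j) \<ominus>\<^bsub>B\<^esub> f u (s k)) \<le> nrm A (s j \<ominus>\<^bsub>A\<^esub> s k)"
      using ev by eventually_elim (use s S' in metis)
  qed
  have "\<exists>N. \<forall>m\<ge>N. \<forall>n\<ge>N. nrm B (t m \<ominus>\<^bsub>B\<^esub> t n) < d" if "d > 0" for d
    using A.nconv_Cauchy[OF s(2) SA[OF s(1)] that] t_le by (meson le_less_trans)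
  then obtain l where l: "nconv B t l sequentially"
    using B.complete_converges[OF B.complete, of t] tB by blast
  have lB: "l \<in> carrier B" using l by (rule B.nconv_closed)
  have "((\<lambda>u. nrm B (f u x \<ominus>\<^bsub>B\<^esub> l)) \<longlongrightarrow> 0) F"
  proof (rule tendstoI)
    fix d :: real assume d: "d > 0"
    have "\<forall>\<^sub>F j in sequentially. nrm A (s j \<ominus>\<^bsub>A\<^esub> x) < d / 3"
      using s(2) order_tendstoD(2)[of "\<lambda>j. nrm A (s j \<ominus>\<^bsub>A\<^esub> x)" 0 sequentially "d / 3"] d by (simp add: nconv_def)
    moreover have "\<forall>\<^sub>F j in sequentially. nrm B (t j \<ominus>\<^bsub>B\<^esub> l) < d / 3"
      using l order_tendstoD(2)[of "\<lambda>j. nrm B (t j \<ominus>\<^bsub>B\<^esub> l)" 0 sequentially "d / 3"] d by (simp add: nconv_def)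
    ultimately have "\<forall>\<^sub>F j in sequentially. nrm A (s j \<ominus>\<^bsub>A\<^esub> x) < d / 3 \<and> nrm B (t j \<ominus>\<^bsub>B\<^esub> l) < d / 3"
      by (rule eventually_conj)
    then obtain j where j: "nrm A (s j \<ominus>\<^bsub>A\<^esub> x) < d / 3" "nrm B (t j \<ominus>\<^bsub>B\<^esub> l) < d / 3"
      using eventually_happens'[OF sequentially_bot] by blast
    have "\<forall>\<^sub>F u in F. nrm B (f u (s j) \<ominus>\<^bsub>B\<^esub> t j) < d / 3"
      using t[of j] order_tendstoD(2)[of "\<lambda>u. nrm B (f u (s j) \<ominus>\<^bsub>B\<^esub> t j)" 0 F "d / 3"] d by (simp add: nconv_def)
    then show "\<forall>\<^sub>F u in F. dist (nrm B (f u x \<ominus>\<^bsub>B\<^esub> l)) 0 < d"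
      using ev
    proof eventually_elim
      case (elim u)
      have fB: "f u x \<in> carrier B" "f u (s j) \<in> carrier B" using elim x s by auto
      have "nrm B (f u x \<ominus>\<^bsub>B\<^esub> f u (s j)) \<le> nrm A (x \<ominus>\<^bsub>A\<^esub> s j)"
        using elim(2) x s(1)[of j] S'(5) by metis
      then have 1: "nrm B (f u x \<ominus>\<^bsub>B\<^esub> f u (s j)) < d / 3"
        using j(1) A.nrm_minus_commute[OF SA[OF x] SA[OF s(1)[of j]]] by simp
      have 2: "nrm B (f u x \<ominus>\<^bsub>B\<^esub> l) \<le> nrm B (f u x \<ominus>\<^bsub>B\<^esub> f u (s j)) + nrm B (f u (s j) \<ominus>\<^bsub>B\<^esub> l)"
        using fB lB by (intro B.nrm_minus_triangle)
      have 3: "nrm B (f u (s j) \<ominus>\<^bsub>B\<^esub> l) \<le> nrm B (f u (s j) \<ominus>\<^bsub>B\<^esub> t j) + nrm B (t j \<ominus>\<^bsub>B\<^esub> l)"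
        using fB lB tB by (intro B.nrm_minus_triangle)
      have "0 \<le> nrm B (f u x \<ominus>\<^bsub>B\<^esub> l)" using fB lB by simp
      then show ?case using 1 2 3 elim(1) j(2) by (simp add: dist_real_def)
    qed
  qed
  moreover have "\<forall>\<^sub>F u in F. f u x \<in> carrier B" using ev by eventually_elim (use x in simp)
  ultimately have "nconv B (\<lambda>u. f u x) l F" using lB by (simp add: nconv_def)
  with l that show ?thesis by blast
qed

section \<open>Approximate units and extendibility\<close>

context cstar_algebra
begin

lemma approximate_unitD:
  assumes "approximate_unit A F"
  shows "F \<noteq> bot" "\<forall>\<^sub>F u in F. u \<in> carrier A \<and> star A u = u \<and> nrm A u \<le> 1"
    "a \<in> carrier A \<Longrightarrow> nconv A (\<lambda>u. u \<otimes> a) a F" "a \<in> carrier A \<Longrightarrow> nconv A (\<lambda>u. a \<otimes> u) a F"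
proof -
  show "F \<noteq> bot" using assms by (simp add: approximate_unit_def)
  have ev: "\<forall>\<^sub>F u in F. u \<in> carrier A \<and> positive A u \<and> nrm A u \<le> 1"
    using assms by (simp add: approximate_unit_def)
  then show ev': "\<forall>\<^sub>F u in F. u \<in> carrier A \<and> star A u = u \<and> nrm A u \<le> 1"
    by eventually_elim (auto simp: positive_def star_mult star_closed star_star)
  assume a: "a \<in> carrier A"
  have "\<forall>\<^sub>F u in F. u \<otimes> a \<in> carrier A" "\<forall>\<^sub>F u in F. a \<otimes> u \<in> carrier A"
    using ev by (eventually_elim, use a in \<open>simp add: m_closed\<close>)+
  then show "nconv A (\<lambda>u. u \<otimes> a) a F" "nconv A (\<lambda>u. a \<otimes> u) a F"
    using assms a by (auto simp: approximate_unit_def nconv_def)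
qed

lemma multiplier_one_closed: "\<one>\<^bsub>multiplier A\<^esub> \<in> carrier (multiplier A)"
  by (auto simp: multiplier_def)

text \<open>Extendibility enters through the strict limit of f u along some approximate unit; both
  coordinates of the multiplier \<open>ext_one A f\<close> are read off from it.\<close>

lemma ext_one_limit:
  assumes "extendible A f" and f: "f \<in> cstar_hom A A"
  obtains F where "approximate_unit A F"
    "\<And>a. a \<in> carrier A \<Longrightarrow> nconv A (\<lambda>u. f u \<otimes> a) (fst (ext_one A f) a) F"
    "\<And>a. a \<in> carrier A \<Longrightarrow> nconv A (\<lambda>u. a \<otimes> f u) (snd (ext_one A f) a) F"
proof -
  define g where "g = (THE g. is_extension A f g)"
  have g: "is_extension A f g" unfolding g_def by (rule theI'[OF assms(1)[unfolded extendible_def]])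
  have m: "ext_one A f = g \<one>\<^bsub>multiplier A\<^esub>" by (simp add: ext_one_def g_def)
  obtain F where F: "approximate_unit A F" "strict_limit A (\<lambda>u. mult_emb A (f u)) (ext_one A f) F"
    using g unfolding is_extension_def m by blast
  have "ext_one A f \<in> carrier (multiplier A)"
    using g homD(1)[of g "multiplier A" "multiplier A", OF _ multiplier_one_closed]
    unfolding m by (simp add: is_extension_def)
  then have cl: "fst (ext_one A f) a \<in> carrier A \<and> snd (ext_one A f) a \<in> carrier A" if "a \<in> carrier A" for a
    using that by (auto simp: multiplier_def)
  have ev: "\<forall>\<^sub>F u in F. f u \<in> carrier A"
    using approximate_unitD(2)[OF F(1)] by eventually_elim (simp add: homD[OF f])
  have "nconv A (\<lambda>u. f u \<otimes> a) (fst (ext_one A f) a) F \<and> nconv A (\<lambda>u. a \<otimes> f u) (snd (ext_one A f) a) F"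
    if a: "a \<in> carrier A" for a
  proof -
    have "\<forall>\<^sub>F u in F. f u \<otimes> a \<in> carrier A" "\<forall>\<^sub>F u in F. a \<otimes> f u \<in> carrier A"
      using ev by (eventually_elim, use a in \<open>simp add: m_closed\<close>)+
    then show ?thesis using F(2) a cl[OF a] by (simp add: nconv_def strict_limit_def mult_emb_def)
  qed
  with F(1) that show ?thesis by blast
qed

end

section \<open>The dynamical system and right multiplication by p_n\<close>

locale dyn_system = cstar_algebra A for A :: "'a cstar" (structure) +
  fixes \<alpha> :: "nat \<Rightarrow> 'a \<Rightarrow> 'a"
  assumes action: "endo_action A \<alpha>" and ext: "\<And>n. extendible A (\<alpha> n)"
    and inj: "\<And>n. inj_on (\<alpha> n) (carrier A)"
    and hered: "\<And>n. hereditary_subalgebra (\<alpha> n ` carrier A) A"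
begin

abbreviation L :: "nat \<Rightarrow> 'a \<Rightarrow> 'a" where "L \<equiv> transfer_op A \<alpha>"

abbreviation V :: "nat \<Rightarrow> 'a set" where "V n \<equiv> pre_module A \<alpha> n"

abbreviation rmul :: "nat \<Rightarrow> 'a \<Rightarrow> 'a" where "rmul n \<equiv> snd (ext_one A (\<alpha> n))"

abbreviation e :: "nat \<Rightarrow> 'a \<Rightarrow> (nat \<Rightarrow> 'a) set" where "e n x \<equiv> cls A \<alpha> L n (\<lambda>k. x)"

lemma alpha_hom: "\<alpha> n \<in> cstar_hom A A" using action by (simp add: endo_action_def)

lemmas alpha = homD[OF alpha_hom]

lemma alpha_closed [simp]: "a \<in> carrier A \<Longrightarrow> \<alpha> n a \<in> carrier A" by (rule alpha)

lemma alpha_0 [simp]: "a \<in> carrier A \<Longrightarrow> \<alpha> 0 a = a" using action by (simp add: endo_action_def)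

lemma alpha_plus: "a \<in> carrier A \<Longrightarrow> \<alpha> (m + n) a = \<alpha> m (\<alpha> n a)"
  using action by (simp add: endo_action_def)

lemma alpha_minus: "\<lbrakk>a \<in> carrier A; b \<in> carrier A\<rbrakk> \<Longrightarrow> \<alpha> n (a \<ominus> b) = \<alpha> n a \<ominus> \<alpha> n b"
  by (rule hom_minus[OF normed_module_axioms normed_module_axioms alpha_hom])

lemma range_subalg: "cstar_subalgebra (\<alpha> n ` carrier A) A"
  using hered by (simp add: hereditary_subalgebra_def)

lemma alpha_nrm [simp]: "a \<in> carrier A \<Longrightarrow> nrm A (\<alpha> n a) = nrm A a"
  by (rule hom_isometric[OF cstar_algebra_axioms cstar_algebra_axioms alpha_hom inj range_subalg])

lemma alpha_nconv: "nconv A f x F \<Longrightarrow> nconv A (\<lambda>i. \<alpha> n (f i)) (\<alpha> n x) F"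
  by (rule hom_nconv[OF cstar_algebra_axioms cstar_algebra_axioms alpha_hom])

text \<open>The approximate unit in the definition of the extension may depend on n, so each n
  carries its own filter; \<open>V_unit\<close> moves to a common one.\<close>

definition ext_filter :: "nat \<Rightarrow> 'a filter" where
  "ext_filter n = (SOME F. approximate_unit A F \<and> (\<forall>a\<in>carrier A.
     nconv A (\<lambda>u. \<alpha> n u \<otimes> a) (fst (ext_one A (\<alpha> n)) a) F \<and> nconv A (\<lambda>u. a \<otimes> \<alpha> n u) (rmul n a) F))"

lemma ext_filter: "approximate_unit A (ext_filter n)"
  "a \<in> carrier A \<Longrightarrow> nconv A (\<lambda>u. \<alpha> n u \<otimes> a) (fst (ext_one A (\<alpha> n)) a) (ext_filter n)"
  "a \<in> carrier A \<Longrightarrow> nconv A (\<lambda>u. a \<otimes> \<alpha> n u) (rmul n a) (ext_filter n)"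
proof -
  have "\<exists>F. approximate_unit A F \<and> (\<forall>a\<in>carrier A.
      nconv A (\<lambda>u. \<alpha> n u \<otimes> a) (fst (ext_one A (\<alpha> n)) a) F \<and> nconv A (\<lambda>u. a \<otimes> \<alpha> n u) (rmul n a) F)"
    by (rule ext_one_limit[OF ext alpha_hom, of n]) blast
  from someI_ex[OF this] show "approximate_unit A (ext_filter n)"
    "a \<in> carrier A \<Longrightarrow> nconv A (\<lambda>u. \<alpha> n u \<otimes> a) (fst (ext_one A (\<alpha> n)) a) (ext_filter n)"
    "a \<in> carrier A \<Longrightarrow> nconv A (\<lambda>u. a \<otimes> \<alpha> n u) (rmul n a) (ext_filter n)"
    unfolding ext_filter_def by blast+
qed

lemmas ext_unit = approximate_unitD[OF ext_filter(1)]

lemma rmul_closed [simp]: "a \<in> carrier A \<Longrightarrow> rmul n a \<in> carrier A"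
  using ext_filter(3) by (rule nconv_closed)

lemma V_carrier: "x \<in> V n \<Longrightarrow> x \<in> carrier A"
  by (auto simp: pre_module_def)

lemma rmul_eqI:
  assumes "a \<in> carrier A" "nconv A f t (ext_filter n)"
    and "\<And>u. \<lbrakk>u \<in> carrier A; nrm A u \<le> 1\<rbrakk> \<Longrightarrow> f u = a \<otimes> \<alpha> n u"
  shows "rmul n a = t"
proof -
  have "\<forall>\<^sub>F u in ext_filter n. f u = a \<otimes> \<alpha> n u"
    using ext_unit(2) by eventually_elim (simp add: assms(3))
  then have "nconv A (\<lambda>u. a \<otimes> \<alpha> n u) t (ext_filter n)" using assms(2) by (simp add: nconv_cong)
  from nconv_unique[OF ext_filter(3)[OF assms(1)] this ext_unit(1)] show ?thesis .
qed

lemma rmul_add: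
  assumes "a \<in> carrier A" "b \<in> carrier A" shows "rmul n (a \<oplus> b) = rmul n a \<oplus> rmul n b"
  by (rule rmul_eqI[OF _ nconv_add[OF ext_filter(3) ext_filter(3)]]) (use assms in \<open>simp_all add: l_distr\<close>)

lemma rmul_scale:
  assumes "a \<in> carrier A" shows "rmul n (c \<odot> a) = c \<odot> rmul n a"
  by (rule rmul_eqI[OF _ nconv_scale[OF ext_filter(3)]]) (use assms in \<open>simp_all add: smult_mult_l\<close>)

lemma rmul_nrm:
  assumes "a \<in> carrier A" shows "nrm A (rmul n a) \<le> nrm A a"
proof (rule nrm_limit_le[OF ext_filter(3)[OF assms] ext_unit(1) _ tendsto_const])
  show "\<forall>\<^sub>F u in ext_filter n. nrm A (a \<otimes> \<alpha> n u) \<le> nrm A a"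
    using ext_unit(2)
  proof eventually_elim
    case (elim u)
    have "nrm A (a \<otimes> \<alpha> n u) \<le> nrm A a * nrm A u" using nrm_mult[of a "\<alpha> n u"] elim assms by simp
    also have "\<dots> \<le> nrm A a" using elim assms by (simp add: mult_left_le)
    finally show ?case .
  qed
qed

text \<open>a \<alpha>_n(b) \<alpha>_n(u) = a \<alpha>_n(b u), and b u tends to b.\<close>

lemma rmul_alpha:
  assumes "a \<in> carrier A" "b \<in> carrier A" shows "rmul n (a \<otimes> \<alpha> n b) = a \<otimes> \<alpha> n b"
proof (rule rmul_eqI)
  show "nconv A (\<lambda>u. a \<otimes> \<alpha> n (b \<otimes> u)) (a \<otimes> \<alpha> n b) (ext_filter n)"
    by (intro nconv_mult_left alpha_nconv ext_unit(4) assms)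
qed (use assms in \<open>simp_all add: alpha m_assoc m_closed\<close>)

lemma rmul_left:
  assumes "a \<in> carrier A" "x \<in> carrier A" shows "rmul n (a \<otimes> x) = a \<otimes> rmul n x"
  by (rule rmul_eqI[OF _ nconv_mult_left[OF ext_filter(3)]]) (use assms in \<open>simp_all add: m_assoc m_closed\<close>)

lemma rmul_nconv: "nconv A f x F \<Longrightarrow> nconv A (\<lambda>i. rmul n (f i)) (rmul n x) F"
  by (rule contractive_nconv[OF normed_module_axioms normed_module_axioms carrier_is_submodule])
    (auto simp: rmul_add rmul_scale rmul_nrm dest: nconv_closed nconv_eventually)

text \<open>Right multiplication by p_n fixes every a \<alpha>_n(u), and these converge to a
  p_n.\<close>

lemma rmul_rmul:
  assumes a: "a \<in> carrier A" shows "rmul n (rmul n a) = rmul n a"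
proof -
  have "\<forall>\<^sub>F u in ext_filter n. rmul n (a \<otimes> \<alpha> n u) = a \<otimes> \<alpha> n u"
    using ext_unit(2) by eventually_elim (simp add: a rmul_alpha)
  then have "nconv A (\<lambda>u. a \<otimes> \<alpha> n u) (rmul n (rmul n a)) (ext_filter n)"
    using rmul_nconv[OF ext_filter(3)[OF a, of n], of n] by (simp add: nconv_cong)
  from nconv_unique[OF this ext_filter(3)[OF a] ext_unit(1)] show ?thesis .
qed

text \<open>As the fixed point set of a continuous linear map, \<open>V n\<close> is visibly a
  closed subspace.\<close>

lemma V_iff: "x \<in> V n \<longleftrightarrow> x \<in> carrier A \<and> rmul n x = x"
  by (auto simp: pre_module_def rmul_rmul) (metis imageI)

lemma V_submodule: "submodule (V n) complex_ring A"
proof (rule smodI)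
  show "\<zero> \<in> V n" using rmul_scale[of \<zero> n 0] by (simp add: V_iff)
qed (auto simp: V_iff rmul_add rmul_scale)

lemma V_closedin: "closedin (ntop A) (V n)"
proof (rule closedI)
  fix s :: "nat \<Rightarrow> 'a" and x assume s: "\<And>i. s i \<in> V n" "nconv A s x sequentially"
  have "nconv A s (rmul n x) sequentially" using rmul_nconv[OF s(2), of n] s(1) by (simp add: V_iff)
  then have "rmul n x = x" using s(2) by (rule nconv_unique) simp
  then show "x \<in> V n" using nconv_closed[OF s(2)] by (simp add: V_iff)
qed (auto simp: V_iff)

lemma V_left: "\<lbrakk>a \<in> carrier A; x \<in> V n\<rbrakk> \<Longrightarrow> a \<otimes> x \<in> V n"
  by (simp add: V_iff rmul_left m_closed)

lemma V_gen: "\<lbrakk>a \<in> carrier A; b \<in> carrier A\<rbrakk> \<Longrightarrow> a \<otimes> \<alpha> n b \<in> V n"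
  by (simp add: V_iff rmul_alpha m_closed)

text \<open>A single approximate unit for all n, because limits belonging to different n are
  compared later.\<close>

definition unit_filter :: "'a filter" where
  "unit_filter = (SOME F. approximate_unit A F)"

lemma unit_filter: "approximate_unit A unit_filter"
  unfolding unit_filter_def using ext_filter(1)[of 0] by (rule someI)

lemmas unit = approximate_unitD[OF unit_filter]

text \<open>The elements with this property are closed under limits, right multiplication by
  \<alpha>_n(u) being contractive; they include all x \<alpha>_n(v), since v u tends to v; and x is
  a limit of such elements along \<open>ext_filter n\<close>.\<close>

lemma V_unit:
  assumes x: "x \<in> V n" shows "nconv A (\<lambda>u. x \<otimes> \<alpha> n u) x unit_filter"
proof -
  let ?H = "{x \<in> carrier A. nconv A (\<lambda>u. x \<otimes> \<alpha> n u) x unit_filter}"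
  have closed: "closedin (ntop A) ?H"
  proof (rule closedI)
    fix s :: "nat \<Rightarrow> 'a" and x assume s: "\<And>i. s i \<in> ?H" "nconv A s x sequentially"
    have x: "x \<in> carrier A" using s(2) by (rule nconv_closed)
    have ev: "\<forall>\<^sub>F u in unit_filter.
        (\<forall>y\<in>carrier A. y \<otimes> \<alpha> n u \<in> carrier A \<and> nrm A (y \<otimes> \<alpha> n u) \<le> nrm A y) \<and>
        (\<forall>y\<in>carrier A. \<forall>z\<in>carrier A. (y \<ominus> z) \<otimes> \<alpha> n u = y \<otimes> \<alpha> n u \<ominus> z \<otimes> \<alpha> n u)"
      using unit(2)
    proof eventually_elim
      case (elim u)
      have "nrm A (y \<otimes> \<alpha> n u) \<le> nrm A y" if y: "y \<in> carrier A" for y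
        using nrm_mult[OF y, of "\<alpha> n u"] mult_left_le[of "nrm A u" "nrm A y"] elim y by simp
      then show ?case using elim by (simp add: m_closed minus_mult)
    qed
    obtain l where l: "nconv A s l sequentially" "nconv A (\<lambda>u. x \<otimes> \<alpha> n u) l unit_filter"
      by (rule contractive_limit_exists[OF normed_module_axioms cstar_algebra_axioms carrier_is_submodule
          unit(1) ev _ s(2) x, of s]) (use s(1) in auto)
    then have "l = x" using nconv_unique[OF l(1) s(2)] by simp
    then show "x \<in> ?H" using x l(2) by simp
  qed auto
  have lim: "nconv A (\<lambda>v. x \<otimes> \<alpha> n v) x (ext_filter n)" using ext_filter(3)[of x n] x by (simp add: V_iff)
  have ev: "\<forall>\<^sub>F v in ext_filter n. x \<otimes> \<alpha> n v \<in> ?H"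
    using ext_unit(2)
  proof eventually_elim
    case (elim v)
    have xA: "x \<in> carrier A" using x by (rule V_carrier)
    have "nconv A (\<lambda>u. x \<otimes> \<alpha> n (v \<otimes> u)) (x \<otimes> \<alpha> n v) unit_filter"
      using elim xA unit(4) by (intro nconv_mult_left alpha_nconv) auto
    moreover have "\<forall>\<^sub>F u in unit_filter. x \<otimes> \<alpha> n (v \<otimes> u) = x \<otimes> \<alpha> n v \<otimes> \<alpha> n u"
      using unit(2) by eventually_elim (use elim xA in \<open>simp add: alpha m_assoc\<close>)
    ultimately show ?case using elim xA by (simp add: nconv_cong m_closed)
  qed
  have "x \<in> ?H" by (rule closed_nconv[OF closed lim ext_unit(1) ev])
  then show ?thesis by simp
qed

text \<open>\<open>\<alpha> 0\<close> is the identity, so x u lies in \<open>V 0\<close> for u in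
  the approximate unit.\<close>

lemma V_0: "V 0 = carrier A"
proof -
  have "x \<in> V 0" if "x \<in> carrier A" for x
  proof (rule closed_nconv[OF V_closedin])
    show "nconv A (\<lambda>u. x \<otimes> u) x unit_filter" using that by (rule unit(4))
    show "\<forall>\<^sub>F u in unit_filter. x \<otimes> u \<in> V 0"
      using unit(2) by eventually_elim (use V_gen[OF that, of _ 0] in simp)
  qed (rule unit(1))
  then show ?thesis using V_carrier by auto
qed

text \<open>With y = lim y \<alpha>_n(u), the element x \<alpha>_m(y) is the limit of x
  \<alpha>_m(y) \<alpha>_(m+n)(u), which lie in A \<alpha>_(m+n)(A).\<close>

lemma V_mult:
  assumes x: "x \<in> carrier A" and y: "y \<in> V n" shows "x \<otimes> \<alpha> m y \<in> V (m + n)"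
proof (rule closed_nconv[OF V_closedin])
  have yA: "y \<in> carrier A" using y by (rule V_carrier)
  show "nconv A (\<lambda>u. x \<otimes> \<alpha> m (y \<otimes> \<alpha> n u)) (x \<otimes> \<alpha> m y) unit_filter"
    using x by (intro nconv_mult_left alpha_nconv V_unit y)
  show "\<forall>\<^sub>F u in unit_filter. x \<otimes> \<alpha> m (y \<otimes> \<alpha> n u) \<in> V (m + n)"
    using unit(2)
  proof eventually_elim
    case (elim u)
    then have "x \<otimes> \<alpha> m (y \<otimes> \<alpha> n u) = (x \<otimes> \<alpha> m y) \<otimes> \<alpha> (m + n) u"
      using x yA by (simp add: alpha alpha_plus m_assoc)
    then show ?case using V_gen x yA elim by (simp add: m_closed)
  qed
qed (rule unit(1))

text \<open>As \<alpha>_(n+1)(u) = \<alpha>_n(\<alpha>_1(u)), the approximants x \<alpha>_(n+1)(u)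
  already lie in \<open>V n\<close>. This decreasing chain lets \<psi>_(n+1) be built from \<psi>_n
  at the same x.\<close>

lemma V_Suc: "x \<in> V (Suc n) \<Longrightarrow> x \<in> V n"
proof (rule closed_nconv[OF V_closedin V_unit unit(1)])
  assume x: "x \<in> V (Suc n)"
  then show "x \<in> V (Suc n)" .
  show "\<forall>\<^sub>F u in unit_filter. x \<otimes> \<alpha> (Suc n) u \<in> V n"
    using unit(2)
  proof eventually_elim
    case (elim u)
    then have "\<alpha> (Suc n) u = \<alpha> n (\<alpha> 1 u)" using alpha_plus[of u n 1] by simp
    then show ?case using V_gen[OF V_carrier[OF x], of "\<alpha> 1 u" n] elim by simp
  qed
qed

text \<open>The place where heredity enters: \<open>hereditary_corner\<close> with b = \<alpha>_n(u)
  puts the approximating products in the range, and the range is closed.\<close>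

lemma V_inner_range:
  assumes x: "x \<in> V n" and y: "y \<in> V n" shows "star A x \<otimes> y \<in> \<alpha> n ` carrier A"
proof (rule closed_nconv[OF subalgD(8)[OF range_subalg]])
  show "nconv A (\<lambda>u. star A (x \<otimes> \<alpha> n u) \<otimes> (y \<otimes> \<alpha> n u)) (star A x \<otimes> y) unit_filter"
    by (intro nconv_mult nconv_star V_unit x y)
  show "\<forall>\<^sub>F u in unit_filter. star A (x \<otimes> \<alpha> n u) \<otimes> (y \<otimes> \<alpha> n u) \<in> \<alpha> n ` carrier A"
    using unit(2) by eventually_elim
      (use x y in \<open>auto intro!: hereditary_corner[OF hered] V_carrier\<close>)
qed (rule unit(1))

text \<open>Since x = x p_n and y = y p_n, compressing x^* y by p_n changes nothing, and
  \<open>L n\<close> becomes the plain inverse of \<open>\<alpha> n\<close> there.\<close>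

lemma transfer_inner:
  assumes x: "x \<in> V n" and y: "y \<in> V n"
  shows "L n (star A x \<otimes> y) \<in> carrier A" "\<alpha> n (L n (star A x \<otimes> y)) = star A x \<otimes> y"
proof -
  let ?z = "star A x \<otimes> y"
  have xA: "x \<in> carrier A" "y \<in> carrier A" using x y V_carrier by auto
  then have z: "?z \<in> carrier A" by (simp add: m_closed star_closed)
  have "nconv A (\<lambda>u. star A (x \<otimes> \<alpha> n u) \<otimes> y) ?z (ext_filter n)"
    using ext_filter(3)[of x n] x xA by (intro nconv_mult_right nconv_star) (auto simp: V_iff)
  moreover have "\<forall>\<^sub>F u in ext_filter n. star A (x \<otimes> \<alpha> n u) \<otimes> y = \<alpha> n u \<otimes> ?z"
    using ext_unit(2)
    by eventually_elim (use xA in \<open>simp add: star_mult m_assoc star_closed flip: alpha(5)\<close>)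
  ultimately have "nconv A (\<lambda>u. \<alpha> n u \<otimes> ?z) ?z (ext_filter n)" by (simp add: nconv_cong)
  from nconv_unique[OF ext_filter(2)[OF z] this ext_unit(1)]
  have l: "fst (ext_one A (\<alpha> n)) ?z = ?z" .
  have "rmul n ?z = ?z" using rmul_left[of "star A x" y n] xA y by (simp add: star_closed V_iff)
  then have "L n ?z = the_inv_into (carrier A) (\<alpha> n) ?z" by (simp add: transfer_op_def l)
  then show "L n ?z \<in> carrier A" "\<alpha> n (L n ?z) = ?z"
    using V_inner_range[OF x y] the_inv_into_into[OF inj _ order_refl] f_the_inv_into_f[OF inj] by auto
qed

section \<open>The fibres: Cauchy sequences and their limits\<close>

lemma pre_norm_eq: "x \<in> V n \<Longrightarrow> pre_norm A L n x = nrm A x"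
proof -
  assume x: "x \<in> V n"
  have "nrm A (L n (star A x \<otimes> x)) = (nrm A x)\<^sup>2"
    using alpha_nrm[OF transfer_inner(1)[OF x x], of n] transfer_inner(2)[OF x x] cstar_identity[OF V_carrier[OF x]]
    by simp
  then show ?thesis using V_carrier[OF x] by (simp add: pre_norm_def pre_ip_def)
qed

lemma V_minus: "\<lbrakk>x \<in> V n; y \<in> V n\<rbrakk> \<Longrightarrow> x \<ominus> y \<in> V n"
  by (rule smodD(5)[OF V_submodule])

lemma cauchy_seqs_iff:
  "s \<in> cauchy_seqs A \<alpha> L n \<longleftrightarrow> (\<forall>k. s k \<in> V n) \<and> (\<exists>x\<in>V n. nconv A s x sequentially)"
proof (cases "\<forall>k. s k \<in> V n")
  case True
  then have *: "pre_norm A L n (s k \<ominus> s l) = nrm A (s k \<ominus> s l)" for k l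
    by (simp add: pre_norm_eq V_minus)
  show ?thesis
  proof
    assume "s \<in> cauchy_seqs A \<alpha> L n"
    then have c: "\<exists>N. \<forall>k\<ge>N. \<forall>l\<ge>N. nrm A (s k \<ominus> s l) < d" if "d > 0" for d
      using that by (simp add: cauchy_seqs_def *)
    obtain x where "x \<in> V n" "nconv A s x sequentially"
      using complete_subset[OF V_closedin, of s n] c True by blast
    then show "(\<forall>k. s k \<in> V n) \<and> (\<exists>x\<in>V n. nconv A s x sequentially)" using True by blast
  next
    assume "(\<forall>k. s k \<in> V n) \<and> (\<exists>x\<in>V n. nconv A s x sequentially)"
    then obtain x where x: "nconv A s x sequentially" by blast
    have "\<exists>N. \<forall>k\<ge>N. \<forall>l\<ge>N. nrm A (s k \<ominus> s l) < d" if "d > 0" for d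
      using nconv_Cauchy[OF x _ that] True V_carrier by blast
    then show "s \<in> cauchy_seqs A \<alpha> L n" using True by (simp add: cauchy_seqs_def *)
  qed
qed (auto simp: cauchy_seqs_def)

text \<open>The seminorm is the norm of A and \<open>V n\<close> is complete, so a class consists of
  all sequences in \<open>V n\<close> with a common limit.\<close>

lemma cls_limit:
  assumes s: "\<And>k. s k \<in> V n" "nconv A s x sequentially" and x: "x \<in> V n"
  shows "cls A \<alpha> L n s = {t. (\<forall>k. t k \<in> V n) \<and> nconv A t x sequentially}"
proof -
  have s': "s \<in> cauchy_seqs A \<alpha> L n" using s x by (auto simp: cauchy_seqs_iff)
  have "(s, t) \<in> cauchy_rel A \<alpha> L n \<longleftrightarrow> (\<forall>k. t k \<in> V n) \<and> nconv A t x sequentially" for t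
  proof
    assume "(s, t) \<in> cauchy_rel A \<alpha> L n"
    then have t: "\<forall>k. t k \<in> V n" "(\<lambda>k. pre_norm A L n (s k \<ominus> t k)) \<longlonglongrightarrow> 0"
      by (auto simp: cauchy_rel_def cauchy_seqs_iff)
    then have "(\<lambda>k. nrm A (s k \<ominus> t k)) \<longlonglongrightarrow> 0" using s(1) by (simp add: pre_norm_eq V_minus)
    moreover have "s k \<ominus> t k \<in> carrier A" for k using s(1) t(1) V_minus V_carrier by blast
    ultimately have "nconv A (\<lambda>k. s k \<ominus> t k) \<zero> sequentially" by (simp add: nconv_def)
    from nconv_minus[OF s(2) this]
    have "nconv A (\<lambda>k. s k \<ominus> (s k \<ominus> t k)) x sequentially" using V_carrier[OF x] by simp
    moreover have "s k \<ominus> (s k \<ominus> t k) = t k" for k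
      using V_carrier[OF s(1)[of k]] V_carrier[of "t k" n] t(1) by (simp add: minus_minus_self)
    ultimately show "(\<forall>k. t k \<in> V n) \<and> nconv A t x sequentially" using t by simp
  next
    assume t: "(\<forall>k. t k \<in> V n) \<and> nconv A t x sequentially"
    then have "nconv A (\<lambda>k. s k \<ominus> t k) (x \<ominus> x) sequentially" using s by (intro nconv_minus) auto
    then have "(\<lambda>k. nrm A (s k \<ominus> t k)) \<longlonglongrightarrow> 0"
      using nconv_nrm V_carrier[OF x] by fastforce
    then have "(\<lambda>k. pre_norm A L n (s k \<ominus> t k)) \<longlonglongrightarrow> 0" using s(1) t by (simp add: pre_norm_eq V_minus)
    then show "(s, t) \<in> cauchy_rel A \<alpha> L n" using s' t x by (auto simp: cauchy_rel_def cauchy_seqs_iff)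
  qed
  then show ?thesis by (auto simp: cls_def)
qed

lemma e_eq: "x \<in> V n \<Longrightarrow> e n x = {t. (\<forall>k. t k \<in> V n) \<and> nconv A t x sequentially}"
  by (rule cls_limit) (auto intro: nconv_const V_carrier)

lemma cls_e: "\<lbrakk>\<And>k. s k \<in> V n; nconv A s x sequentially; x \<in> V n\<rbrakk> \<Longrightarrow> cls A \<alpha> L n s = e n x"
  by (simp add: cls_limit e_eq)

text \<open>The representative is an unspecified choice, but its limit is not; every operation of
  the fibre is continuous and so depends on that limit alone.\<close>

lemma rep_e:
  assumes "x \<in> V n" shows "\<And>k. rep (e n x) k \<in> V n" "nconv A (rep (e n x)) x sequentially"
proof -
  have "(\<lambda>k. x) \<in> e n x" using assms by (simp add: e_eq nconv_const V_carrier)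
  then have "rep (e n x) \<in> e n x" unfolding rep_def by (rule someI[where P = "\<lambda>s. s \<in> e n x"])
  then show "\<And>k. rep (e n x) k \<in> V n" "nconv A (rep (e n x)) x sequentially"
    using assms by (auto simp: e_eq)
qed

lemma e_inj: "\<lbrakk>x \<in> V n; y \<in> V n; e n x = e n y\<rbrakk> \<Longrightarrow> x = y"
  using rep_e(2)[of x n] rep_e(2)[of y n] nconv_unique[of _ x sequentially y] by simp

lemma fibre_carrier: "carrier (dyn_fibre A \<alpha> L n) = e n ` V n"
proof -
  have "carrier (dyn_fibre A \<alpha> L n) = cls A \<alpha> L n ` cauchy_seqs A \<alpha> L n"
    by (auto simp: dyn_fibre_def quotient_def cls_def)
  also have "\<dots> = e n ` V n"
  proof (intro subset_antisym subsetI)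
    fix z assume "z \<in> cls A \<alpha> L n ` cauchy_seqs A \<alpha> L n"
    then obtain s where s: "s \<in> cauchy_seqs A \<alpha> L n" "z = cls A \<alpha> L n s" by blast
    then obtain x where "x \<in> V n" "nconv A s x sequentially" by (auto simp: cauchy_seqs_iff)
    then show "z \<in> e n ` V n" using s cls_e[of s n x] by (auto simp: cauchy_seqs_iff)
  next
    fix z assume "z \<in> e n ` V n"
    then obtain x where "x \<in> V n" "z = e n x" by auto
    then show "z \<in> cls A \<alpha> L n ` cauchy_seqs A \<alpha> L n"
      by (auto simp: cauchy_seqs_iff intro!: imageI bexI nconv_const V_carrier)
  qed
  finally show ?thesis .
qed

lemma fibre_ip:
  assumes x: "x \<in> V n" and y: "y \<in> V n"
  shows "ip (dyn_fibre A \<alpha> L n) (e n x) (e n y) = L n (star A x \<otimes> y)"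
proof -
  let ?s = "rep (e n x)" and ?t = "rep (e n y)"
  note X = rep_e[OF x] and Y = rep_e[OF y]
  have cl: "L n (star A (?s k) \<otimes> ?t k) \<in> carrier A" for k using transfer_inner X Y by simp
  have 1: "nconv A (\<lambda>k. star A (?s k) \<otimes> ?t k) (star A x \<otimes> y) sequentially"
    by (intro nconv_mult nconv_star X Y)
  \<comment> \<open>\<open>\<alpha> n\<close> is isometric, so convergence of the inner products can
    be read off from their images.\<close>
  have "nrm A (\<alpha> n (L n (star A (?s k) \<otimes> ?t k)) \<ominus> \<alpha> n (L n (star A x \<otimes> y)))
      = nrm A (L n (star A (?s k) \<otimes> ?t k) \<ominus> L n (star A x \<otimes> y))" for k
    by (subst alpha_minus[symmetric]) (use cl transfer_inner(1)[OF x y] in simp_all)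
  then have "(\<lambda>k. nrm A (L n (star A (?s k) \<otimes> ?t k) \<ominus> L n (star A x \<otimes> y))) \<longlonglongrightarrow> 0"
    using 1 X Y transfer_inner x y by (simp add: nconv_def)
  then have "nconv A (\<lambda>k. pre_ip A L n (?s k) (?t k)) (L n (star A x \<otimes> y)) sequentially"
    using cl transfer_inner[OF x y] by (simp add: nconv_def pre_ip_def)
  then have lim: "limitin (ntop A) (\<lambda>k. pre_ip A L n (?s k) (?t k)) (L n (star A x \<otimes> y)) sequentially"
    using limitin_iff_nconv[of "\<lambda>k. pre_ip A L n (?s k) (?t k)"] cl by (simp add: pre_ip_def)
  have "(THE l. limitin (ntop A) (\<lambda>k. pre_ip A L n (?s k) (?t k)) l sequentially) = L n (star A x \<otimes> y)"
  proof (rule the_equality)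
    fix l assume "limitin (ntop A) (\<lambda>k. pre_ip A L n (?s k) (?t k)) l sequentially"
    then show "l = L n (star A x \<otimes> y)"
      using Metric_space.limitin_metric_unique[OF metric _ lim] by simp
  qed (rule lim)
  then show ?thesis by (simp add: dyn_fibre_def)
qed

lemma fibre_module: "corner_module A (dyn_fibre A \<alpha> L n) (V n) (\<alpha> n) (e n)"
proof (intro corner_module.intro corner_module_axioms.intro)
  show "cstar_algebra A" by (rule cstar_algebra_axioms)
  let ?Y = "dyn_fibre A \<alpha> L n"
  note VD = smodD[OF V_submodule]
  show "submodule (V n) complex_ring A" by (rule V_submodule)
  show "closedin (ntop A) (V n)" by (rule V_closedin)
  show "a \<otimes> x \<in> V n" if "a \<in> carrier A" "x \<in> V n" for a x using that by (rule V_left)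
  show right: "x \<otimes> \<alpha> n a \<in> V n" if "x \<in> V n" "a \<in> carrier A" for x a using that V_gen V_carrier by simp
  show "\<alpha> n a \<in> carrier A" "nrm A (\<alpha> n a) = nrm A a" if "a \<in> carrier A" for a using that by simp_all
  show "\<alpha> n (a \<ominus> b) = \<alpha> n a \<ominus> \<alpha> n b" if "a \<in> carrier A" "b \<in> carrier A" for a b
    using that by (rule alpha_minus)
  show "bij_betw (e n) (V n) (carrier ?Y)"
    using e_inj by (auto simp: bij_betw_def fibre_carrier intro!: inj_onI)
  show "\<zero>\<^bsub>?Y\<^esub> = e n \<zero>" by (simp add: dyn_fibre_def)
  fix x assume x: "x \<in> V n"
  note X = rep_e[OF x]
  show "c \<odot>\<^bsub>?Y\<^esub> e n x = e n (c \<odot> x)" for c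
    using X x VD by (simp add: dyn_fibre_def cls_e nconv_scale)
  show "ract ?Y (e n x) a = e n (x \<otimes> \<alpha> n a)" if "a \<in> carrier A" for a
    using that X x right by (simp add: dyn_fibre_def cls_e nconv_mult_right)
  show "lact ?Y a (e n x) = e n (a \<otimes> x)" if "a \<in> carrier A" for a
    using that X x V_left by (simp add: dyn_fibre_def cls_e nconv_mult_left)
  fix y assume y: "y \<in> V n"
  note Y = rep_e[OF y]
  show "e n x \<oplus>\<^bsub>?Y\<^esub> e n y = e n (x \<oplus> y)"
    using X Y x y VD by (simp add: dyn_fibre_def cls_e nconv_add)
  show "ip ?Y (e n x) (e n y) \<in> carrier A" "\<alpha> n (ip ?Y (e n x) (e n y)) = star A x \<otimes> y"
    using transfer_inner[OF x y] by (simp_all add: fibre_ip[OF x y])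
qed

lemma ps_mult_e:
  assumes x: "x \<in> V m" and y: "y \<in> V n"
  shows "ps_mult (dyn_product_system A \<alpha> L) (m, e m x) (n, e n y) = (m + n, e (m + n) (x \<otimes> \<alpha> m y))"
proof -
  note X = rep_e[OF x] and Y = rep_e[OF y]
  have "cls A \<alpha> L (m + n) (\<lambda>k. rep (e m x) k \<otimes> \<alpha> m (rep (e n y) k)) = e (m + n) (x \<otimes> \<alpha> m y)"
    by (rule cls_e) (use X Y x y in \<open>auto intro!: V_mult nconv_mult alpha_nconv V_carrier\<close>)
  then show ?thesis by (simp add: dyn_product_system_def)
qed

text \<open>x y^* is the limit of x \<alpha>_n(u) y^*, and a \<alpha>_n(b) c is the limit of a
  \<alpha>_n(b) \<alpha>_n(u) c, a product of an element of \<open>V n\<close> with the adjoint of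
  c^* \<alpha>_n(u), another such element.\<close>

lemma range_ideal_eq: "corner_module.compact_ideal A (V n) = range_ideal A \<alpha> n"
proof
  interpret C: corner_module A "dyn_fibre A \<alpha> L n" "V n" "\<alpha> n" "e n" by (rule fibre_module)
  let ?G = "{a \<otimes> \<alpha> n b \<otimes> c | a b c. a \<in> carrier A \<and> b \<in> carrier A \<and> c \<in> carrier A}"
  have G: "?G \<subseteq> carrier A" by (auto simp: m_closed)
  note span = closed_span_props[OF G, folded range_ideal_def]
  show "C.compact_ideal \<subseteq> range_ideal A \<alpha> n"
  proof (rule C.ideal_le[OF span(1,3)])
    fix x y assume xy: "x \<in> V n" "y \<in> V n"
    show "x \<otimes> star A y \<in> range_ideal A \<alpha> n"
    proof (rule closed_nconv[OF span(3) _ unit(1)])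
      show "nconv A (\<lambda>u. x \<otimes> \<alpha> n u \<otimes> star A y) (x \<otimes> star A y) unit_filter"
        using xy by (intro nconv_mult_right V_unit star_closed V_carrier)
      show "\<forall>\<^sub>F u in unit_filter. x \<otimes> \<alpha> n u \<otimes> star A y \<in> range_ideal A \<alpha> n"
        using unit(2)
      proof eventually_elim
        case (elim u)
        have "x \<otimes> \<alpha> n u \<otimes> star A y \<in> ?G"
          using elim V_carrier[OF xy(1)] star_closed[OF V_carrier[OF xy(2)]] by blast
        then show ?case using span(2) by blast
      qed
    qed
  qed
  show "range_ideal A \<alpha> n \<subseteq> C.compact_ideal"
    unfolding range_ideal_def
  proof (rule closed_span_le[OF C.ideal_props(1,3)], safe)
    fix a b c assume abc: "a \<in> carrier A" "b \<in> carrier A" "c \<in> carrier A"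
    show "a \<otimes> \<alpha> n b \<otimes> c \<in> C.compact_ideal"
    proof (rule closed_nconv[OF C.ideal_props(3) _ unit(1)])
      show "nconv A (\<lambda>u. a \<otimes> \<alpha> n (b \<otimes> u) \<otimes> c) (a \<otimes> \<alpha> n b \<otimes> c) unit_filter"
        using abc by (intro nconv_mult_right nconv_mult_left alpha_nconv unit(4))
      show "\<forall>\<^sub>F u in unit_filter. a \<otimes> \<alpha> n (b \<otimes> u) \<otimes> c \<in> C.compact_ideal"
        using unit(2)
      proof eventually_elim
        case (elim u)
        have "a \<otimes> \<alpha> n (b \<otimes> u) \<otimes> c = (a \<otimes> \<alpha> n b) \<otimes> star A (star A c \<otimes> \<alpha> n u)"
          using abc elim by (simp add: alpha m_closed m_assoc star_mult star_closed star_star flip: alpha(5))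
        moreover have "(a \<otimes> \<alpha> n b) \<otimes> star A (star A c \<otimes> \<alpha> n u) \<in> C.compact_ideal"
          using abc elim by (intro C.ideal_gen V_gen) (auto simp: star_closed)
        ultimately show ?case by simp
      qed
    qed
  qed
qed

end

section \<open>Extension of a representation of the first fibre\<close>

(* The simplifier would otherwise turn the index 1 into Suc 0, where no rule about the first fibre applies. *)
declare One_nat_def [simp del]

context dyn_system
begin

lemma alpha_V: "b \<in> carrier A \<Longrightarrow> \<alpha> n b \<in> V n"
proof (rule closed_nconv[OF V_closedin _ unit(1)])
  assume b: "b \<in> carrier A"
  show "nconv A (\<lambda>u. \<alpha> n (u \<otimes> b)) (\<alpha> n b) unit_filter" by (intro alpha_nconv unit(3) b)
  show "\<forall>\<^sub>F u in unit_filter. \<alpha> n (u \<otimes> b) \<in> V n"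
    using unit(2) by eventually_elim (use b V_gen in \<open>simp add: alpha\<close>)
qed

text \<open>For the inner product of the extended representation, where u appears on both
  sides.\<close>

lemma unit_sandwich:
  assumes d: "d \<in> carrier A" shows "nconv A (\<lambda>u. u \<otimes> (d \<otimes> u)) d unit_filter"
proof (rule nconvI_le[OF d])
  have "((\<lambda>u. nrm A (d \<otimes> u \<ominus> d) + nrm A (u \<otimes> d \<ominus> d)) \<longlongrightarrow> 0 + 0) unit_filter"
    using unit(3,4)[OF d] by (intro tendsto_add) (auto simp: nconv_def)
  then show "((\<lambda>u. nrm A (d \<otimes> u \<ominus> d) + nrm A (u \<otimes> d \<ominus> d)) \<longlongrightarrow> 0) unit_filter" by simp
  show "\<forall>\<^sub>F u in unit_filter. u \<otimes> (d \<otimes> u) \<in> carrier A \<and>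
      nrm A (u \<otimes> (d \<otimes> u) \<ominus> d) \<le> nrm A (d \<otimes> u \<ominus> d) + nrm A (u \<otimes> d \<ominus> d)"
    using unit(2)
  proof eventually_elim
    case (elim u)
    then have u: "u \<in> carrier A" by simp
    have "nrm A (u \<otimes> (d \<otimes> u) \<ominus> u \<otimes> d) \<le> nrm A u * nrm A (d \<otimes> u \<ominus> d)"
      using nrm_mult[of u "d \<otimes> u \<ominus> d"] u d by (simp add: mult_minus m_closed)
    also have "\<dots> \<le> nrm A (d \<otimes> u \<ominus> d)" using elim d by (simp add: mult_left_le_one_le m_closed)
    finally show ?case using nrm_minus_triangle[of "u \<otimes> (d \<otimes> u)" "u \<otimes> d" d] u d by (simp add: m_closed)
  qed
qed

text \<open>For the coisometry of the extended representation, where \<open>P u\<close> times its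
  adjoint brings in u u^* instead of u.\<close>

lemma V_unit_square:
  assumes x: "x \<in> V n" shows "nconv A (\<lambda>u. x \<otimes> \<alpha> n (u \<otimes> star A u)) x unit_filter"
proof (rule nconvI_le)
  show xA: "x \<in> carrier A" using x by (rule V_carrier)
  have "((\<lambda>u. nrm A (x \<otimes> \<alpha> n u \<ominus> x) + nrm A (x \<otimes> \<alpha> n u \<ominus> x)) \<longlongrightarrow> 0 + 0) unit_filter"
    using V_unit[OF x] by (intro tendsto_add) (auto simp: nconv_def)
  then show "((\<lambda>u. nrm A (x \<otimes> \<alpha> n u \<ominus> x) + nrm A (x \<otimes> \<alpha> n u \<ominus> x)) \<longlongrightarrow> 0) unit_filter" by simp
  show "\<forall>\<^sub>F u in unit_filter. x \<otimes> \<alpha> n (u \<otimes> star A u) \<in> carrier A \<and>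
      nrm A (x \<otimes> \<alpha> n (u \<otimes> star A u) \<ominus> x) \<le> nrm A (x \<otimes> \<alpha> n u \<ominus> x) + nrm A (x \<otimes> \<alpha> n u \<ominus> x)"
    using unit(2)
  proof eventually_elim
    case (elim u)
    let ?a = "\<alpha> n u"
    have u: "?a \<in> carrier A" "nrm A ?a \<le> 1" using elim by auto
    have eq: "x \<otimes> \<alpha> n (u \<otimes> star A u) = x \<otimes> ?a \<otimes> ?a" using elim xA by (simp add: alpha m_assoc)
    have "nrm A (x \<otimes> ?a \<otimes> ?a \<ominus> x \<otimes> ?a) \<le> nrm A (x \<otimes> ?a \<ominus> x) * nrm A ?a"
      using nrm_mult[of "x \<otimes> ?a \<ominus> x" ?a] u xA by (simp add: minus_mult m_closed)
    also have "\<dots> \<le> nrm A (x \<otimes> ?a \<ominus> x)" using u xA by (simp add: mult_left_le m_closed)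
    finally show ?case using nrm_minus_triangle[of "x \<otimes> ?a \<otimes> ?a" "x \<otimes> ?a" x] u xA
      unfolding eq by (simp add: m_closed)
  qed
qed

lemma alpha_Suc: "a \<in> carrier A \<Longrightarrow> \<alpha> (Suc n) a = \<alpha> n (\<alpha> 1 a)"
  using alpha_plus[of a n 1] by (simp only: Suc_eq_plus1)

lemma e_inj_on: "inj_on (e n) (V n)"
  using e_inj by (rule inj_onI)

end

section \<open>The first fibre in a representation\<close>

locale dyn_rep = dyn_system A \<alpha> + B: cstar_algebra B
  for A :: "'a cstar" (structure) and \<alpha> and B :: "'b cstar" +
  fixes \<psi> :: "(nat \<Rightarrow> 'a) set \<Rightarrow> 'b" and \<pi> :: "'a \<Rightarrow> 'b"
  assumes rep: "toeplitz_rep A (dyn_fibre A \<alpha> L 1) B \<psi> \<pi>"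
    and coisom: "coisometric A (dyn_fibre A \<alpha> L 1) (range_ideal A \<alpha> 1) B \<psi> \<pi>"
begin

sublocale C: corner_rep A "dyn_fibre A \<alpha> L 1" "V 1" "\<alpha> 1" "e 1" B \<psi> \<pi>
  by (intro corner_rep.intro corner_rep_axioms.intro fibre_module B.cstar_algebra_axioms rep)

lemma p_coisom: "\<lbrakk>x \<in> V 1; y \<in> V 1\<rbrakk> \<Longrightarrow> \<pi> (x \<otimes> star A y) = C.p x \<otimes>\<^bsub>B\<^esub> star B (C.p y)"
  using coisom C.coisometric_iff unfolding range_ideal_eq by blast

text \<open>With \<open>\<alpha>\<^sub>1\<close> implemented by an isometry \<open>s\<close>, so that \<open>\<psi> x = \<pi> x s\<close>, the map \<open>psi n\<close> is
  \<open>x \<mapsto> \<pi> x s\<^sup>n\<close>; as \<open>s\<close> need not lie in \<open>B\<close> it is approximated by \<open>P u = s (\<pi> u)\<close>.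
  The limit defining \<open>psi n x\<close> exists for \<open>x \<in> V n\<close>.\<close>

definition P :: "'a \<Rightarrow> 'b" where "P u = C.p (\<alpha> 1 u)"

fun psi :: "nat \<Rightarrow> 'a \<Rightarrow> 'b" where
  "psi 0 x = \<pi> x"
| "psi (Suc n) x = (THE t. nconv B (\<lambda>u. psi n x \<otimes>\<^bsub>B\<^esub> P u) t unit_filter)"

lemma P_closed [simp]: "u \<in> carrier A \<Longrightarrow> P u \<in> carrier B"
  by (simp add: P_def alpha_V)

lemma P_nrm: "u \<in> carrier A \<Longrightarrow> nrm B (P u) \<le> nrm A u"
  using C.p_nrm[of "\<alpha> 1 u"] by (simp add: P_def alpha_V)

lemma P_nconv:
  assumes f: "nconv A f x F" shows "nconv B (\<lambda>i. P (f i)) (P x) F"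
  unfolding P_def
proof (rule C.p_nconv[OF alpha_nconv[OF f]])
  show "\<forall>\<^sub>F i in F. \<alpha> 1 (f i) \<in> V 1"
    using nconv_eventually[OF f] by eventually_elim (rule alpha_V)
  show "\<alpha> 1 x \<in> V 1" using nconv_closed[OF f] by (rule alpha_V)
qed

text \<open>Reflects \<pi>(\<alpha>_1(a)) s = s \<pi>(a).\<close>

lemma pi_P: "\<lbrakk>a \<in> carrier A; u \<in> carrier A\<rbrakk> \<Longrightarrow> \<pi> (\<alpha> 1 a) \<otimes>\<^bsub>B\<^esub> P u = P (a \<otimes> u)"
  by (simp add: P_def C.p_left alpha_V alpha flip: C.p_left)

lemma P_pi: "\<lbrakk>a \<in> carrier A; u \<in> carrier A\<rbrakk> \<Longrightarrow> P u \<otimes>\<^bsub>B\<^esub> \<pi> a = P (u \<otimes> a)"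
  by (simp add: P_def C.p_right alpha_V alpha flip: C.p_right)

text \<open>Coisometry in the form s \<pi>(a) s^* = \<pi>(\<alpha>_1(a)), here with a = u
  u^*.\<close>

lemma P_P_star: "u \<in> carrier A \<Longrightarrow> P u \<otimes>\<^bsub>B\<^esub> star B (P u) = \<pi> (\<alpha> 1 (u \<otimes> star A u))"
  using p_coisom[of "\<alpha> 1 u" "\<alpha> 1 u"] by (simp add: P_def alpha_V alpha star_closed)

text \<open>Formally the left side is \<pi>(u)^* s^* s \<pi>(d u) with s^* s = 1; inside B the value
  comes from the inner product of \<alpha>_1(u) and \<alpha>_1(d u).\<close>

lemma P_star_pi_P:
  assumes "u \<in> carrier A" "d \<in> carrier A"
  shows "star B (P u) \<otimes>\<^bsub>B\<^esub> (\<pi> (\<alpha> 1 d) \<otimes>\<^bsub>B\<^esub> P u) = \<pi> (star A u \<otimes> (d \<otimes> u))"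
proof -
  have V: "\<alpha> 1 u \<in> V 1" "\<alpha> 1 (d \<otimes> u) \<in> V 1" using assms by (auto intro!: alpha_V m_closed)
  let ?c = "star A u \<otimes> (d \<otimes> u)"
  have "\<alpha> 1 (L 1 (star A (\<alpha> 1 u) \<otimes> \<alpha> 1 (d \<otimes> u))) = \<alpha> 1 ?c"
    using transfer_inner(2)[OF V] assms by (simp add: alpha m_closed star_closed)
  then have "L 1 (star A (\<alpha> 1 u) \<otimes> \<alpha> 1 (d \<otimes> u)) = ?c"
    using inj_onD[OF inj] transfer_inner(1)[OF V] assms by (simp add: m_closed star_closed)
  then have "star B (C.p (\<alpha> 1 u)) \<otimes>\<^bsub>B\<^esub> C.p (\<alpha> 1 (d \<otimes> u)) = \<pi> ?c"
    using C.p_ip[OF V] fibre_ip[OF V] by simp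
  then show ?thesis using assms by (simp add: pi_P) (simp add: P_def)
qed

section \<open>Induction over the fibres\<close>

lemma unit_P: "\<forall>\<^sub>F u in unit_filter. P u \<in> carrier B \<and> nrm B (P u) \<le> 1"
  using unit(2) by eventually_elim (use P_nrm in \<open>auto intro: order_trans\<close>)

text \<open>The properties of fibre n go through the induction together, as they feed one another:
  the right action and the last clause give the next coisometry, whose diagonal case gives the norm
  bound for the next limit. The last clause is coisometry as in
  \<open>coisometric_iff\<close>.\<close>

definition is_rep :: "nat \<Rightarrow> bool" where
  "is_rep n \<longleftrightarrow>
    (\<forall>x\<in>V n. psi n x \<in> carrier B \<and> (\<forall>c. psi n (c \<odot> x) = c \<odot>\<^bsub>B\<^esub> psi n x) \<and>
      (\<forall>a\<in>carrier A. psi n (a \<otimes> x) = \<pi> a \<otimes>\<^bsub>B\<^esub> psi n x \<and> psi n (x \<otimes> \<alpha> n a) = psi n x \<otimes>\<^bsub>B\<^esub> \<pi> a) \<and>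
      (\<forall>y\<in>V n. psi n (x \<oplus> y) = psi n x \<oplus>\<^bsub>B\<^esub> psi n y \<and>
        star B (psi n x) \<otimes>\<^bsub>B\<^esub> psi n y = \<pi> (L n (star A x \<otimes> y)) \<and>
        psi n x \<otimes>\<^bsub>B\<^esub> star B (psi n y) = \<pi> (x \<otimes> star A y)))"

lemma is_repD:
  assumes "is_rep n" "x \<in> V n"
  shows "psi n x \<in> carrier B" "psi n (c \<odot> x) = c \<odot>\<^bsub>B\<^esub> psi n x"
    "a \<in> carrier A \<Longrightarrow> psi n (a \<otimes> x) = \<pi> a \<otimes>\<^bsub>B\<^esub> psi n x"
    "a \<in> carrier A \<Longrightarrow> psi n (x \<otimes> \<alpha> n a) = psi n x \<otimes>\<^bsub>B\<^esub> \<pi> a"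
    "y \<in> V n \<Longrightarrow> psi n (x \<oplus> y) = psi n x \<oplus>\<^bsub>B\<^esub> psi n y"
    "y \<in> V n \<Longrightarrow> star B (psi n x) \<otimes>\<^bsub>B\<^esub> psi n y = \<pi> (L n (star A x \<otimes> y))"
    "y \<in> V n \<Longrightarrow> psi n x \<otimes>\<^bsub>B\<^esub> star B (psi n y) = \<pi> (x \<otimes> star A y)"
  using assms by (auto simp: is_rep_def)

lemma is_rep_nrm:
  assumes "is_rep n" "x \<in> V n" shows "nrm B (psi n x) \<le> nrm A x"
proof -
  have xA: "x \<in> carrier A" using assms(2) by (rule V_carrier)
  have "(nrm B (psi n x))\<^sup>2 = nrm B (\<pi> (x \<otimes> star A x))"
    using is_repD(7)[OF assms assms(2)] B.cstar_identity'[OF is_repD(1)[OF assms]] by simp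
  also have "\<dots> \<le> nrm A (x \<otimes> star A x)"
    by (rule C.pi_nrm) (simp add: xA m_closed star_closed)
  also have "\<dots> = (nrm A x)\<^sup>2" using xA by (rule cstar_identity')
  finally show ?thesis using xA by (simp add: power2_le_iff_abs_le)
qed

lemma is_rep_minus:
  assumes "is_rep n" "x \<in> V n" "y \<in> V n" shows "psi n (x \<ominus> y) = psi n x \<ominus>\<^bsub>B\<^esub> psi n y"
proof -
  have "x \<ominus> y = x \<oplus> (-1) \<odot> y" using assms(2,3)[THEN V_carrier] by (rule minus_scale)
  moreover have "(-1) \<odot> y \<in> V n" using smodD(4)[OF V_submodule assms(3)] .
  ultimately show ?thesis using is_repD[OF assms(1,2)] is_repD[OF assms(1,3)] by (simp add: B.minus_scale)
qed

text \<open>The limit is evident at x \<alpha>_(n+1)(c): there the right action turns \<psi>_n(x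
  \<alpha>_(n+1)(c)) P u into \<psi>_n(x) P (c u), which tends to \<psi>_n(x) P c. Such elements
  approach x, and right multiplication by P u is eventually contractive.\<close>

lemma psi_Suc_limit:
  assumes g: "is_rep n" and x: "x \<in> V (Suc n)"
  shows "nconv B (\<lambda>u. psi n x \<otimes>\<^bsub>B\<^esub> P u) (psi (Suc n) x) unit_filter"
proof -
  note G = is_repD[OF g]
  have xA: "x \<in> carrier A" using x by (rule V_carrier)
  have "\<exists>t. nconv B (\<lambda>u. psi n x \<otimes>\<^bsub>B\<^esub> P u) t unit_filter"
  proof -
    have gen: "\<exists>t. nconv B (\<lambda>u. psi n (x \<otimes> \<alpha> (Suc n) c) \<otimes>\<^bsub>B\<^esub> P u) t unit_filter" if c: "c \<in> carrier A" for c
    proof -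
      have "nconv B (\<lambda>u. psi n x \<otimes>\<^bsub>B\<^esub> P (c \<otimes> u)) (psi n x \<otimes>\<^bsub>B\<^esub> P c) unit_filter"
        using G(1)[OF V_Suc[OF x]] unit(4)[OF c] by (intro B.nconv_mult_left P_nconv)
      moreover have "\<forall>\<^sub>F u in unit_filter. psi n (x \<otimes> \<alpha> (Suc n) c) \<otimes>\<^bsub>B\<^esub> P u = psi n x \<otimes>\<^bsub>B\<^esub> P (c \<otimes> u)"
        using unit(2) by eventually_elim
          (use c x G(1,4)[OF V_Suc[OF x]] C.pi(1) in \<open>simp add: alpha_Suc[of c n] B.m_assoc flip: pi_P\<close>)
      ultimately show ?thesis by (auto simp: B.nconv_cong)
    qed
    have near: "\<exists>s\<in>{x \<otimes> \<alpha> (Suc n) c | c. c \<in> carrier A}. nrm A (s \<ominus> x) < d" if "d > 0" for d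
    proof (rule nconv_approx[OF V_unit[OF x] unit(1) _ that])
      show "\<forall>\<^sub>F u in unit_filter. x \<otimes> \<alpha> (Suc n) u \<in> {x \<otimes> \<alpha> (Suc n) c | c. c \<in> carrier A}"
        using unit(2) by eventually_elim blast
    qed
    have "{x \<otimes> \<alpha> (Suc n) c | c. c \<in> carrier A} \<subseteq> carrier A" using xA by (auto simp: m_closed)
    from approx_sequence[OF this xA near]
    obtain s where s: "\<And>j::nat. s j \<in> {x \<otimes> \<alpha> (Suc n) c | c. c \<in> carrier A}" "nconv A s x sequentially"
      by blast
    have "\<exists>t. nconv B (\<lambda>u. psi n (s j) \<otimes>\<^bsub>B\<^esub> P u) t unit_filter" for j
      using s(1)[of j] gen by auto
    then obtain ts where ts: "\<And>j. nconv B (\<lambda>u. psi n (s j) \<otimes>\<^bsub>B\<^esub> P u) (ts j) unit_filter" by metis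
    show ?thesis
    proof (rule contractive_limit_exists[where f = "\<lambda>u x. psi n x \<otimes>\<^bsub>B\<^esub> P u" and t = ts,
        OF normed_module_axioms B.cstar_algebra_axioms V_submodule[of n] unit(1) _ _ s(2) _ ts])
      show "s j \<in> V n" for j
      proof -
        obtain c where "c \<in> carrier A" "s j = x \<otimes> \<alpha> (Suc n) c" using s(1)[of j] by blast
        then show ?thesis using V_Suc[OF V_gen[OF xA, of c "Suc n"]] by simp
      qed
      show "x \<in> V n" using x by (rule V_Suc)
      show "\<forall>\<^sub>F u in unit_filter. (\<forall>x\<in>V n. psi n x \<otimes>\<^bsub>B\<^esub> P u \<in> carrier B \<and> nrm B (psi n x \<otimes>\<^bsub>B\<^esub> P u) \<le> nrm A x) \<and>
          (\<forall>x\<in>V n. \<forall>y\<in>V n. psi n (x \<ominus> y) \<otimes>\<^bsub>B\<^esub> P u = psi n x \<otimes>\<^bsub>B\<^esub> P u \<ominus>\<^bsub>B\<^esub> psi n y \<otimes>\<^bsub>B\<^esub> P u)"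
        using unit_P
      proof eventually_elim
        case (elim u)
        have "nrm B (psi n x \<otimes>\<^bsub>B\<^esub> P u) \<le> nrm A x" if x: "x \<in> V n" for x
        proof -
          have "nrm B (psi n x \<otimes>\<^bsub>B\<^esub> P u) \<le> nrm B (psi n x) * nrm B (P u)"
            using G(1)[OF x] elim by (intro B.nrm_mult) auto
          also have "\<dots> \<le> nrm B (psi n x)" using elim G(1)[OF x] by (simp add: mult_left_le)
          finally show ?thesis using is_rep_nrm[OF g x] by simp
        qed
        then show ?case using elim by (auto simp: G(1) B.m_closed is_rep_minus[OF g] B.minus_mult)
      qed
    qed blast
  qed
  then obtain t where t: "nconv B (\<lambda>u. psi n x \<otimes>\<^bsub>B\<^esub> P u) t unit_filter" ..
  then have "(THE t. nconv B (\<lambda>u. psi n x \<otimes>\<^bsub>B\<^esub> P u) t unit_filter) = t"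
    by (rule the_equality) (rule B.nconv_unique[OF _ t unit(1)])
  then show ?thesis using t by simp
qed

text \<open>Reduces an identity at level n + 1 to one at level n for fixed u.\<close>

lemma psi_Suc_unique:
  assumes g: "is_rep n" and x: "x \<in> V (Suc n)" and t: "nconv B f t unit_filter"
    and eq: "\<forall>\<^sub>F u in unit_filter. f u = psi n x \<otimes>\<^bsub>B\<^esub> P u"
  shows "psi (Suc n) x = t"
  using B.nconv_unique[OF psi_Suc_limit[OF g x] _ unit(1)] t eq by (simp add: B.nconv_cong)

lemma is_rep_0: "is_rep 0"
proof -
  have "L 0 (star A x \<otimes> y) = star A x \<otimes> y" if "x \<in> carrier A" "y \<in> carrier A" for x y
    using transfer_inner[of x 0 y] that by (simp add: V_0)
  then show ?thesis
    by (auto simp: is_rep_def V_0 C.pi m_closed star_closed simp flip: C.pi(5))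
qed

lemma is_rep_Suc:
  assumes g: "is_rep n" shows "is_rep (Suc n)"
proof -
  note G = is_repD[OF g]
  note lim = psi_Suc_limit[OF g]
  note VS = smodD[OF V_submodule[of "Suc n"]]
  show ?thesis unfolding is_rep_def
  proof (intro ballI conjI allI)
    fix x assume x: "x \<in> V (Suc n)"
    have xn: "x \<in> V n" and xA: "x \<in> carrier A" using x V_Suc V_carrier by auto
    show cl: "psi (Suc n) x \<in> carrier B" using lim[OF x] by (rule B.nconv_closed)
    show "psi (Suc n) (c \<odot> x) = c \<odot>\<^bsub>B\<^esub> psi (Suc n) x" for c
    proof (rule psi_Suc_unique[OF g VS(4)[OF x] B.nconv_scale[OF lim[OF x]]])
      show "\<forall>\<^sub>F u in unit_filter. c \<odot>\<^bsub>B\<^esub> (psi n x \<otimes>\<^bsub>B\<^esub> P u) = psi n (c \<odot> x) \<otimes>\<^bsub>B\<^esub> P u"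
        using unit_P by eventually_elim (simp add: G(1,2)[OF xn] B.smult_mult_l)
    qed
    fix a assume a: "a \<in> carrier A"
    show "psi (Suc n) (a \<otimes> x) = \<pi> a \<otimes>\<^bsub>B\<^esub> psi (Suc n) x"
    proof (rule psi_Suc_unique[OF g V_left[OF a x] B.nconv_mult_left[OF lim[OF x] C.pi(1)[OF a]]])
      show "\<forall>\<^sub>F u in unit_filter. \<pi> a \<otimes>\<^bsub>B\<^esub> (psi n x \<otimes>\<^bsub>B\<^esub> P u) = psi n (a \<otimes> x) \<otimes>\<^bsub>B\<^esub> P u"
        using unit_P by eventually_elim (simp add: G(1,3)[OF xn] a B.m_assoc C.pi)
    qed
    \<comment> \<open>Both sides of the right action formula are shown to equal \<psi>_n(x) P a: one
      through P (a u), the other through P (u a).\<close>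
    have "psi (Suc n) (x \<otimes> \<alpha> (Suc n) a) = psi n x \<otimes>\<^bsub>B\<^esub> P a"
    proof (rule psi_Suc_unique[OF g V_gen[OF xA a]])
      show "nconv B (\<lambda>u. psi n x \<otimes>\<^bsub>B\<^esub> P (a \<otimes> u)) (psi n x \<otimes>\<^bsub>B\<^esub> P a) unit_filter"
        by (intro B.nconv_mult_left P_nconv unit(4) a G(1) xn)
      show "\<forall>\<^sub>F u in unit_filter. psi n x \<otimes>\<^bsub>B\<^esub> P (a \<otimes> u) = psi n (x \<otimes> \<alpha> (Suc n) a) \<otimes>\<^bsub>B\<^esub> P u"
        using unit(2) by eventually_elim
          (use a G(1,4)[OF xn] C.pi(1) in \<open>simp add: alpha_Suc[of a n] B.m_assoc flip: pi_P\<close>)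
    qed
    moreover have "psi (Suc n) x \<otimes>\<^bsub>B\<^esub> \<pi> a = psi n x \<otimes>\<^bsub>B\<^esub> P a"
    proof (rule B.nconv_unique[OF _ _ unit(1)])
      show "nconv B (\<lambda>u. psi n x \<otimes>\<^bsub>B\<^esub> P (u \<otimes> a)) (psi n x \<otimes>\<^bsub>B\<^esub> P a) unit_filter"
        by (intro B.nconv_mult_left P_nconv unit(3) a G(1) xn)
      have "\<forall>\<^sub>F u in unit_filter. psi n x \<otimes>\<^bsub>B\<^esub> P u \<otimes>\<^bsub>B\<^esub> \<pi> a = psi n x \<otimes>\<^bsub>B\<^esub> P (u \<otimes> a)"
        using unit(2) by eventually_elim (use a G(1)[OF xn] C.pi(1) in \<open>simp add: B.m_assoc P_pi\<close>)
      then show "nconv B (\<lambda>u. psi n x \<otimes>\<^bsub>B\<^esub> P (u \<otimes> a)) (psi (Suc n) x \<otimes>\<^bsub>B\<^esub> \<pi> a) unit_filter"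
        using B.nconv_mult_right[OF lim[OF x] C.pi(1)[OF a]] by (simp add: B.nconv_cong)
    qed
    ultimately show "psi (Suc n) (x \<otimes> \<alpha> (Suc n) a) = psi (Suc n) x \<otimes>\<^bsub>B\<^esub> \<pi> a" by simp
  next
    fix x y assume x: "x \<in> V (Suc n)" and y: "y \<in> V (Suc n)"
    have xn: "x \<in> V n" "y \<in> V n" and xA: "x \<in> carrier A" "y \<in> carrier A" using x y V_Suc V_carrier by auto
    show "psi (Suc n) (x \<oplus> y) = psi (Suc n) x \<oplus>\<^bsub>B\<^esub> psi (Suc n) y"
    proof (rule psi_Suc_unique[OF g VS(3)[OF x y] B.nconv_add[OF lim[OF x] lim[OF y]]])
      show "\<forall>\<^sub>F u in unit_filter. psi n x \<otimes>\<^bsub>B\<^esub> P u \<oplus>\<^bsub>B\<^esub> psi n y \<otimes>\<^bsub>B\<^esub> P u = psi n (x \<oplus> y) \<otimes>\<^bsub>B\<^esub> P u"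
        using unit_P by eventually_elim (simp add: G(1)[OF xn(1)] G(1)[OF xn(2)] G(5)[OF xn] B.l_distr)
    qed
    show "star B (psi (Suc n) x) \<otimes>\<^bsub>B\<^esub> psi (Suc n) y = \<pi> (L (Suc n) (star A x \<otimes> y))"
    proof (rule B.nconv_unique[OF B.nconv_mult[OF B.nconv_star[OF lim[OF x]] lim[OF y]] _ unit(1)])
      \<comment> \<open>\<open>\<alpha> n\<close> takes both \<alpha>_1(d) and \<open>L n\<close> of
        x^* y to x^* y, so these two agree; the outer factors P u then turn the product into \<pi>(u
        d u), and u d u tends to d.\<close>
      define d where "d = L (Suc n) (star A x \<otimes> y)"
      have d: "d \<in> carrier A" "\<alpha> (Suc n) d = star A x \<otimes> y" using transfer_inner[OF x y] by (auto simp: d_def)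
      have "\<alpha> n (L n (star A x \<otimes> y)) = \<alpha> n (\<alpha> 1 d)" using transfer_inner(2)[OF xn] d alpha_Suc[of d n] by simp
      then have Ln: "L n (star A x \<otimes> y) = \<alpha> 1 d"
        using inj_onD[OF inj] transfer_inner(1)[OF xn] d by simp
      have "nconv B (\<lambda>u. \<pi> (u \<otimes> (d \<otimes> u))) (\<pi> d) unit_filter"
        by (intro C.pi_nconv unit_sandwich d)
      moreover have "\<forall>\<^sub>F u in unit_filter. star B (psi n x \<otimes>\<^bsub>B\<^esub> P u) \<otimes>\<^bsub>B\<^esub> (psi n y \<otimes>\<^bsub>B\<^esub> P u) = \<pi> (u \<otimes> (d \<otimes> u))"
        using unit(2)
      proof eventually_elim
        case (elim u)
        have "star B (psi n x \<otimes>\<^bsub>B\<^esub> P u) \<otimes>\<^bsub>B\<^esub> (psi n y \<otimes>\<^bsub>B\<^esub> P u) =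
            star B (P u) \<otimes>\<^bsub>B\<^esub> ((star B (psi n x) \<otimes>\<^bsub>B\<^esub> psi n y) \<otimes>\<^bsub>B\<^esub> P u)"
          using elim G(1) xn by (simp add: B.star_mult B.m_assoc B.star_closed B.m_closed)
        also have "\<dots> = \<pi> (star A u \<otimes> (d \<otimes> u))"
          using elim d by (simp add: G(6)[OF xn] Ln P_star_pi_P)
        finally show ?case using elim by simp
      qed
      ultimately show "nconv B (\<lambda>u. star B (psi n x \<otimes>\<^bsub>B\<^esub> P u) \<otimes>\<^bsub>B\<^esub> (psi n y \<otimes>\<^bsub>B\<^esub> P u))
          (\<pi> (L (Suc n) (star A x \<otimes> y))) unit_filter"
        by (simp add: B.nconv_cong d_def)
    qed
    show "psi (Suc n) x \<otimes>\<^bsub>B\<^esub> star B (psi (Suc n) y) = \<pi> (x \<otimes> star A y)"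
    proof (rule B.nconv_unique[OF B.nconv_mult[OF lim[OF x] B.nconv_star[OF lim[OF y]]] _ unit(1)])
      have "nconv B (\<lambda>u. \<pi> (x \<otimes> \<alpha> (Suc n) (u \<otimes> star A u) \<otimes> star A y)) (\<pi> (x \<otimes> star A y)) unit_filter"
        by (intro C.pi_nconv nconv_mult_right V_unit_square x star_closed xA)
      moreover have "\<forall>\<^sub>F u in unit_filter. (psi n x \<otimes>\<^bsub>B\<^esub> P u) \<otimes>\<^bsub>B\<^esub> star B (psi n y \<otimes>\<^bsub>B\<^esub> P u) =
          \<pi> (x \<otimes> \<alpha> (Suc n) (u \<otimes> star A u) \<otimes> star A y)"
        using unit(2)
      proof eventually_elim
        case (elim u)
        \<comment> \<open>By coisometry on the first fibre, \<pi> of w is \<open>P u\<close> times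
          its adjoint; the right action moves it into x as the factor \<open>\<alpha> n ?w\<close>,
          which disappears in the limit.\<close>
        let ?w = "\<alpha> 1 (u \<otimes> star A u)"
        have w: "?w \<in> carrier A" using elim by (simp add: m_closed star_closed)
        have "(psi n x \<otimes>\<^bsub>B\<^esub> P u) \<otimes>\<^bsub>B\<^esub> star B (psi n y \<otimes>\<^bsub>B\<^esub> P u) =
            (psi n x \<otimes>\<^bsub>B\<^esub> (P u \<otimes>\<^bsub>B\<^esub> star B (P u))) \<otimes>\<^bsub>B\<^esub> star B (psi n y)"
          using elim G(1) xn by (simp add: B.star_mult B.m_assoc B.star_closed B.m_closed)
        also have "\<dots> = psi n (x \<otimes> \<alpha> n ?w) \<otimes>\<^bsub>B\<^esub> star B (psi n y)"
          using elim w xn by (simp add: P_P_star G(4))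
        also have "\<dots> = \<pi> (x \<otimes> \<alpha> n ?w \<otimes> star A y)"
          using w xA by (intro G(7) V_gen xn)
        finally show ?case using elim alpha_Suc[of "u \<otimes> star A u" n] by (simp add: m_closed star_closed)
      qed
      ultimately show "nconv B (\<lambda>u. (psi n x \<otimes>\<^bsub>B\<^esub> P u) \<otimes>\<^bsub>B\<^esub> star B (psi n y \<otimes>\<^bsub>B\<^esub> P u))
          (\<pi> (x \<otimes> star A y)) unit_filter"
        by (simp add: B.nconv_cong)
    qed
  qed
qed

lemma is_rep: "is_rep n"
  by (induction n) (simp_all only: is_rep_0 is_rep_Suc)

lemmas psi_D = is_repD[OF is_rep]

text \<open>By the left action \<pi>(x) P u = \<psi>(x \<alpha>_1(u)), and x \<alpha>_1(u) tends to
  x. So the new maps do extend the given representation.\<close>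

lemma psi_1: "x \<in> V 1 \<Longrightarrow> psi 1 x = C.p x"
proof -
  assume x: "x \<in> V 1"
  have "psi (Suc 0) x = C.p x"
  proof (rule psi_Suc_unique[OF is_rep])
    show "nconv B (\<lambda>u. C.p (x \<otimes> \<alpha> 1 u)) (C.p x) unit_filter"
    proof (rule C.p_nconv[OF V_unit[OF x] _ x])
      show "\<forall>\<^sub>F u in unit_filter. x \<otimes> \<alpha> 1 u \<in> V 1"
        using unit(2) by eventually_elim (use V_gen V_carrier[OF x] in simp)
    qed
    show "\<forall>\<^sub>F u in unit_filter. C.p (x \<otimes> \<alpha> 1 u) = psi 0 x \<otimes>\<^bsub>B\<^esub> P u"
      using unit(2) by eventually_elim (use V_carrier[OF x] alpha_V in \<open>simp add: C.p_left P_def\<close>)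
  qed (use x in \<open>simp only: One_nat_def\<close>)
  then show ?thesis by (simp only: One_nat_def)
qed

text \<open>Induction on n with m fixed: the case n = 0 is the right action, and in the step the
  factor P u is split off from \<psi>_(n+1)(y) and joined to \<psi>_(m+n).\<close>

lemma psi_mult:
  assumes x: "x \<in> V m" shows "y \<in> V n \<Longrightarrow> psi m x \<otimes>\<^bsub>B\<^esub> psi n y = psi (m + n) (x \<otimes> \<alpha> m y)"
proof (induction n arbitrary: y)
  case 0
  then show ?case using psi_D(4)[OF x] by (simp add: V_0)
next
  case (Suc n)
  have yA: "y \<in> carrier A" and yn: "y \<in> V n" using Suc.prems V_carrier V_Suc by auto
  have "psi (Suc (m + n)) (x \<otimes> \<alpha> m y) = psi m x \<otimes>\<^bsub>B\<^esub> psi (Suc n) y"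
  proof (rule psi_Suc_unique[OF is_rep])
    show "x \<otimes> \<alpha> m y \<in> V (Suc (m + n))" using V_mult[OF V_carrier[OF x] Suc.prems, of m] by simp
    show "nconv B (\<lambda>u. psi m x \<otimes>\<^bsub>B\<^esub> (psi n y \<otimes>\<^bsub>B\<^esub> P u)) (psi m x \<otimes>\<^bsub>B\<^esub> psi (Suc n) y) unit_filter"
      by (intro B.nconv_mult_left psi_Suc_limit is_rep Suc.prems psi_D(1) x)
    show "\<forall>\<^sub>F u in unit_filter. psi m x \<otimes>\<^bsub>B\<^esub> (psi n y \<otimes>\<^bsub>B\<^esub> P u) = psi (m + n) (x \<otimes> \<alpha> m y) \<otimes>\<^bsub>B\<^esub> P u"
      using unit_P by eventually_elim (simp add: psi_D(1)[OF x] psi_D(1)[OF yn] Suc.IH[OF yn, symmetric] B.m_assoc)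
  qed
  then show ?case by simp
qed

section \<open>The representation of the product system\<close>

abbreviation X :: "('a, (nat \<Rightarrow> 'a) set) product_system" where "X \<equiv> dyn_product_system A \<alpha> L"

definition ext_rep :: "nat \<times> (nat \<Rightarrow> 'a) set \<Rightarrow> 'b" where
  "ext_rep = (\<lambda>(n, \<xi>). psi n (the_inv_into (V n) (e n) \<xi>))"

lemma ext_rep_e [simp]: "x \<in> V n \<Longrightarrow> ext_rep (n, e n x) = psi n x"
  by (simp add: ext_rep_def the_inv_into_f_f[OF e_inj_on])

lemma fibre_X [simp]: "fibre X = dyn_fibre A \<alpha> L"
  by (simp add: dyn_product_system_def)

lemma coeff_ext_rep: "a \<in> carrier A \<Longrightarrow> coeff_rep X ext_rep a = \<pi> a"
  using ext_rep_e[of a 0] by (simp add: coeff_rep_def dyn_product_system_def V_0)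

lemma ext_rep_toeplitz: "toeplitz_rep A (dyn_fibre A \<alpha> L n) B (fibre_rep ext_rep n) (coeff_rep X ext_rep)"
proof -
  interpret M: corner_module A "dyn_fibre A \<alpha> L n" "V n" "\<alpha> n" "e n" by (rule fibre_module)
  have pi: "coeff_rep X ext_rep \<in> cstar_hom A B"
    by (auto simp: cstar_hom_def coeff_ext_rep C.pi m_closed star_closed)
  have f: "fibre_rep ext_rep n (e n x) = psi n x" if "x \<in> V n" for x using that by (simp add: fibre_rep_def)
  show ?thesis unfolding toeplitz_rep_def M.ballY
  proof (intro conjI ballI allI pi)
    show "fibre_rep ext_rep n \<in> carrier (dyn_fibre A \<alpha> L n) \<rightarrow> carrier B"
      by (auto simp: fibre_carrier f psi_D)
    fix x assume x: "x \<in> V n"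
    show "fibre_rep ext_rep n (c \<odot>\<^bsub>dyn_fibre A \<alpha> L n\<^esub> e n x) = c \<odot>\<^bsub>B\<^esub> fibre_rep ext_rep n (e n x)" for c
      using x by (simp add: M.Y_scale f psi_D)
    fix y assume y: "y \<in> V n"
    show "fibre_rep ext_rep n (e n x \<oplus>\<^bsub>dyn_fibre A \<alpha> L n\<^esub> e n y) = fibre_rep ext_rep n (e n x) \<oplus>\<^bsub>B\<^esub> fibre_rep ext_rep n (e n y)"
      using x y by (simp add: M.Y_add f psi_D)
    show "star B (fibre_rep ext_rep n (e n x)) \<otimes>\<^bsub>B\<^esub> fibre_rep ext_rep n (e n y) =
        coeff_rep X ext_rep (ip (dyn_fibre A \<alpha> L n) (e n x) (e n y))"
      using x y transfer_inner(1)[OF x y] by (simp add: f psi_D fibre_ip coeff_ext_rep)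
  next
    fix x a assume x: "x \<in> V n" and a: "a \<in> carrier A"
    show "fibre_rep ext_rep n (ract (dyn_fibre A \<alpha> L n) (e n x) a) = fibre_rep ext_rep n (e n x) \<otimes>\<^bsub>B\<^esub> coeff_rep X ext_rep a"
      using x a by (simp add: M.Y_ract M.V_right f psi_D coeff_ext_rep)
    show "fibre_rep ext_rep n (lact (dyn_fibre A \<alpha> L n) a (e n x)) = coeff_rep X ext_rep a \<otimes>\<^bsub>B\<^esub> fibre_rep ext_rep n (e n x)"
      using x a by (simp add: M.Y_lact M.V_left f psi_D coeff_ext_rep)
  qed
qed

lemma ext_rep_coisometric:
  "coisometric A (dyn_fibre A \<alpha> L n) (range_ideal A \<alpha> n) B (fibre_rep ext_rep n) (coeff_rep X ext_rep)"
proof -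
  interpret R: corner_rep A "dyn_fibre A \<alpha> L n" "V n" "\<alpha> n" "e n" B "fibre_rep ext_rep n" "coeff_rep X ext_rep"
    by (intro corner_rep.intro corner_rep_axioms.intro fibre_module B.cstar_algebra_axioms ext_rep_toeplitz)
  have "coeff_rep X ext_rep (x \<otimes> star A y) = R.p x \<otimes>\<^bsub>B\<^esub> star B (R.p y)" if "x \<in> V n" "y \<in> V n" for x y
    using that V_carrier by (simp add: coeff_ext_rep m_closed star_closed fibre_rep_def psi_D)
  then show ?thesis using R.coisometric_iff unfolding range_ideal_eq by blast
qed

lemma ps_carrier_eq: "ps_carrier X = {(n, e n x) | n x. x \<in> V n}"
  by (auto simp: ps_carrier_def fibre_carrier)

lemma ext_rep_ps: "ps_toeplitz_rep A X B ext_rep" "ps_coisometric A X (range_ideal A \<alpha>) B ext_rep"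
proof -
  have "ext_rep u \<otimes>\<^bsub>B\<^esub> ext_rep v = ext_rep (ps_mult X u v)" if uv: "u \<in> ps_carrier X" "v \<in> ps_carrier X" for u v
  proof -
    obtain m x n y where "x \<in> V m" "y \<in> V n" "u = (m, e m x)" "v = (n, e n y)"
      using uv by (auto simp: ps_carrier_eq)
    then show ?thesis using V_mult V_carrier by (simp add: ps_mult_e psi_mult)
  qed
  then show "ps_toeplitz_rep A X B ext_rep" by (simp add: ps_toeplitz_rep_def ext_rep_toeplitz)
  show "ps_coisometric A X (range_ideal A \<alpha>) B ext_rep" by (simp add: ps_coisometric_def ext_rep_coisometric)
qed

text \<open>A representation of the product system is determined by fibres 0 and 1: in the step,
  \<rho> sends \<psi>_n(x) P u to i(n, x) i(1, \<alpha>_1(u)) = i(n+1, x \<alpha>_(n+1)(u)), and x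
  \<alpha>_(n+1)(u) tends to x.\<close>

lemma psi_intertwine:
  assumes D: "cstar_algebra D" and i: "ps_toeplitz_rep A X D i" and r: "\<rho> \<in> cstar_hom B D"
    and rX: "\<And>u. u \<in> carrier (dyn_fibre A \<alpha> L 1) \<Longrightarrow> \<rho> (\<psi> u) = i (1, u)"
    and rA: "\<And>a. a \<in> carrier A \<Longrightarrow> \<rho> (\<pi> a) = coeff_rep X i a"
  shows "x \<in> V n \<Longrightarrow> \<rho> (psi n x) = i (n, e n x)"
proof (induction n arbitrary: x)
  case 0
  then show ?case by (simp add: rA V_0) (simp add: coeff_rep_def dyn_product_system_def)
next
  case (Suc n)
  interpret D: cstar_algebra D by fact
  interpret R: corner_rep A "dyn_fibre A \<alpha> L (Suc n)" "V (Suc n)" "\<alpha> (Suc n)" "e (Suc n)" D "fibre_rep i (Suc n)" "coeff_rep X i"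
    using i by (intro corner_rep.intro corner_rep_axioms.intro fibre_module D) (simp add: ps_toeplitz_rep_def)
  note x = Suc.prems
  have xn: "x \<in> V n" and xA: "x \<in> carrier A" using x V_Suc V_carrier by auto
  have "nconv D (\<lambda>u. \<rho> (psi n x \<otimes>\<^bsub>B\<^esub> P u)) (\<rho> (psi (Suc n) x)) unit_filter"
    by (intro hom_nconv[OF B.cstar_algebra_axioms D r] psi_Suc_limit is_rep x)
  moreover have ev: "\<forall>\<^sub>F u in unit_filter. \<rho> (psi n x \<otimes>\<^bsub>B\<^esub> P u) = R.p (x \<otimes> \<alpha> (Suc n) u)"
    using unit(2)
  proof eventually_elim
    case (elim u)
    then have u: "\<alpha> 1 u \<in> V 1" by (simp add: alpha_V)
    have "\<rho> (psi n x \<otimes>\<^bsub>B\<^esub> P u) = i (n, e n x) \<otimes>\<^bsub>D\<^esub> i (1, e 1 (\<alpha> 1 u))"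
      using homD(3)[OF r psi_D(1)[OF xn] P_closed] elim Suc.IH[OF xn] rX[of "e 1 (\<alpha> 1 u)"] u
      by (simp add: P_def)
    also have "\<dots> = i (ps_mult X (n, e n x) (1, e 1 (\<alpha> 1 u)))"
    proof -
      have "(n, e n x) \<in> ps_carrier X" "(1, e 1 (\<alpha> 1 u)) \<in> ps_carrier X"
        using xn u by (auto simp: ps_carrier_eq)
      then show ?thesis using i unfolding ps_toeplitz_rep_def by blast
    qed
    also have "\<dots> = R.p (x \<otimes> \<alpha> (Suc n) u)"
      using elim alpha_Suc[of u n] by (simp only: ps_mult_e[OF xn u] Suc_eq_plus1[symmetric]) (simp add: fibre_rep_def)
    finally show ?case .
  qed
  moreover have "nconv D (\<lambda>u. R.p (x \<otimes> \<alpha> (Suc n) u)) (R.p x) unit_filter"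
  proof (rule R.p_nconv[OF V_unit[OF x] _ x])
    show "\<forall>\<^sub>F u in unit_filter. x \<otimes> \<alpha> (Suc n) u \<in> V (Suc n)"
      using unit(2) by eventually_elim (use V_gen xA in simp)
  qed
  ultimately have "\<rho> (psi (Suc n) x) = R.p x"
    using D.nconv_unique[OF _ _ unit(1)] D.nconv_cong[OF ev] by blast
  then show ?case by (simp add: fibre_rep_def)
qed

end

section \<open>The isomorphism\<close>

lemma hom_compose:
  assumes "f \<in> cstar_hom A B" "g \<in> cstar_hom B C"
  shows "(\<lambda>x. g (f x)) \<in> cstar_hom A C"
  using homD[OF assms(1)] homD[OF assms(2)] by (auto simp: cstar_hom_def)

lemma hom_eq_id:
  assumes A: "cstar_algebra A" and f: "f \<in> cstar_hom A A" and gen: "cstar_generated A G = carrier A"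
    and G: "G \<subseteq> carrier A" "\<And>x. x \<in> G \<Longrightarrow> f x = x" and x: "x \<in> carrier A"
  shows "f x = x"
proof -
  have "(\<lambda>x. x) \<in> cstar_hom A A" by (auto simp: cstar_hom_def)
  from equalizer_subalgebra[OF A A f this] have "cstar_subalgebra {x \<in> carrier A. f x = x} A" .
  from generated_induct[OF _ this, of x G] show ?thesis using x gen G by auto
qed

theorem proposition3p6:
  fixes A :: "'a cstar"
    and \<alpha> L :: "nat \<Rightarrow> 'a \<Rightarrow> 'a"
    and X :: "('a, (nat \<Rightarrow> 'a) set) product_system"
    and K :: "nat \<Rightarrow> 'a set"
    and D E :: "'b cstar"
    and i :: "nat \<times> (nat \<Rightarrow> 'a) set \<Rightarrow> 'b"
    and k_X :: "(nat \<Rightarrow> 'a) set \<Rightarrow> 'b"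
    and k_A :: "'a \<Rightarrow> 'b"
  assumes "cstar_algebra A"
    and "endo_action A \<alpha>"
    and "\<And>n. extendible A (\<alpha> n)"
    and "\<And>n. inj_on (\<alpha> n) (carrier A)"
    and "\<And>n. hereditary_subalgebra (\<alpha> n ` carrier A) A"
    and "L = transfer_op A \<alpha>"
    and "X = dyn_product_system A \<alpha> L"
    and "K = range_ideal A \<alpha>"
    and "ps_relative_cuntz_pimsner A X K D i"
    and "relative_cuntz_pimsner A (fibre X 1) (K 1) E k_X k_A"
  shows "cstar_isomorphic D E"
proof -
  interpret S: dyn_system A \<alpha> using assms(1-5) by (intro dyn_system.intro dyn_system_axioms.intro)
  have X: "X = dyn_product_system A \<alpha> S.L" using assms(6,7) by simp
  have fib: "fibre X 1 = dyn_fibre A \<alpha> S.L 1" by (simp add: X dyn_product_system_def)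
  have D: "cstar_algebra D" "ps_toeplitz_rep A X D i" "ps_coisometric A X K D i"
    "cstar_generated D (i ` ps_carrier X) = carrier D"
    and D_univ: "\<And>C \<psi>. \<lbrakk>cstar_algebra C; ps_toeplitz_rep A X C \<psi>; ps_coisometric A X K C \<psi>\<rbrakk>
      \<Longrightarrow> \<exists>\<rho> \<in> cstar_hom D (C :: 'b cstar). \<forall>u\<in>ps_carrier X. \<rho> (i u) = \<psi> u"
    using assms(9) by (auto simp: ps_relative_cuntz_pimsner_def)
  have E: "cstar_algebra E" "toeplitz_rep A (fibre X 1) E k_X k_A" "coisometric A (fibre X 1) (K 1) E k_X k_A"
    "cstar_generated E (k_X ` carrier (fibre X 1) \<union> k_A ` carrier A) = carrier E"
    and E_univ: "\<And>C \<psi> \<pi>. \<lbrakk>cstar_algebra C; toeplitz_rep A (fibre X 1) C \<psi> \<pi>; coisometric A (fibre X 1) (K 1) C \<psi> \<pi>\<rbrakk>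
      \<Longrightarrow> \<exists>\<rho> \<in> cstar_hom E (C :: 'b cstar).
        (\<forall>u\<in>carrier (fibre X 1). \<rho> (k_X u) = \<psi> u) \<and> (\<forall>a\<in>carrier A. \<rho> (k_A a) = \<pi> a)"
    using assms(10) by (auto simp: relative_cuntz_pimsner_def)
  interpret E: dyn_rep A \<alpha> E k_X k_A
    using E fib assms(8)
    by (intro dyn_rep.intro dyn_rep_axioms.intro S.dyn_system_axioms) simp_all
  \<comment> \<open>E has the type of D, so it is an admissible test algebra for D; the next step
    uses D as test algebra for E.\<close>
  obtain \<sigma> where s: "\<sigma> \<in> cstar_hom D E" "\<And>u. u \<in> ps_carrier X \<Longrightarrow> \<sigma> (i u) = E.ext_rep u"
    using D_univ[OF E(1)] E.ext_rep_ps assms(8) X by metis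
  obtain \<rho> where r: "\<rho> \<in> cstar_hom E D" "\<And>u. u \<in> carrier (fibre X 1) \<Longrightarrow> \<rho> (k_X u) = i (1, u)"
    "\<And>a. a \<in> carrier A \<Longrightarrow> \<rho> (k_A a) = coeff_rep X i a"
    using E_univ[OF D(1), of "fibre_rep i 1" "coeff_rep X i"] D(2,3)
    by (auto simp: ps_toeplitz_rep_def ps_coisometric_def fibre_rep_def)
  have car: "ps_carrier X = {(n, S.e n x) | n x. x \<in> S.V n}" unfolding X by (rule E.ps_carrier_eq)
  \<comment> \<open>Generators of D come from all fibres; those above 1 are the reason for
    \<open>psi_intertwine\<close>.\<close>
  have rs: "\<rho> (\<sigma> z) = z" if "z \<in> carrier D" for z
  proof (rule hom_eq_id[OF D(1) hom_compose[OF s(1) r(1)] D(4) _ _ that])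
    show "i ` ps_carrier X \<subseteq> carrier D"
      using D(2) by (auto simp: ps_toeplitz_rep_def toeplitz_rep_def ps_carrier_def fibre_rep_def)
    fix z assume "z \<in> i ` ps_carrier X"
    then obtain n x where x: "x \<in> S.V n" "z = i (n, S.e n x)" by (auto simp: car)
    have "\<rho> (E.psi n x) = i (n, S.e n x)"
      using D(2) r x fib unfolding X by (intro E.psi_intertwine[OF D(1) _ r(1)]) auto
    moreover have "\<sigma> (i (n, S.e n x)) = E.psi n x" using s(2)[of "(n, S.e n x)"] x car by auto
    ultimately show "\<rho> (\<sigma> z) = z" using x by simp
  qed
  \<comment> \<open>Generators of E come from A and the first fibre only, where the extension agrees
    with \<open>k_A\<close> and \<open>k_X\<close>.\<close>
  have sr: "\<sigma> (\<rho> z) = z" if "z \<in> carrier E" for z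
  proof (rule hom_eq_id[OF E(1) hom_compose[OF r(1) s(1)] E(4) _ _ that])
    show "k_X ` carrier (fibre X 1) \<union> k_A ` carrier A \<subseteq> carrier E"
      using E(2) by (auto simp: toeplitz_rep_def cstar_hom_def)
    fix z assume "z \<in> k_X ` carrier (fibre X 1) \<union> k_A ` carrier A"
    then consider x where "x \<in> S.V 1" "z = k_X (S.e 1 x)" | a where "a \<in> carrier A" "z = k_A a"
      unfolding fib S.fibre_carrier by blast
    then show "\<sigma> (\<rho> z) = z"
    proof cases
      case 1
      have "\<rho> z = i (1, S.e 1 x)" using 1 r(2)[of "S.e 1 x"] fib S.fibre_carrier by auto
      moreover have "\<sigma> (i (1, S.e 1 x)) = E.psi 1 x" using s(2)[of "(1, S.e 1 x)"] 1 car by auto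
      ultimately show ?thesis using E.psi_1[OF 1(1)] 1 by simp
    next
      case 2
      have "\<rho> z = i (0, S.e 0 a)" using 2 r(3) by (simp add: coeff_rep_def X dyn_product_system_def)
      moreover have "\<sigma> (i (0, S.e 0 a)) = E.psi 0 a" using s(2)[of "(0, S.e 0 a)"] 2 car S.V_0 by auto
      ultimately show ?thesis using 2 by simp
    qed
  qed
  have "bij_betw \<sigma> (carrier D) (carrier E)"
    using rs sr homD(1)[OF s(1)] homD(1)[OF r(1)] by (intro bij_betwI[of _ _ _ \<rho>]) auto
  then show ?thesis using s(1) by (auto simp: cstar_isomorphic_def)
qed

end
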